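(* Let $X$ be a sigma-finite measure space with measure denoted $dx$, let $t$ be a closed non-negative quadratic form in $L^2(X)$ with domain $\mathrm{dom}\,t$, and let $T$ be the corresponding self-adjoint operator. Let $(\kappa,\gamma)\in(0,\infty)\times(0,\infty)$ and $(q,\theta)\in(2,\infty)\times(0,1)$ be related by $$ \gamma=\frac{q(1-\theta)}{q-2},\qquad \kappa=\frac{q\theta}{q-2}, $$ equivalently $$ q=\frac{2(\gamma+\kappa)}{\gamma+\kappa-1},\qquad \theta=\frac{\kappa}{\gamma+\kappa}, $$ and assume that $\gamma+\kappa>1$. Assume that $t$ satisfies the generalized Beurling--Deny conditions with parameter $\gamma+\kappa$. Then the following are equivalent: (1) $T$ satisfies a Sobolev interpolation inequality with exponent $q$, that is, there is a constant $S>0$ such that for all $u\in\mathrm{dom}\,t$, $$ t[u]^{\theta}\,\|u\|^{2(1-\theta)}\ \geq\ S\left(\int_X|u|^q\,dx\right)^{2/q}. $$ (2) $T$ satisfies a weak LT inequality with exponent $\kappa$, that is, there is a constant $L>0$ such that for all $0\leq V\in L^{\gamma+\kappa}(X)$ and all $\tau>0$, $$ N(-\tau,T-V)\ \leq\ L\,\tau^{-\gamma}\int_X V^{\gamma+\kappa}\,dx. $$ Moreover, the respective sharp constants (the largest possible $S$ in (1) and the smallest possible $L$ in (2)) satisfy $$ \left(\theta^{-\theta}(1-\theta)^{-1+\theta}S\right)^{-\gamma-\kappa}\ \leq\ L\ \leq\ e^{\gamma+\kappa-1}\left(\theta^{-\theta}(1-\theta)^{-1+\theta}S\right)^{-\gamma-\kappa}.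 $$
   Context: $L^2(X)$ is the complex Hilbert space of square-integrable functions with respect to $dx$, with norm $\|\cdot\|$; $L^p(X)$ is the usual $L^p$ space, and for a non-negative function $w$ on $X$, $L^p(X,w)$ is the $L^p$ space with respect to the measure $w(x)\,dx$. The form $t$ is densely defined (so that $T$ exists). Generalized Beurling--Deny conditions with parameter $p\in(1,\infty)$ (here used with $p=\gamma+\kappa$): (i) if $u,v\in\mathrm{dom}\,t$ are real-valued then $t[u+iv]=t[u]+t[v]$; (ii) if $u\in\mathrm{dom}\,t$ is real-valued then $|u|\in\mathrm{dom}\,t$ and $t[|u|]\leq t[u]$; (iii) there is a measurable, a.e. positive function $\omega$ on $X$ such that if $u\in\mathrm{dom}\,t$ is non-negative then $\min(u,\omega)\in\mathrm{dom}\,t$ and $t[\min(u,\omega)]\leq t[u]$; moreover, there is a form core $\mathcal Q$ of $t$ such that $\omega^{-1}\mathcal Q$ is dense in $L^2(X,\omega^{2p/(p-1)})$. For $\tau\geq0$, $N(-\tau,T-V)$ denotes the number of eigenvalues of the operator $T-V$ less than $-\tau$, counted with multiplicity. The operator $T-V$ is understood in the sense of quadratic forms, and by the variational principle $N(-\tau,T-V)$ is the supremum of $\dim M$ over subspaces $M\subset\mathrm{dom}\,t$ such that $t[u]+\tau\int_X|u|^2\,dx<\int_X V|u|^2\,dx$ for all $0\neq u\in M$.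
   Formalization: Condition (i) is strengthened: for real-valued u, v in L^2, u+iv in dom t also forces u and v in dom t (the domain is invariant under complex conjugation); without this the bound on L fails for domains containing no nonzero real function. *)

theory Defs
  imports "HOL-Analysis.Analysis"
begin

text \<open>
  Elements of \<open>L\<^sup>2(X)\<close> are represented by measurable functions; all notions below are
  invariant under modification on null sets.
\<close>

definition L2 :: "'a measure \<Rightarrow> ('a \<Rightarrow> complex) set" where
  "L2 M = {u \<in> borel_measurable M. integrable M (\<lambda>x. (cmod (u x))\<^sup>2)}"

definition L2_inner :: "'a measure \<Rightarrow> ('a \<Rightarrow> complex) \<Rightarrow> ('a \<Rightarrow> complex) \<Rightarrow> complex" where
  "L2_inner M u v = (\<integral>x. u x * cnj (v x) \<partial>M)"

definition L2_norm :: "'a measure \<Rightarrow> ('a \<Rightarrow> complex) \<Rightarrow> real" where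
  "L2_norm M u = sqrt (\<integral>x. (cmod (u x))\<^sup>2 \<partial>M)"

definition dense_in_L2 :: "'a measure \<Rightarrow> ('a \<Rightarrow> complex) set \<Rightarrow> bool" where
  "dense_in_L2 M A \<longleftrightarrow>
     A \<subseteq> L2 M \<and> (\<forall>f\<in>L2 M. \<forall>e>0. \<exists>u\<in>A. L2_norm M (\<lambda>x. f x - u x) < e)"

definition fun_subspace :: "('a \<Rightarrow> complex) set \<Rightarrow> bool" where
  "fun_subspace D \<longleftrightarrow> (\<lambda>x. 0) \<in> D \<and>
     (\<forall>u\<in>D. \<forall>v\<in>D. \<forall>a b. (\<lambda>x. a * u x + b * v x) \<in> D)"

text \<open>Dimension modulo functions vanishing almost everywhere.\<close>

definition ae_independent :: "'a measure \<Rightarrow> ('a \<Rightarrow> complex) set \<Rightarrow> bool" where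
  "ae_independent M F \<longleftrightarrow>
     (\<forall>c. (AE x in M. (\<Sum>u\<in>F. c u * u x) = 0) \<longrightarrow> (\<forall>u\<in>F. c u = 0))"

definition ae_dim :: "'a measure \<Rightarrow> ('a \<Rightarrow> complex) set \<Rightarrow> ennreal" where
  "ae_dim M E = Sup {of_nat (card F) | F. finite F \<and> F \<subseteq> E \<and> ae_independent M F}"


section \<open>Quadratic forms\<close>

text \<open>
  A form is given by its domain \<open>D\<close> and its sesquilinear form \<open>t\<close> (linear in the first
  argument, values outside \<open>D\<close> irrelevant); the quadratic form is \<open>t[u] = t(u,u)\<close>, which is real.
\<close>

definition hermitian_form ::
    "'a measure \<Rightarrow> ('a \<Rightarrow> complex) set \<Rightarrow> (('a \<Rightarrow> complex) \<Rightarrow> ('a \<Rightarrow> complex) \<Rightarrow> complex) \<Rightarrow> bool" where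
  "hermitian_form M D t \<longleftrightarrow>
     D \<subseteq> L2 M \<and> fun_subspace D \<and>
     (\<forall>u\<in>D. \<forall>u'\<in>borel_measurable M. (AE x in M. u x = u' x) \<longrightarrow>
        u' \<in> D \<and> (\<forall>w\<in>D. t u' w = t u w)) \<and>
     (\<forall>u\<in>D. \<forall>v\<in>D. \<forall>w\<in>D. \<forall>a b.
        t (\<lambda>x. a * u x + b * v x) w = a * t u w + b * t v w) \<and>
     (\<forall>u\<in>D. \<forall>v\<in>D. t v u = cnj (t u v))"

definition quad ::
    "(('a \<Rightarrow> complex) \<Rightarrow> ('a \<Rightarrow> complex) \<Rightarrow> complex) \<Rightarrow> ('a \<Rightarrow> complex) \<Rightarrow> real" where
  "quad t u = Re (t u u)"

definition nonneg_form ::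
    "('a \<Rightarrow> complex) set \<Rightarrow> (('a \<Rightarrow> complex) \<Rightarrow> ('a \<Rightarrow> complex) \<Rightarrow> complex) \<Rightarrow> bool" where
  "nonneg_form D t \<longleftrightarrow> (\<forall>u\<in>D. 0 \<le> quad t u)"

definition semibounded_form ::
    "'a measure \<Rightarrow> ('a \<Rightarrow> complex) set \<Rightarrow> (('a \<Rightarrow> complex) \<Rightarrow> ('a \<Rightarrow> complex) \<Rightarrow> complex) \<Rightarrow> bool" where
  "semibounded_form M D t \<longleftrightarrow> (\<exists>c. \<forall>u\<in>D. - c * (L2_norm M u)\<^sup>2 \<le> quad t u)"

text \<open>Closedness in the sense of Kato; meaningful for semibounded forms.\<close>

definition closed_form ::
    "'a measure \<Rightarrow> ('a \<Rightarrow> complex) set \<Rightarrow> (('a \<Rightarrow> complex) \<Rightarrow> ('a \<Rightarrow> complex) \<Rightarrow> complex) \<Rightarrow> bool" where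
  "closed_form M D t \<longleftrightarrow>
     (\<forall>U u. (\<forall>n::nat. U n \<in> D) \<and> u \<in> L2 M \<and>
        (\<lambda>n. L2_norm M (\<lambda>x. U n x - u x)) \<longlonglongrightarrow> 0 \<and>
        (\<forall>e>0. \<exists>n0. \<forall>m\<ge>n0. \<forall>n\<ge>n0. \<bar>quad t (\<lambda>x. U m x - U n x)\<bar> < e) \<longrightarrow>
        u \<in> D \<and> (\<lambda>n. quad t (\<lambda>x. U n x - u x)) \<longlonglongrightarrow> 0)"

definition form_core ::
    "'a measure \<Rightarrow> ('a \<Rightarrow> complex) set \<Rightarrow> (('a \<Rightarrow> complex) \<Rightarrow> ('a \<Rightarrow> complex) \<Rightarrow> complex) \<Rightarrow>
     ('a \<Rightarrow> complex) set \<Rightarrow> bool" where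
  "form_core M D t Q \<longleftrightarrow> Q \<subseteq> D \<and> fun_subspace Q \<and>
     (\<forall>u\<in>D. \<forall>e>0. \<exists>v\<in>Q.
        quad t (\<lambda>x. u x - v x) + (L2_norm M (\<lambda>x. u x - v x))\<^sup>2 < e)"


section \<open>Generalized Beurling--Deny conditions\<close>

definition ae_real :: "'a measure \<Rightarrow> ('a \<Rightarrow> complex) \<Rightarrow> bool" where
  "ae_real M u \<longleftrightarrow> (AE x in M. Im (u x) = 0)"

definition ae_nonneg :: "'a measure \<Rightarrow> ('a \<Rightarrow> complex) \<Rightarrow> bool" where
  "ae_nonneg M u \<longleftrightarrow> (AE x in M. Im (u x) = 0 \<and> 0 \<le> Re (u x))"

text \<open>
  In the first condition the identity \<open>t[u + iv] = t[u] + t[v]\<close> is read in \<open>[0,\<infinity>]\<close>, with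
  \<open>t = \<infinity>\<close> off \<open>D\<close>: the domain is the complexification of its real part. Without this the
  conditions are void for a form whose domain contains no nonzero real-valued function.
\<close>

definition gen_beurling_deny ::
    "'a measure \<Rightarrow> ('a \<Rightarrow> complex) set \<Rightarrow> (('a \<Rightarrow> complex) \<Rightarrow> ('a \<Rightarrow> complex) \<Rightarrow> complex) \<Rightarrow>
     real \<Rightarrow> bool" where
  "gen_beurling_deny M D t p \<longleftrightarrow>
     (\<forall>u\<in>L2 M. \<forall>v\<in>L2 M. ae_real M u \<and> ae_real M v \<longrightarrow>
        ((\<lambda>x. u x + \<i> * v x) \<in> D \<longleftrightarrow> u \<in> D \<and> v \<in> D) \<and>
        (u \<in> D \<and> v \<in> D \<longrightarrow> quad t (\<lambda>x. u x + \<i> * v x) = quad t u + quad t v)) \<and>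
     (\<forall>u\<in>D. ae_real M u \<longrightarrow>
        (\<lambda>x. of_real (cmod (u x))) \<in> D \<and>
        quad t (\<lambda>x. of_real (cmod (u x))) \<le> quad t u) \<and>
     (\<exists>\<omega>\<in>borel_measurable M. (AE x in M. 0 < \<omega> x) \<and>
        (\<forall>u\<in>D. ae_nonneg M u \<longrightarrow>
           (\<lambda>x. of_real (min (Re (u x)) (\<omega> x))) \<in> D \<and>
           quad t (\<lambda>x. of_real (min (Re (u x)) (\<omega> x))) \<le> quad t u) \<and>
        (\<exists>Q. form_core M D t Q \<and>
           dense_in_L2 (density M (\<lambda>x. ennreal (\<omega> x powr (2 * p / (p - 1)))))
             ((\<lambda>u x. u x / of_real (\<omega> x)) ` Q)))"


section \<open>Operators and counting of eigenvalues\<close>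

text \<open>
  Operators in \<open>L\<^sup>2(X)\<close> are represented by their graphs. The operator of a densely defined
  closed semibounded form is the one of the first representation theorem.
\<close>

definition form_operator ::
    "'a measure \<Rightarrow> ('a \<Rightarrow> complex) set \<Rightarrow> (('a \<Rightarrow> complex) \<Rightarrow> ('a \<Rightarrow> complex) \<Rightarrow> complex) \<Rightarrow>
     (('a \<Rightarrow> complex) \<times> ('a \<Rightarrow> complex)) set" where
  "form_operator M D t =
     {(u, f). u \<in> D \<and> f \<in> L2 M \<and> (\<forall>v\<in>D. t u v = L2_inner M f v)}"

definition eigenspace ::
    "(('a \<Rightarrow> complex) \<times> ('a \<Rightarrow> complex)) set \<Rightarrow> complex \<Rightarrow> ('a \<Rightarrow> complex) set" where
  "eigenspace A z = {u. (u, \<lambda>x. z * u x) \<in> A}"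

definition is_eigenvalue ::
    "'a measure \<Rightarrow> (('a \<Rightarrow> complex) \<times> ('a \<Rightarrow> complex)) set \<Rightarrow> complex \<Rightarrow> bool" where
  "is_eigenvalue M A z \<longleftrightarrow> (\<exists>u\<in>eigenspace A z. \<not> (AE x in M. u x = 0))"

definition resolvent_set ::
    "'a measure \<Rightarrow> (('a \<Rightarrow> complex) \<times> ('a \<Rightarrow> complex)) set \<Rightarrow> complex set" where
  "resolvent_set M A = {z.
     (\<forall>g\<in>L2 M. \<exists>(u, f)\<in>A. AE x in M. f x - z * u x = g x) \<and>
     (\<exists>C. \<forall>(u, f)\<in>A. L2_norm M u \<le> C * L2_norm M (\<lambda>x. f x - z * u x))}"

text \<open>
  The number of eigenvalues of a self-adjoint operator below \<open>b\<close>, counted with multiplicity, with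
  the usual convention that it is infinite if there is essential spectrum below \<open>b\<close>. It suffices
  to impose this for spectral points that are not eigenvalues: if all spectral points below \<open>b\<close> are
  eigenvalues and one of them has infinite multiplicity or is not isolated, the sum is infinite
  anyway.
\<close>

definition eigenvalue_count ::
    "'a measure \<Rightarrow> (('a \<Rightarrow> complex) \<times> ('a \<Rightarrow> complex)) set \<Rightarrow> real \<Rightarrow> ennreal" where
  "eigenvalue_count M A b =
     (if \<exists>l<b. complex_of_real l \<notin> resolvent_set M A \<and> \<not> is_eigenvalue M A (complex_of_real l)
      then \<infinity>
      else (\<Sum>\<^sub>\<infinity>l\<in>{..<b}. ae_dim M (eigenspace A (complex_of_real l))))"

definition form_minus ::
    "'a measure \<Rightarrow> (('a \<Rightarrow> complex) \<Rightarrow> ('a \<Rightarrow> complex) \<Rightarrow> complex) \<Rightarrow> ('a \<Rightarrow> real) \<Rightarrow>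
     ('a \<Rightarrow> complex) \<Rightarrow> ('a \<Rightarrow> complex) \<Rightarrow> complex" where
  "form_minus M t V u v = t u v - (\<integral>x. of_real (V x) * u x * cnj (v x) \<partial>M)"

text \<open>\<open>T - V\<close> exists in the sense of quadratic forms.\<close>

definition form_sum_exists ::
    "'a measure \<Rightarrow> ('a \<Rightarrow> complex) set \<Rightarrow> (('a \<Rightarrow> complex) \<Rightarrow> ('a \<Rightarrow> complex) \<Rightarrow> complex) \<Rightarrow>
     ('a \<Rightarrow> real) \<Rightarrow> bool" where
  "form_sum_exists M D t V \<longleftrightarrow>
     (\<forall>u\<in>D. integrable M (\<lambda>x. V x * (cmod (u x))\<^sup>2)) \<and>
     semibounded_form M D (form_minus M t V) \<and> closed_form M D (form_minus M t V)"


section \<open>The two inequalities and their sharp constants\<close>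

definition sobolev_interp ::
    "'a measure \<Rightarrow> ('a \<Rightarrow> complex) set \<Rightarrow> (('a \<Rightarrow> complex) \<Rightarrow> ('a \<Rightarrow> complex) \<Rightarrow> complex) \<Rightarrow>
     real \<Rightarrow> real \<Rightarrow> real \<Rightarrow> bool" where
  "sobolev_interp M D t q \<theta> S \<longleftrightarrow>
     (\<forall>u\<in>D. integrable M (\<lambda>x. cmod (u x) powr q) \<and>
        quad t u powr \<theta> * L2_norm M u powr (2 * (1 - \<theta>))
          \<ge> S * (\<integral>x. cmod (u x) powr q \<partial>M) powr (2 / q))"

definition weak_LT ::
    "'a measure \<Rightarrow> ('a \<Rightarrow> complex) set \<Rightarrow> (('a \<Rightarrow> complex) \<Rightarrow> ('a \<Rightarrow> complex) \<Rightarrow> complex) \<Rightarrow>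
     real \<Rightarrow> real \<Rightarrow> real \<Rightarrow> bool" where
  "weak_LT M D t \<gamma> \<kappa> L \<longleftrightarrow>
     (\<forall>V\<in>borel_measurable M.
        (AE x in M. 0 \<le> V x) \<and> integrable M (\<lambda>x. V x powr (\<gamma> + \<kappa>)) \<longrightarrow>
        form_sum_exists M D t V \<and>
        (\<forall>\<tau>>0. eigenvalue_count M (form_operator M D (form_minus M t V)) (- \<tau>)
           \<le> ennreal (L * \<tau> powr (- \<gamma>) * (\<integral>x. V x powr (\<gamma> + \<kappa>) \<partial>M))))"

definition sharp_sobolev ::
    "'a measure \<Rightarrow> ('a \<Rightarrow> complex) set \<Rightarrow> (('a \<Rightarrow> complex) \<Rightarrow> ('a \<Rightarrow> complex) \<Rightarrow> complex) \<Rightarrow>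
     real \<Rightarrow> real \<Rightarrow> real \<Rightarrow> bool" where
  "sharp_sobolev M D t q \<theta> S \<longleftrightarrow> 0 < S \<and> sobolev_interp M D t q \<theta> S \<and>
     (\<forall>S'>0. sobolev_interp M D t q \<theta> S' \<longrightarrow> S' \<le> S)"

definition sharp_LT ::
    "'a measure \<Rightarrow> ('a \<Rightarrow> complex) set \<Rightarrow> (('a \<Rightarrow> complex) \<Rightarrow> ('a \<Rightarrow> complex) \<Rightarrow> complex) \<Rightarrow>
     real \<Rightarrow> real \<Rightarrow> real \<Rightarrow> bool" where
  "sharp_LT M D t \<gamma> \<kappa> L \<longleftrightarrow> 0 < L \<and> weak_LT M D t \<gamma> \<kappa> L \<and>
     (\<forall>L'>0. weak_LT M D t \<gamma> \<kappa> L' \<longrightarrow> L \<le> L')"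

end

theory Submission
  imports Defs
begin

text \<open>
  Throughout, \<open>p = \<gamma> + \<kappa>\<close>, so that \<open>q = 2p/(p - 1)\<close>, and \<open>t\<^sub>\<tau>[u] = t[u] + \<tau> \<parallel>u\<parallel>\<^sup>2\<close>. By the weighted
  inequality of arithmetic and geometric means, the interpolation inequality gives for every
  \<open>\<tau> > 0\<close> the Sobolev inequality \<open>t\<^sub>\<tau>[u] \<ge> S\<^sub>\<tau> \<parallel>u\<parallel>\<^sub>q\<^sup>2\<close> with \<open>S\<^sub>\<tau>\<close> equal to \<open>\<tau>\<^bsup>1-\<theta>\<^esup>\<close> times the normalized
  constant of the theorem, and optimizing over \<open>\<tau>\<close> leads back.

  From the Sobolev inequality to the bound on eigenvalues (\<open>orthonormal_card_bound\<close>,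
  \<open>sobolev_imp_weak_LT\<close>). The argument is that of Li and Yau, with the resolvent in place of the
  heat semigroup. Let \<open>A\<close> be the operator of the form \<open>t\<^sub>\<tau>\<close> in the weighted space \<open>L\<^sup>2(V)\<close>; the aim is to
  bound the number of \<open>L\<^sup>2(V)\<close>-orthonormal functions \<open>\<psi>\<close> with \<open>t\<^sub>\<tau>[\<psi>] \<le> 1\<close>. Let
  \<open>R = (1 + \<epsilon> A)\<^sup>-\<^sup>1\<close>. The Beurling--Deny conditions make \<open>R\<close> positivity preserving (\<open>R_nonneg\<close>). For a
  finite \<open>L\<^sup>2(V)\<close>-orthonormal family of non-negative functions \<open>\<phi>\<^sub>i\<close> put
  \<open>h\<^sub>k = \<Sum>\<^sub>i \<langle>\<phi>\<^sub>i, A\<^sup>-\<^sup>1 R\<^sup>2\<^sup>k \<phi>\<^sub>i\<rangle>\<close> and \<open>g\<^sub>k = \<Sum>\<^sub>i \<parallel>R\<^sup>k \<phi>\<^sub>i\<parallel>\<^sup>2\<close>. Then \<open>h\<^sub>k - h\<^sub>k\<^sub>+\<^sub>1 \<ge> 2 \<epsilon> g\<^sub>k\<^sub>+\<^sub>1\<close> (\<open>decrement\<close>), while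
  duality, Hoelder's inequality for the non-negative functions \<open>R\<^sup>k \<phi>\<^sub>i\<close> and Bessel's inequality give
  \<open>h\<^sub>k \<le> S\<^sub>\<tau>\<^sup>-\<^sup>1 g\<^sub>k\<^bsup>1-1/p\<^esup> (\<integral>V\<^sup>p)\<^bsup>1/p\<^esup>\<close> (\<open>family_step\<close>). These two inequalities are a discrete version of a
  differential inequality and force \<open>h\<^sub>k\<close> to decay (\<open>family_decay\<close>) at a rate that depends neither on the
  family nor, as \<open>\<epsilon> \<rightarrow> 0\<close> with \<open>2 k \<epsilon>\<close> fixed, on its initial value. Each \<open>\<psi>\<close> contributes at least
  \<open>(1 + \<epsilon>)\<^sup>-\<^sup>2\<^sup>k\<close> to the corresponding sum (\<open>rayleigh_lower_bound\<close>), and the functions \<open>\<psi>\<close> are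
  approximated by linear combinations of normalized indicator functions \<open>\<phi>\<^sub>i\<close>
  (\<open>nonneg_orthonormal_approx\<close>, \<open>trace_contraction\<close>). The choice \<open>2 k \<epsilon> = p - 1\<close> gives the factor
  \<open>e\<^bsup>p-1\<^esup>\<close>. Working with finite families makes it unnecessary to know beforehand that any trace is
  finite or that \<open>R\<close> has an integral kernel.

  It remains to pass from subspaces on which the form of \<open>T - V\<close> is below \<open>-\<tau>\<close> to eigenvalues. Since the
  dimension of such subspaces is bounded, \<open>T - V - l\<close> with \<open>l < -\<tau>\<close> is a finite rank perturbation of a
  form that is bounded below by a positive constant, so that \<open>l\<close> is either in the resolvent set or an
  eigenvalue (\<open>resolvent_or_eigenvalue\<close>), and eigenfunctions of distinct eigenvalues are orthogonal.

  Conversely, if the bound on the number of eigenvalues below \<open>-\<tau>\<close> is less than one, then \<open>T - V \<ge> -\<tau>\<close>,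
  because the infimum of the Rayleigh quotient is not in the resolvent set (\<open>eigenvalue_below\<close>). The
  interpolation inequality follows by inserting for \<open>V\<close> multiples of truncations of \<open>\<bar>u\<bar>\<^bsup>q-2\<^esup>\<close> and
  optimizing over \<open>\<tau>\<close> (\<open>weak_LT_imp_sobolev\<close>). Both directions come with explicit constants, which gives
  the inequalities between the sharp ones.
\<close>

section \<open>Semi-definite Hermitian forms on spaces of functions\<close>

text \<open>
  A sesquilinear Hermitian form on a space of functions, linear in the first argument. Functions
  are not identified when they agree almost everywhere, so that \<open>L\<^sup>2\<close>, the domain of a quadratic form
  and \<open>\<complex>\<^sup>n\<close> are all instances.
\<close>

locale herm_form =
  fixes H :: "('a \<Rightarrow> complex) set" and s :: "('a \<Rightarrow> complex) \<Rightarrow> ('a \<Rightarrow> complex) \<Rightarrow> complex"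
  assumes subspace: "fun_subspace H"
    and lin: "u \<in> H \<Longrightarrow> v \<in> H \<Longrightarrow> w \<in> H \<Longrightarrow> s (\<lambda>x. a * u x + b * v x) w = a * s u w + b * s v w"
    and herm: "u \<in> H \<Longrightarrow> v \<in> H \<Longrightarrow> s v u = cnj (s u v)"
begin

lemma comb_in: "u \<in> H \<Longrightarrow> v \<in> H \<Longrightarrow> (\<lambda>x. a * u x + b * v x) \<in> H"
  using subspace unfolding fun_subspace_def by blast

lemma zero_in: "(\<lambda>x. 0) \<in> H"
  using subspace unfolding fun_subspace_def by blast

lemma scale_in: "u \<in> H \<Longrightarrow> (\<lambda>x. a * u x) \<in> H"
  using comb_in[of u u a 0] by simp

lemma add_in: "u \<in> H \<Longrightarrow> v \<in> H \<Longrightarrow> (\<lambda>x. u x + v x) \<in> H"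
  using comb_in[of u v 1 1] by simp

lemma diff_in: "u \<in> H \<Longrightarrow> v \<in> H \<Longrightarrow> (\<lambda>x. u x - v x) \<in> H"
  using comb_in[of u v 1 "-1"] by simp

lemma sum_in: "(\<And>i. i \<in> I \<Longrightarrow> u i \<in> H) \<Longrightarrow> (\<lambda>x. \<Sum>i\<in>I. c i * u i x) \<in> H"
proof (induction I rule: infinite_finite_induct)
  case (insert i I)
  then have "(\<lambda>x. c i * u i x + 1 * (\<Sum>i\<in>I. c i * u i x)) \<in> H"
    by (intro comb_in) auto
  then show ?case using insert by simp
qed (simp_all add: zero_in)

lemma lin_right:
  "u \<in> H \<Longrightarrow> v \<in> H \<Longrightarrow> w \<in> H \<Longrightarrow> s w (\<lambda>x. a * u x + b * v x) = cnj a * s w u + cnj b * s w v"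
  using herm[of "\<lambda>x. a * u x + b * v x" w] herm[of u w] herm[of v w] lin[of u v w a b] comb_in[of u v a b]
  by simp

lemma scale_left: "u \<in> H \<Longrightarrow> w \<in> H \<Longrightarrow> s (\<lambda>x. a * u x) w = a * s u w"
  using lin[of u u w a 0] by simp

lemma scale_right: "u \<in> H \<Longrightarrow> w \<in> H \<Longrightarrow> s w (\<lambda>x. a * u x) = cnj a * s w u"
  using lin_right[of u u w a 0] by simp

lemma add_left: "u \<in> H \<Longrightarrow> v \<in> H \<Longrightarrow> w \<in> H \<Longrightarrow> s (\<lambda>x. u x + v x) w = s u w + s v w"
  using lin[of u v w 1 1] by simp

lemma diff_left: "u \<in> H \<Longrightarrow> v \<in> H \<Longrightarrow> w \<in> H \<Longrightarrow> s (\<lambda>x. u x - v x) w = s u w - s v w"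
  using lin[of u v w 1 "-1"] by simp

lemma zero_left: "w \<in> H \<Longrightarrow> s (\<lambda>x. 0) w = 0"
  using scale_left[of w w 0] by simp

lemma sum_left:
  "(\<And>i. i \<in> I \<Longrightarrow> u i \<in> H) \<Longrightarrow> w \<in> H \<Longrightarrow> s (\<lambda>x. \<Sum>i\<in>I. c i * u i x) w = (\<Sum>i\<in>I. c i * s (u i) w)"
proof (induction I rule: infinite_finite_induct)
  case (insert i I)
  have "s (\<lambda>x. c i * u i x + 1 * (\<Sum>i\<in>I. c i * u i x)) w
      = c i * s (u i) w + 1 * s (\<lambda>x. \<Sum>i\<in>I. c i * u i x) w"
    using insert by (intro lin sum_in) auto
  then show ?case using insert by simp
qed (simp_all add: zero_left)

lemma sum_right:
  assumes "\<And>i. i \<in> I \<Longrightarrow> u i \<in> H" "w \<in> H"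
  shows "s w (\<lambda>x. \<Sum>i\<in>I. c i * u i x) = (\<Sum>i\<in>I. cnj (c i) * s w (u i))"
proof -
  have "s w (\<lambda>x. \<Sum>i\<in>I. c i * u i x) = cnj (s (\<lambda>x. \<Sum>i\<in>I. c i * u i x) w)"
    using assms by (intro herm sum_in) auto
  also have "\<dots> = (\<Sum>i\<in>I. cnj (c i) * cnj (s (u i) w))"
    using assms by (subst sum_left) auto
  also have "\<dots> = (\<Sum>i\<in>I. cnj (c i) * s w (u i))"
    using assms by (intro sum.cong refl) (metis herm)
  finally show ?thesis .
qed

lemma sum_sum:
  assumes "\<And>i. i \<in> I \<Longrightarrow> u i \<in> H" "\<And>i. i \<in> J \<Longrightarrow> v i \<in> H"
  shows "s (\<lambda>x. \<Sum>i\<in>I. c i * u i x) (\<lambda>x. \<Sum>j\<in>J. d j * v j x)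
       = (\<Sum>i\<in>I. \<Sum>j\<in>J. c i * cnj (d j) * s (u i) (v j))"
  using assms by (simp add: sum_left sum_right sum_in sum_distrib_left mult.assoc)

lemma self: "u \<in> H \<Longrightarrow> s u u = of_real (quad s u)"
  using herm[of u u] unfolding quad_def
  by (metis Reals_cnj_iff complex_is_Real_iff of_real_Re)

lemma quad_comb:
  assumes "u \<in> H" "v \<in> H"
  shows "quad s (\<lambda>x. a * u x + b * v x)
       = (cmod a)\<^sup>2 * quad s u + 2 * Re (a * cnj b * s u v) + (cmod b)\<^sup>2 * quad s v"
proof -
  have "s (\<lambda>x. a * u x + b * v x) (\<lambda>x. a * u x + b * v x)
      = a * cnj a * s u u + (a * cnj b * s u v + cnj (a * cnj b * s u v)) + b * cnj b * s v v"
    using assms herm[of u v] by (simp add: lin lin_right comb_in algebra_simps)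
  also have "\<dots> = of_real ((cmod a)\<^sup>2 * quad s u + 2 * Re (a * cnj b * s u v) + (cmod b)\<^sup>2 * quad s v)"
    using assms by (simp only: self complex_add_cnj complex_norm_square[symmetric] of_real_add of_real_mult)
  finally show ?thesis unfolding quad_def[of s "\<lambda>x. a * u x + b * v x"] by simp
qed

lemma quad_add: "u \<in> H \<Longrightarrow> v \<in> H \<Longrightarrow> quad s (\<lambda>x. u x + v x) = quad s u + 2 * Re (s u v) + quad s v"
  using quad_comb[of u v 1 1] by simp

lemma quad_diff: "u \<in> H \<Longrightarrow> v \<in> H \<Longrightarrow> quad s (\<lambda>x. u x - v x) = quad s u - 2 * Re (s u v) + quad s v"
  using quad_comb[of u v 1 "-1"] by simp

lemma quad_scale: "u \<in> H \<Longrightarrow> quad s (\<lambda>x. a * u x) = (cmod a)\<^sup>2 * quad s u"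
  using quad_comb[of u u a 0] by simp

lemma quad_zero: "quad s (\<lambda>x. 0) = 0"
  using zero_left[OF zero_in] by (simp add: quad_def)

end

lemma tendsto_zero_le:
  fixes f g :: "nat \<Rightarrow> real"
  assumes "\<And>n. 0 \<le> f n" "\<And>n. f n \<le> g n" "g \<longlonglongrightarrow> 0"
  shows "f \<longlonglongrightarrow> 0"
  by (rule tendsto_sandwich[OF _ _ tendsto_const assms(3)]) (use assms in auto)

lemma herm_form_add_scaled:
  assumes "herm_form D s" "herm_form H s'" "D \<subseteq> H"
  shows "herm_form D (\<lambda>u v. s u v + of_real c * s' u v)"
proof -
  interpret s: herm_form D s by fact
  interpret s': herm_form H s' by fact
  show ?thesis
  proof
    show "s v u + of_real c * s' v u = cnj (s u v + of_real c * s' u v)" if "u \<in> D" "v \<in> D" for u v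
      using s.herm[OF that] s'.herm[of u v] that assms(3) by auto
  qed (use assms(3) in \<open>auto simp: s.subspace s.lin s'.lin subset_iff algebra_simps\<close>)
qed

text \<open>The discriminant criterion, over the complex numbers.\<close>

lemma quadratic_bound:
  fixes c :: complex
  assumes "\<And>z. 2 * Re (cnj z * c) + (cmod z)\<^sup>2 * Q \<ge> - e" "Q > 0"
  shows "(cmod c)\<^sup>2 \<le> e * Q"
proof -
  \<comment> \<open>the minimizer of the quadratic function\<close>
  have "2 * Re (cnj (- c / of_real Q) * c) + (cmod (- c / of_real Q))\<^sup>2 * Q \<ge> - e" by (rule assms)
  moreover have "Re (cnj (- c / of_real Q) * c) = - (cmod c)\<^sup>2 / Q"
  proof -
    have "cnj (- c / of_real Q) * c = of_real (- (cmod c)\<^sup>2 / Q)"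
      using complex_norm_square[of c] by (simp add: mult.commute)
    then show ?thesis by (simp only: Re_complex_of_real)
  qed
  moreover have "(cmod (- c / of_real Q))\<^sup>2 * Q = (cmod c)\<^sup>2 / Q"
    using assms(2) by (simp add: norm_divide power2_eq_square field_simps)
  ultimately have "(cmod c)\<^sup>2 / Q \<le> e" by linarith
  then show ?thesis using assms(2) by (simp add: field_simps)
qed

text \<open>
  Non-negative forms, possibly degenerate: \<open>quad s u = 0\<close> does not imply \<open>u = 0\<close>.
\<close>

locale psd_form = herm_form +
  assumes nonneg: "u \<in> H \<Longrightarrow> 0 \<le> quad s u"
begin

lemma cauchy_schwarz:
  assumes "u \<in> H" "v \<in> H"
  shows "(cmod (s u v))\<^sup>2 \<le> quad s u * quad s v"
proof -
  \<comment> \<open>\<open>e\<close> covers the case \<open>quad s v = 0\<close>\<close>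
  have *: "(cmod (s u v))\<^sup>2 \<le> quad s u * (quad s v + e)" if e: "e > 0" for e
  proof (rule quadratic_bound)
    fix z
    have "0 \<le> quad s (\<lambda>x. 1 * u x + z * v x)" using assms by (intro nonneg comb_in)
    also have "\<dots> = quad s u + 2 * Re (cnj z * s u v) + (cmod z)\<^sup>2 * quad s v"
      using quad_comb[OF assms, of 1 z] by simp
    finally have "- quad s u \<le> 2 * Re (cnj z * s u v) + (cmod z)\<^sup>2 * quad s v" by linarith
    also have "\<dots> \<le> 2 * Re (cnj z * s u v) + (cmod z)\<^sup>2 * (quad s v + e)"
      using e by (simp add: distrib_left)
    finally show "- quad s u \<le> 2 * Re (cnj z * s u v) + (cmod z)\<^sup>2 * (quad s v + e)" .
  next
    show "0 < quad s v + e" using nonneg[OF assms(2)] e by simp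
  qed
  have "((\<lambda>e. quad s u * (quad s v + e)) \<longlongrightarrow> quad s u * (quad s v + 0)) (at_right 0)"
    by (intro tendsto_intros)
  then have "(cmod (s u v))\<^sup>2 \<le> quad s u * (quad s v + 0)"
    by (rule tendsto_lowerbound) (auto intro!: * eventually_mono[OF eventually_at_right_less])
  then show ?thesis by simp
qed

lemma cauchy_schwarz_sqrt:
  assumes "u \<in> H" "v \<in> H"
  shows "cmod (s u v) \<le> sqrt (quad s u) * sqrt (quad s v)"
  using cauchy_schwarz[OF assms] real_le_rsqrt by (simp add: real_sqrt_mult[symmetric])

lemma null_left: "u \<in> H \<Longrightarrow> v \<in> H \<Longrightarrow> quad s u = 0 \<Longrightarrow> s u v = 0"
  using cauchy_schwarz[of u v] by simp

lemma null_right: "u \<in> H \<Longrightarrow> v \<in> H \<Longrightarrow> quad s v = 0 \<Longrightarrow> s u v = 0"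
  using cauchy_schwarz[of u v] by simp

lemma quad_add_le:
  assumes "u \<in> H" "v \<in> H" "0 < e"
  shows "quad s (\<lambda>x. u x + v x) \<le> (1 + e) * quad s u + (1 + 1 / e) * quad s v"
proof -
  have "0 \<le> quad s (\<lambda>x. of_real (sqrt e) * u x + of_real (- 1 / sqrt e) * v x)"
    using assms by (intro nonneg comb_in)
  also have "\<dots> = e * quad s u - 2 * Re (s u v) + quad s v / e"
    using assms by (subst quad_comb) (auto simp: norm_divide power_divide)
  finally show ?thesis using assms by (simp add: quad_add algebra_simps)
qed

lemma quad_add_le_2:
  assumes "u \<in> H" "v \<in> H"
  shows "quad s (\<lambda>x. u x + v x) \<le> 2 * quad s u + 2 * quad s v"
  using quad_add_le[OF assms, of 1] by simp

lemma quad_diff_le_2: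
  assumes "u \<in> H" "v \<in> H"
  shows "quad s (\<lambda>x. u x - v x) \<le> 2 * quad s u + 2 * quad s v"
  using quad_add_le_2[OF assms(1) scale_in[OF assms(2), of "-1"]] quad_scale[OF assms(2), of "-1"]
  by simp

subsection \<open>Orthonormal families\<close>

text \<open>Finite orthonormal families, indexed by a set.\<close>

definition orthonormal :: "('i \<Rightarrow> 'a \<Rightarrow> complex) \<Rightarrow> 'i set \<Rightarrow> bool" where
  "orthonormal e I \<longleftrightarrow> finite I \<and> (\<forall>i\<in>I. e i \<in> H) \<and> (\<forall>i\<in>I. \<forall>j\<in>I. s (e i) (e j) = (if i = j then 1 else 0))"

lemma orthonormal_quad_sum:
  assumes "orthonormal e I"
  shows "quad s (\<lambda>x. \<Sum>i\<in>I. c i * e i x) = (\<Sum>i\<in>I. (cmod (c i))\<^sup>2)"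
proof -
  have "s (\<lambda>x. \<Sum>i\<in>I. c i * e i x) (\<lambda>x. \<Sum>i\<in>I. c i * e i x)
      = (\<Sum>i\<in>I. \<Sum>j\<in>I. c i * cnj (c j) * s (e i) (e j))"
    using assms by (intro sum_sum) (auto simp: orthonormal_def)
  also have "\<dots> = (\<Sum>i\<in>I. \<Sum>j\<in>I. if j = i then c i * cnj (c i) else 0)"
    using assms by (intro sum.cong refl) (auto simp: orthonormal_def)
  also have "\<dots> = (\<Sum>i\<in>I. of_real ((cmod (c i))\<^sup>2))"
    using assms by (auto simp: orthonormal_def complex_norm_square simp del: of_real_power)
  finally show ?thesis unfolding quad_def by simp
qed

lemma quad_diff_orthonormal:
  assumes "orthonormal e I" "u \<in> H"
  shows "quad s (\<lambda>x. u x - (\<Sum>i\<in>I. c i * e i x))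
       = quad s u - (\<Sum>i\<in>I. (cmod (s u (e i)))\<^sup>2) + (\<Sum>i\<in>I. (cmod (c i - s u (e i)))\<^sup>2)"
proof -
  have H: "i \<in> I \<Longrightarrow> e i \<in> H" for i using assms by (auto simp: orthonormal_def)
  have "quad s (\<lambda>x. u x - (\<Sum>i\<in>I. c i * e i x))
     = quad s u - 2 * Re (\<Sum>i\<in>I. cnj (c i) * s u (e i)) + (\<Sum>i\<in>I. (cmod (c i))\<^sup>2)"
    using assms H by (simp add: quad_diff sum_in sum_right orthonormal_quad_sum)
  also have "\<dots> = quad s u + (\<Sum>i\<in>I. (cmod (c i))\<^sup>2 - 2 * Re (cnj (c i) * s u (e i)))"
    by (simp add: sum_subtractf sum_distrib_left)
  also have "(\<Sum>i\<in>I. (cmod (c i))\<^sup>2 - 2 * Re (cnj (c i) * s u (e i)))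
     = (\<Sum>i\<in>I. (cmod (c i - s u (e i)))\<^sup>2 - (cmod (s u (e i)))\<^sup>2)"
    by (intro sum.cong refl) (simp add: cmod_power2 power2_diff algebra_simps)
  finally show ?thesis by (simp add: sum_subtractf)
qed

lemma best_approximation:
  assumes "orthonormal e I" "u \<in> H"
  shows "quad s (\<lambda>x. u x - (\<Sum>i\<in>I. s u (e i) * e i x)) \<le> quad s (\<lambda>x. u x - (\<Sum>i\<in>I. c i * e i x))"
  using assms by (simp add: quad_diff_orthonormal sum_nonneg)

lemma bessel:
  assumes "orthonormal e I" "u \<in> H"
  shows "(\<Sum>i\<in>I. (cmod (s u (e i)))\<^sup>2) \<le> quad s u"
proof -
  have "0 \<le> quad s (\<lambda>x. u x - (\<Sum>i\<in>I. s u (e i) * e i x))"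
    using assms by (intro nonneg diff_in sum_in) (auto simp: orthonormal_def)
  then show ?thesis using assms by (simp add: quad_diff_orthonormal)
qed

text \<open>A Cholesky factorization of the Gram matrix of a finite family, which may be degenerate.\<close>

lemma gram_factorization:
  assumes "finite I" "\<And>i. i \<in> I \<Longrightarrow> g i \<in> H"
  shows "\<exists>y. \<forall>i\<in>I. \<forall>k\<in>I. s (g i) (g k) = (\<Sum>l\<in>I. y i l * cnj (y k l))"
  using assms
proof (induction I arbitrary: g)
  case (insert n I)
  have gn: "g n \<in> H" and gI: "i \<in> I \<Longrightarrow> g i \<in> H" for i using insert by auto
  show ?case
  proof (cases "quad s (g n) = 0")
    case True
    obtain y where y: "\<forall>i\<in>I. \<forall>k\<in>I. s (g i) (g k) = (\<Sum>l\<in>I. y i l * cnj (y k l))"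
      using insert.IH[of g] gI by blast
    define z where "z i l = (if i = n \<or> l = n then 0 else y i l)" for i l
    have "s (g i) (g k) = (\<Sum>l\<in>insert n I. z i l * cnj (z k l))" if "i \<in> insert n I" "k \<in> insert n I" for i k
    proof (cases "i = n \<or> k = n")
      case True
      then have "s (g i) (g k) = 0" using gn gI that \<open>quad s (g n) = 0\<close> null_left null_right by blast
      moreover have "(\<Sum>l\<in>insert n I. z i l * cnj (z k l)) = 0"
        using True by (intro sum.neutral) (auto simp: z_def)
      ultimately show ?thesis by simp
    next
      case False
      then have "(\<Sum>l\<in>insert n I. z i l * cnj (z k l)) = (\<Sum>l\<in>I. y i l * cnj (y k l))"
        using insert.hyps by (auto simp: z_def intro!: sum.cong)
      then show ?thesis using y that False by auto
    qed
    then show ?thesis by blast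
  next
    case False
    define \<alpha> where "\<alpha> = sqrt (quad s (g n))"
    have \<alpha>: "\<alpha> > 0" "\<alpha>\<^sup>2 = quad s (g n)" using False nonneg[OF gn] by (auto simp: \<alpha>_def)
    have snn: "s (g n) (g n) = of_real (\<alpha>\<^sup>2)" using self[OF gn] \<alpha> by simp
    \<comment> \<open>project out \<open>g n\<close>\<close>
    define \<beta> where "\<beta> i = - s (g i) (g n) / of_real (\<alpha>\<^sup>2)" for i
    define h where "h i = (\<lambda>x. 1 * g i x + \<beta> i * g n x)" for i
    have hH: "i \<in> I \<Longrightarrow> h i \<in> H" for i unfolding h_def using gI gn by (intro comb_in)
    obtain y where y: "\<forall>i\<in>I. \<forall>k\<in>I. s (h i) (h k) = (\<Sum>l\<in>I. y i l * cnj (y k l))"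
      using insert.IH[of h] hH by blast
    define z where "z i l = (if l = n then s (g i) (g n) / of_real \<alpha> else if i = n then 0 else y i l)" for i l
    have sh: "s (h i) (h k) = s (g i) (g k) - s (g i) (g n) * cnj (s (g k) (g n)) / of_real (\<alpha>\<^sup>2)"
      if ik: "i \<in> I" "k \<in> I" for i k
    proof -
      have "s (h i) (h k) = s (g i) (g k) + cnj (\<beta> k) * s (g i) (g n)
          + \<beta> i * (s (g n) (g k) + cnj (\<beta> k) * s (g n) (g n))"
        using lin[OF gI gn hH, of i k 1 "\<beta> i"] lin_right[OF gI gn gI, of k i 1 "\<beta> k"]
          lin_right[OF gI gn gn, of k 1 "\<beta> k"] ik
        by (simp add: h_def)
      then show ?thesis
        using ik gI gn \<alpha>(1) herm[of "g k" "g n"]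
        by (simp add: snn \<beta>_def field_simps power2_eq_square)
    qed
    have "s (g i) (g k) = (\<Sum>l\<in>insert n I. z i l * cnj (z k l))" if ik: "i \<in> insert n I" "k \<in> insert n I" for i k
    proof -
      have zn: "z i n * cnj (z k n) = s (g i) (g n) * cnj (s (g k) (g n)) / of_real (\<alpha>\<^sup>2)"
        by (simp add: z_def power2_eq_square)
      have S: "(\<Sum>l\<in>insert n I. z i l * cnj (z k l)) = z i n * cnj (z k n) + (\<Sum>l\<in>I. z i l * cnj (z k l))"
        using insert.hyps by simp
      show ?thesis
      proof (cases "i = n \<or> k = n")
        case True
        then have "(\<Sum>l\<in>I. z i l * cnj (z k l)) = 0"
          using insert.hyps by (intro sum.neutral) (auto simp: z_def)
        moreover have "s (g i) (g k) = s (g i) (g n) * cnj (s (g k) (g n)) / of_real (\<alpha>\<^sup>2)"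
          using True \<alpha>(1) snn herm[of "g k" "g n"] ik gn gI by (auto simp: power2_eq_square)
        ultimately show ?thesis using zn S by simp
      next
        case False
        then have "(\<Sum>l\<in>I. z i l * cnj (z k l)) = (\<Sum>l\<in>I. y i l * cnj (y k l))"
          using insert.hyps by (intro sum.cong) (auto simp: z_def)
        then show ?thesis using False ik y sh[of i k] zn S by auto
      qed
    qed
    then show ?thesis by blast
  qed
qed auto

text \<open>
  A trace inequality: if \<open>G\<close> is the Gram matrix of the \<open>g i\<close> and \<open>m\<close> is a contraction, then the
  trace of \<open>m G m\<^sup>*\<close> is at most that of \<open>G\<close>.
\<close>

lemma trace_contraction:
  assumes "finite I" "\<And>i. i \<in> I \<Longrightarrow> g i \<in> H"
    and contr: "\<And>x. (\<Sum>j\<in>J. (cmod (\<Sum>i\<in>I. m j i * x i))\<^sup>2) \<le> (\<Sum>i\<in>I. (cmod (x i))\<^sup>2)"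
  shows "(\<Sum>j\<in>J. quad s (\<lambda>z. \<Sum>i\<in>I. m j i * g i z)) \<le> (\<Sum>i\<in>I. quad s (g i))"
proof -
  obtain y where y: "\<And>i k. i \<in> I \<Longrightarrow> k \<in> I \<Longrightarrow> s (g i) (g k) = (\<Sum>l\<in>I. y i l * cnj (y k l))"
    using gram_factorization[of I g] assms(1,2) by blast
  have q: "quad s (\<lambda>z. \<Sum>i\<in>I. c i * g i z) = (\<Sum>l\<in>I. (cmod (\<Sum>i\<in>I. c i * y i l))\<^sup>2)" for c
  proof -
    have "s (\<lambda>z. \<Sum>i\<in>I. c i * g i z) (\<lambda>z. \<Sum>i\<in>I. c i * g i z)
        = (\<Sum>i\<in>I. \<Sum>k\<in>I. \<Sum>l\<in>I. (c i * y i l) * cnj (c k * y k l))"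
      using assms by (subst sum_sum) (auto simp: y sum_distrib_left mult_ac intro!: sum.cong)
    also have "\<dots> = (\<Sum>i\<in>I. \<Sum>l\<in>I. \<Sum>k\<in>I. (c i * y i l) * cnj (c k * y k l))"
      by (intro sum.cong refl sum.swap)
    also have "\<dots> = (\<Sum>l\<in>I. \<Sum>i\<in>I. \<Sum>k\<in>I. (c i * y i l) * cnj (c k * y k l))"
      by (rule sum.swap)
    also have "\<dots> = (\<Sum>l\<in>I. (\<Sum>i\<in>I. c i * y i l) * cnj (\<Sum>i\<in>I. c i * y i l))"
      by (simp add: sum_product)
    also have "\<dots> = (\<Sum>l\<in>I. of_real ((cmod (\<Sum>i\<in>I. c i * y i l))\<^sup>2))"
      by (simp only: complex_norm_square)
    finally show ?thesis unfolding quad_def by simp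
  qed
  have "(\<Sum>j\<in>J. quad s (\<lambda>z. \<Sum>i\<in>I. m j i * g i z)) = (\<Sum>l\<in>I. \<Sum>j\<in>J. (cmod (\<Sum>i\<in>I. m j i * y i l))\<^sup>2)"
    unfolding q by (rule sum.swap)
  also have "\<dots> \<le> (\<Sum>l\<in>I. \<Sum>i\<in>I. (cmod (y i l))\<^sup>2)" by (intro sum_mono contr)
  also have "\<dots> = (\<Sum>i\<in>I. \<Sum>l\<in>I. (cmod (y i l))\<^sup>2)" by (rule sum.swap)
  also have "\<dots> = (\<Sum>i\<in>I. quad s (g i))"
  proof (intro sum.cong refl)
    fix i assume "i \<in> I"
    then have "s (g i) (g i) = (\<Sum>l\<in>I. of_real ((cmod (y i l))\<^sup>2))" by (simp add: y complex_norm_square del: of_real_power)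
    then show "(\<Sum>l\<in>I. (cmod (y i l))\<^sup>2) = quad s (g i)" unfolding quad_def by simp
  qed
  finally show ?thesis .
qed

text \<open>Gram--Schmidt, keeping track of the coefficients in the original family.\<close>

lemma gram_schmidt:
  assumes "finite I" "\<And>i. i \<in> I \<Longrightarrow> g i \<in> H"
    and "\<And>c. \<exists>i\<in>I. c i \<noteq> 0 \<Longrightarrow> quad s (\<lambda>x. \<Sum>i\<in>I. c i * g i x) > 0"
  shows "\<exists>a. orthonormal (\<lambda>i x. \<Sum>k\<in>I. a i k * g k x) I"
  using assms
proof (induction I)
  case empty
  then show ?case by (auto simp: orthonormal_def)
next
  case (insert n I)
  have gI: "i \<in> insert n I \<Longrightarrow> g i \<in> H" for i using insert by auto
  have "\<exists>a. orthonormal (\<lambda>i x. \<Sum>k\<in>I. a i k * g k x) I"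
  proof (rule insert.IH)
    fix c assume c: "\<exists>i\<in>I. c i \<noteq> (0::complex)"
    define d where "d = (\<lambda>i. if i = n then 0 else c i)"
    have "quad s (\<lambda>x. \<Sum>i\<in>insert n I. d i * g i x) > 0"
      using c insert.hyps by (intro insert.prems(2)) (auto simp: d_def)
    moreover have "(\<lambda>x. \<Sum>i\<in>insert n I. d i * g i x) = (\<lambda>x. \<Sum>i\<in>I. c i * g i x)"
      using insert.hyps by (auto simp: d_def intro!: ext sum.cong)
    ultimately show "quad s (\<lambda>x. \<Sum>i\<in>I. c i * g i x) > 0" by simp
  qed (use insert in auto)
  then obtain a where a: "orthonormal (\<lambda>i x. \<Sum>k\<in>I. a i k * g k x) I" by blast
  define e where "e = (\<lambda>i x. \<Sum>k\<in>I. a i k * g k x)"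
  have eo: "orthonormal e I" using a by (simp add: e_def)
  have eH: "i \<in> I \<Longrightarrow> e i \<in> H" for i using eo by (auto simp: orthonormal_def)
  define d where "d = (\<lambda>k. if k = n then 1 else - (\<Sum>j\<in>I. s (g n) (e j) * a j k))"
  define f where "f = (\<lambda>x. g n x - (\<Sum>j\<in>I. s (g n) (e j) * e j x))"
  have f_eq: "f = (\<lambda>x. \<Sum>k\<in>insert n I. d k * g k x)"
  proof
    fix x
    have "(\<Sum>j\<in>I. s (g n) (e j) * e j x) = (\<Sum>k\<in>I. (\<Sum>j\<in>I. s (g n) (e j) * a j k) * g k x)"
      unfolding e_def sum_distrib_left sum_distrib_right by (subst sum.swap) (simp add: mult.assoc)
    moreover have "(\<Sum>k\<in>I. d k * g k x) = (\<Sum>k\<in>I. - ((\<Sum>j\<in>I. s (g n) (e j) * a j k) * g k x))"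
      using insert.hyps by (intro sum.cong) (auto simp: d_def)
    ultimately show "f x = (\<Sum>k\<in>insert n I. d k * g k x)"
      using insert.hyps unfolding f_def by (simp add: sum_negf) (simp add: d_def)
  qed
  have fH: "f \<in> H" unfolding f_def using gI eH by (intro diff_in sum_in) auto
  have fpos: "quad s f > 0"
    unfolding f_eq by (rule insert.prems(2)) (auto simp: d_def)
  have f_orth: "s f (e i) = 0" if "i \<in> I" for i
  proof -
    have "s f (e i) = s (g n) (e i) - (\<Sum>j\<in>I. s (g n) (e j) * s (e j) (e i))"
      unfolding f_def using gI eH that by (simp add: diff_left sum_in sum_left)
    also have "(\<Sum>j\<in>I. s (g n) (e j) * s (e j) (e i)) = (\<Sum>j\<in>I. if j = i then s (g n) (e i) else 0)"
      using eo that by (intro sum.cong) (auto simp: orthonormal_def)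
    finally show ?thesis using that insert.hyps by simp
  qed
  define r where "r = complex_of_real (1 / sqrt (quad s f))"
  define b where "b i k = (if i = n then r * d k else if k = n then 0 else a i k)" for i k
  define e' where "e' = (\<lambda>i x. \<Sum>k\<in>insert n I. b i k * g k x)"
  have e'n: "e' n = (\<lambda>x. r * f x)"
    unfolding e'_def b_def f_eq by (simp add: sum_distrib_left mult.assoc)
  have e'I: "e' i = e i" if "i \<in> I" for i
    unfolding e'_def b_def e_def using that insert.hyps by (auto intro!: ext sum.cong)
  have "orthonormal e' (insert n I)"
    unfolding orthonormal_def
  proof (intro conjI ballI)
    show "finite (insert n I)" using insert.hyps by simp
    show "e' i \<in> H" if "i \<in> insert n I" for i
      using that e'I e'n eH fH scale_in by auto
    fix i j assume ij: "i \<in> insert n I" "j \<in> insert n I"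
    have nn: "s (e' n) (e' n) = 1"
    proof -
      have "s (e' n) (e' n) = r * cnj r * s f f"
        unfolding e'n using fH by (simp add: scale_left scale_right scale_in)
      then show ?thesis using fpos self[OF fH] by (simp add: r_def flip: of_real_mult)
    qed
    have nI: "s (e' n) (e' k) = 0" "s (e' k) (e' n) = 0" if "k \<in> I" for k
    proof -
      show *: "s (e' n) (e' k) = 0"
        unfolding e'n e'I[OF that] using fH f_orth[OF that] eH[OF that] by (simp add: scale_left)
      show "s (e' k) (e' n) = 0"
        using herm[of "e' n" "e' k"] * e'n e'I[OF that] eH[OF that] fH scale_in by simp
    qed
    show "s (e' i) (e' j) = (if i = j then 1 else 0)"
      using ij nn nI insert.hyps e'I eo by (auto simp: orthonormal_def)
  qed
  then show ?case unfolding e'_def by blast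
qed

subsection \<open>The Riesz representation theorem\<close>

text \<open>Every Cauchy sequence in \<open>H\<close> has a limit in \<open>H\<close>, both with respect to the seminorm of \<open>s\<close>.\<close>

definition form_complete :: bool where
  "form_complete \<longleftrightarrow> (\<forall>U. (\<forall>n::nat. U n \<in> H) \<and>
     (\<forall>e>0. \<exists>n0. \<forall>m\<ge>n0. \<forall>n\<ge>n0. quad s (\<lambda>x. U m x - U n x) < e) \<longrightarrow>
     (\<exists>u\<in>H. (\<lambda>n. quad s (\<lambda>x. U n x - u x)) \<longlonglongrightarrow> 0))"

text \<open>
  The representing element is the limit of a minimizing sequence for \<open>s[v] - 2 Re (l v)\<close>, which is a
  Cauchy sequence by the parallelogram law.
\<close>

theorem riesz:
  assumes form_complete
    and conj_lin: "\<And>u v a b. u \<in> H \<Longrightarrow> v \<in> H \<Longrightarrow> l (\<lambda>x. a * u x + b * v x) = cnj a * l u + cnj b * l v"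
    and bdd: "\<And>v. v \<in> H \<Longrightarrow> (cmod (l v))\<^sup>2 \<le> C * quad s v"
  shows "\<exists>w\<in>H. \<forall>v\<in>H. s w v = l v"
proof -
  define J where "J v = quad s v - 2 * Re (l v)" for v
  have J_comb: "J (\<lambda>x. a * u x + b * v x) = (cmod a)\<^sup>2 * quad s u + 2 * Re (a * cnj b * s u v) + (cmod b)\<^sup>2 * quad s v
      - 2 * Re (cnj a * l u) - 2 * Re (cnj b * l v)" if "u \<in> H" "v \<in> H" for a b u v
    unfolding J_def using that by (simp only: quad_comb conj_lin plus_complex.sel) simp
  have lower: "J v \<ge> - \<bar>C\<bar>" if "v \<in> H" for v
  proof -
    have "cmod (l v) \<le> sqrt (C * quad s v)" using bdd[OF that] by (rule real_le_rsqrt)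
    also have "\<dots> \<le> sqrt (\<bar>C\<bar> * quad s v)"
      using nonneg[OF that] by (intro real_sqrt_le_mono mult_right_mono) auto
    also have "2 * \<dots> \<le> \<bar>C\<bar> + quad s v"
      using arith_geo_mean_sqrt[of "\<bar>C\<bar>" "quad s v"] nonneg[OF that] by simp
    finally have "2 * cmod (l v) \<le> \<bar>C\<bar> + quad s v" by simp
    then show ?thesis using complex_Re_le_cmod[of "l v"] unfolding J_def by linarith
  qed
  define m where "m = Inf (J ` H)"
  have bddb: "bdd_below (J ` H)" using lower by (intro bdd_belowI2) auto
  have m_le: "m \<le> J v" if "v \<in> H" for v unfolding m_def using that bddb by (intro cInf_lower) auto
  have "\<exists>v\<in>H. J v < m + 1 / real (Suc n)" for n
  proof -
    have "Inf (J ` H) < m + 1 / real (Suc n)" by (simp add: m_def)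
    then show ?thesis using zero_in bddb by (subst (asm) cInf_less_iff) auto
  qed
  then obtain V where VH: "\<And>n. V n \<in> H" and VJ: "\<And>n. J (V n) < m + 1 / real (Suc n)" by metis
  have cauchy: "quad s (\<lambda>x. V i x - V j x) \<le> 2 * (1 / real (Suc i)) + 2 * (1 / real (Suc j))" for i j
  proof -
    have "m \<le> J (\<lambda>x. (1/2) * V i x + (1/2) * V j x)" using VH by (intro m_le comb_in)
    also have "\<dots> = J (V i) / 2 + J (V j) / 2 - quad s (\<lambda>x. V i x - V j x) / 4"
      using J_comb[OF VH[of i] VH[of j], of "1/2" "1/2"] quad_diff[OF VH[of i] VH[of j]]
      by (simp add: J_def norm_divide power2_eq_square field_simps)
    finally show ?thesis using VJ[of i] VJ[of j] by linarith
  qed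
  have "\<exists>n0. \<forall>i\<ge>n0. \<forall>j\<ge>n0. quad s (\<lambda>x. V i x - V j x) < e" if "e > 0" for e
  proof -
    obtain n0 where "4 / e < real n0" using reals_Archimedean2 by blast
    moreover from this have "n0 > 0"
      using that by (metis divide_pos_pos less_trans of_nat_0_less_iff zero_less_numeral)
    ultimately have n0: "n0 > 0" "4 / e < real n0" by auto
    then have *: "4 / real n0 < e" using that by (simp add: field_simps)
    have "quad s (\<lambda>x. V i x - V j x) < e" if "i \<ge> n0" "j \<ge> n0" for i j
    proof -
      have "1 / real (Suc i) \<le> 1 / real n0" "1 / real (Suc j) \<le> 1 / real n0"
        using that n0 by (auto intro!: divide_left_mono)
      then show ?thesis using cauchy[of i j] * by linarith
    qed
    then show ?thesis by blast
  qed
  then obtain u where u: "u \<in> H" "(\<lambda>n. quad s (\<lambda>x. V n x - u x)) \<longlonglongrightarrow> 0"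
    using \<open>form_complete\<close> VH unfolding form_complete_def by blast
  have "s u w = l w" if w: "w \<in> H" for w
  proof -
    have near: "(cmod (s (V n) w - l w))\<^sup>2 \<le> 1 / real (Suc n) * (quad s w + 1)" for n
    proof (rule quadratic_bound)
      fix z
      have "m \<le> J (\<lambda>x. 1 * V n x + z * w x)" using VH w by (intro m_le comb_in)
      also have "\<dots> = J (V n) + 2 * Re (cnj z * (s (V n) w - l w)) + (cmod z)\<^sup>2 * quad s w"
        using VH w by (subst J_comb) (auto simp: J_def algebra_simps)
      also have "\<dots> \<le> m + 1 / real (Suc n) + 2 * Re (cnj z * (s (V n) w - l w)) + (cmod z)\<^sup>2 * (quad s w + 1)"
        unfolding distrib_left using VJ[of n] zero_le_power2[of "cmod z"] by linarith
      finally show "- (1 / real (Suc n)) \<le> 2 * Re (cnj z * (s (V n) w - l w)) + (cmod z)\<^sup>2 * (quad s w + 1)"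
        by simp
    qed (use nonneg[OF w] in simp)
    have "(\<lambda>n. 1 / real (Suc n) * (quad s w + 1)) \<longlonglongrightarrow> 0"
      using tendsto_mult[OF LIMSEQ_inverse_real_of_nat tendsto_const[of "quad s w + 1"]]
      by (simp only: inverse_eq_divide mult_zero_left)
    with near have "(\<lambda>n. (cmod (s (V n) w - l w))\<^sup>2) \<longlonglongrightarrow> 0"
      by (rule tendsto_zero_le[OF zero_le_power2])
    then have "(\<lambda>n. (cmod (s (V n) w - l w))) \<longlonglongrightarrow> 0"
      using tendsto_real_sqrt[of "\<lambda>n. (cmod (s (V n) w - l w))\<^sup>2" 0] by simp
    then have lim_l: "(\<lambda>n. s (V n) w) \<longlonglongrightarrow> l w"
      by (rule LIM_zero_cancel[OF tendsto_norm_zero_cancel])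
    have "cmod (s (V n) w - s u w) \<le> sqrt (quad s (\<lambda>x. V n x - u x)) * sqrt (quad s w)" for n
      using cauchy_schwarz_sqrt[of "\<lambda>x. V n x - u x" w] VH u(1) w by (simp add: diff_left diff_in)
    moreover have "(\<lambda>n. sqrt (quad s (\<lambda>x. V n x - u x)) * sqrt (quad s w)) \<longlonglongrightarrow> 0"
      using tendsto_mult[OF tendsto_real_sqrt[OF u(2)] tendsto_const[of "sqrt (quad s w)"]] by simp
    ultimately have "(\<lambda>n. cmod (s (V n) w - s u w)) \<longlonglongrightarrow> 0"
      by (rule tendsto_zero_le[OF norm_ge_zero])
    then have "(\<lambda>n. s (V n) w) \<longlonglongrightarrow> s u w"
      by (rule LIM_zero_cancel[OF tendsto_norm_zero_cancel])
    then show ?thesis using lim_l LIMSEQ_unique by blast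
  qed
  then show ?thesis using u(1) by blast
qed

end

section \<open>The space of square-integrable functions\<close>

lemma L2_measurable [measurable_dest]: "u \<in> L2 N \<Longrightarrow> u \<in> borel_measurable N"
  unfolding L2_def by blast

lemma L2_integrable: "u \<in> L2 N \<Longrightarrow> integrable N (\<lambda>x. (cmod (u x))\<^sup>2)"
  unfolding L2_def by blast

lemma borel_measurable_cnj [measurable]: "cnj \<in> borel_measurable borel"
  by (intro borel_measurable_continuous_onI continuous_intros)

lemma cmod_mult_le_squares: "cmod (a * cnj b) \<le> (cmod a)\<^sup>2 + (cmod b)\<^sup>2"
proof -
  have "0 \<le> (cmod a - cmod b)\<^sup>2 + (cmod a)\<^sup>2 + (cmod b)\<^sup>2" by simp
  then have "2 * (cmod a * cmod b) \<le> 2 * ((cmod a)\<^sup>2 + (cmod b)\<^sup>2)" by (simp add: power2_diff)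
  then show ?thesis by (simp add: norm_mult)
qed

lemma cmod_comb_squared: "(cmod (a * u + b * v))\<^sup>2 \<le> 2 * (cmod a)\<^sup>2 * (cmod u)\<^sup>2 + 2 * (cmod b)\<^sup>2 * (cmod v)\<^sup>2"
proof -
  have "cmod (a * u + b * v) \<le> cmod a * cmod u + cmod b * cmod v"
    using norm_triangle_ineq[of "a * u" "b * v"] by (simp add: norm_mult)
  then have "(cmod (a * u + b * v))\<^sup>2 \<le> (cmod a * cmod u + cmod b * cmod v)\<^sup>2"
    by (intro power_mono) auto
  also have "\<dots> \<le> 2 * (cmod a * cmod u)\<^sup>2 + 2 * (cmod b * cmod v)\<^sup>2"
    using zero_le_power2[of "cmod a * cmod u - cmod b * cmod v"] by (simp add: power2_sum power2_diff)
  finally show ?thesis by (simp add: power_mult_distrib)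
qed

lemma L2_inner_integrable:
  assumes "u \<in> L2 N" "v \<in> L2 N"
  shows "integrable N (\<lambda>x. u x * cnj (v x))"
proof (rule Bochner_Integration.integrable_bound)
  show "integrable N (\<lambda>x. (cmod (u x))\<^sup>2 + (cmod (v x))\<^sup>2)"
    using assms by (intro Bochner_Integration.integrable_add L2_integrable)
  show "(\<lambda>x. u x * cnj (v x)) \<in> borel_measurable N"
    using assms by measurable
  show "AE x in N. norm (u x * cnj (v x)) \<le> norm ((cmod (u x))\<^sup>2 + (cmod (v x))\<^sup>2)"
    using cmod_mult_le_squares by (intro always_eventually allI) (simp add: order_trans)
qed

lemma L2_bound:
  assumes "u \<in> L2 N" "v \<in> borel_measurable N" "AE x in N. cmod (v x) \<le> C * cmod (u x)" "0 \<le> C"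
  shows "v \<in> L2 N"
proof -
  have "integrable N (\<lambda>x. (cmod (v x))\<^sup>2)"
  proof (rule Bochner_Integration.integrable_bound)
    show "integrable N (\<lambda>x. C\<^sup>2 * (cmod (u x))\<^sup>2)" using L2_integrable[OF assms(1)] by simp
    show "(\<lambda>x. (cmod (v x))\<^sup>2) \<in> borel_measurable N" using assms(2) by measurable
    show "AE x in N. norm ((cmod (v x))\<^sup>2) \<le> norm (C\<^sup>2 * (cmod (u x))\<^sup>2)"
      using assms(3)
    proof eventually_elim
      case (elim x)
      then have "(cmod (v x))\<^sup>2 \<le> (C * cmod (u x))\<^sup>2" by (intro power_mono) auto
      then show ?case by (simp add: power_mult_distrib)
    qed
  qed
  then show ?thesis using assms(2) by (simp add: L2_def)
qed

lemma L2_comb: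
  assumes "u \<in> L2 N" "v \<in> L2 N"
  shows "(\<lambda>x. a * u x + b * v x) \<in> L2 N"
proof -
  have "integrable N (\<lambda>x. (cmod (a * u x + b * v x))\<^sup>2)"
  proof (rule Bochner_Integration.integrable_bound)
    show "integrable N (\<lambda>x. 2 * (cmod a)\<^sup>2 * (cmod (u x))\<^sup>2 + 2 * (cmod b)\<^sup>2 * (cmod (v x))\<^sup>2)"
      using assms by (intro Bochner_Integration.integrable_add integrable_mult_right L2_integrable)
    show "(\<lambda>x. (cmod (a * u x + b * v x))\<^sup>2) \<in> borel_measurable N"
      using assms by measurable
    show "AE x in N. norm ((cmod (a * u x + b * v x))\<^sup>2)
        \<le> norm (2 * (cmod a)\<^sup>2 * (cmod (u x))\<^sup>2 + 2 * (cmod b)\<^sup>2 * (cmod (v x))\<^sup>2)"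
      using cmod_comb_squared[of a _ b] by (intro always_eventually allI) simp
  qed
  moreover have "(\<lambda>x. a * u x + b * v x) \<in> borel_measurable N" using assms by measurable
  ultimately show ?thesis by (simp add: L2_def)
qed

lemma quad_L2: "quad (L2_inner N) u = (\<integral>x. (cmod (u x))\<^sup>2 \<partial>N)"
proof -
  have "L2_inner N u u = (\<integral>x. complex_of_real ((cmod (u x))\<^sup>2) \<partial>N)"
    unfolding L2_inner_def by (simp only: complex_norm_square)
  then show ?thesis unfolding quad_def by (simp only: integral_complex_of_real Re_complex_of_real)
qed

lemma L2_norm_squared: "(L2_norm N u)\<^sup>2 = quad (L2_inner N) u"
  unfolding L2_norm_def quad_L2 by simp

lemma L2_norm_sqrt: "L2_norm N u = sqrt (quad (L2_inner N) u)"
  unfolding L2_norm_def quad_L2 by simp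

lemma psd_form_L2: "psd_form (L2 N) (L2_inner N)"
proof
  show "fun_subspace (L2 N)"
    unfolding fun_subspace_def using L2_comb[of _ N] by (simp add: L2_def)
  show "L2_inner N (\<lambda>x. a * u x + b * v x) w = a * L2_inner N u w + b * L2_inner N v w"
    if "u \<in> L2 N" "v \<in> L2 N" "w \<in> L2 N" for u v w a b
    unfolding L2_inner_def using L2_inner_integrable[of u N w] L2_inner_integrable[of v N w] that
    by (simp add: distrib_right mult.assoc)
  show "L2_inner N v u = cnj (L2_inner N u v)" if "u \<in> L2 N" "v \<in> L2 N" for u v
    unfolding L2_inner_def using integral_bounded_linear[OF bounded_linear_cnj L2_inner_integrable[OF that]]
    by (simp add: mult.commute)
  show "0 \<le> quad (L2_inner N) u" for u
    unfolding quad_L2 by simp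
qed

interpretation L2: psd_form "L2 N" "L2_inner N" for N
  by (rule psd_form_L2)

lemma L2_null_AE:
  assumes "u \<in> L2 N" "quad (L2_inner N) u = 0"
  shows "AE x in N. u x = 0"
  using assms integral_nonneg_eq_0_iff_AE[OF L2_integrable[OF assms(1)]] by (simp add: quad_L2)

lemma L2_nn_integral:
  "u \<in> L2 N \<Longrightarrow> (\<integral>\<^sup>+x. ennreal ((cmod (u x))\<^sup>2) \<partial>N) = ennreal (quad (L2_inner N) u)"
  unfolding quad_L2 by (intro nn_integral_eq_integral L2_integrable) auto

text \<open>The Riesz--Fischer theorem.\<close>

theorem L2_complete: "psd_form.form_complete (L2 N) (L2_inner N)"
  unfolding L2.form_complete_def
proof (intro allI impI, elim conjE)
  fix U :: "nat \<Rightarrow> 'a \<Rightarrow> complex"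
  let ?q = "quad (L2_inner N)"
  assume "\<forall>n. U n \<in> L2 N" and cauchy: "\<forall>e>0. \<exists>n0. \<forall>m\<ge>n0. \<forall>n\<ge>n0. ?q (\<lambda>x. U m x - U n x) < e"
  then have U: "U n \<in> L2 N" for n by blast
  have [measurable]: "U n \<in> borel_measurable N" for n using U by (rule L2_measurable)
  have "\<forall>k. \<exists>n0. \<forall>m\<ge>n0. \<forall>n\<ge>n0. ?q (\<lambda>x. U m x - U n x) < (1/4)^k"
    using cauchy by simp
  then obtain r0 where r0: "\<And>k m n. m \<ge> r0 k \<Longrightarrow> n \<ge> r0 k \<Longrightarrow> ?q (\<lambda>x. U m x - U n x) < (1/4)^k"
    by metis
  \<comment> \<open>\<open>r\<close> is increasing and dominates \<open>r0\<close>: along it the sequence converges almost everywhere\<close>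
  define r where "r k = k + (\<Sum>i\<le>k. r0 i)" for k
  have r_ge: "r0 k \<le> r k" for k
  proof -
    have "r0 k \<le> (\<Sum>i\<le>k. r0 i)" by (rule member_le_sum) auto
    then show ?thesis by (simp add: r_def)
  qed
  have r_Suc: "r k \<le> r (Suc k)" for k by (simp add: r_def)
  have r_k: "k \<le> r k" for k by (simp add: r_def)
  define d where "d k x = U (r (Suc k)) x - U (r k) x" for k x
  have dL: "d k \<in> L2 N" for k unfolding d_def using U by (intro L2.diff_in)
  have [measurable]: "d k \<in> borel_measurable N" for k using dL by (rule L2_measurable)
  have d_le: "?q (d k) \<le> (1/4)^k" for k
    unfolding d_def using r0[of k "r (Suc k)" "r k"] r_ge[of k] r_Suc[of k] by simp
  have "(\<integral>\<^sup>+x. (\<Sum>k. ennreal (2^k * (cmod (d k x))\<^sup>2)) \<partial>N) = (\<Sum>k. \<integral>\<^sup>+x. ennreal (2^k * (cmod (d k x))\<^sup>2) \<partial>N)"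
    by (rule nn_integral_suminf) measurable
  also have "\<dots> = (\<Sum>k. ennreal (2^k * ?q (d k)))"
    using dL by (intro suminf_cong) (simp add: ennreal_mult' nn_integral_cmult L2_nn_integral L2.nonneg)
  also have "\<dots> \<le> (\<Sum>k. ennreal ((1/2)^k))"
  proof (intro suminf_le summableI ennreal_leI)
    fix k
    have "2^k * ?q (d k) \<le> 2^k * (1/4)^k" using d_le by (intro mult_left_mono) auto
    also have "\<dots> = (1/2)^k" by (simp flip: power_mult_distrib)
    finally show "2^k * ?q (d k) \<le> (1/2)^k" .
  qed
  also have "\<dots> = ennreal (\<Sum>k. (1/2)^k)"
    by (rule suminf_ennreal2) (auto intro: summable_geometric)
  finally have "(\<integral>\<^sup>+x. (\<Sum>k. ennreal (2^k * (cmod (d k x))\<^sup>2)) \<partial>N) \<noteq> \<infinity>"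
    by (auto simp: top_unique)
  then have "AE x in N. (\<Sum>k. ennreal (2^k * (cmod (d k x))\<^sup>2)) \<noteq> \<infinity>"
    by (intro nn_integral_PInf_AE) auto
  then have conv: "AE x in N. convergent (\<lambda>k. U (r k) x)"
  proof eventually_elim
    case (elim x)
    have "summable (\<lambda>k. 2^k * (cmod (d k x))\<^sup>2)"
      using elim by (intro summable_suminf_not_top) auto
    then have "summable (\<lambda>k. (1/2)^k + 2^k * (cmod (d k x))\<^sup>2)"
      by (intro summable_add summable_geometric) auto
    then have "summable (\<lambda>k. d k x)"
    proof (rule summable_comparison_test')
      fix k
      have "0 \<le> (1 - 2^k * cmod (d k x))\<^sup>2 / 2^k" by simp
      also have "\<dots> = (1/2)^k + 2^k * (cmod (d k x))\<^sup>2 - 2 * cmod (d k x)"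
        by (simp add: power2_eq_square field_simps)
      finally show "norm (d k x) \<le> (1/2)^k + 2^k * (cmod (d k x))\<^sup>2"
        using norm_ge_zero[of "d k x"] by linarith
    qed
    then have "convergent (\<lambda>n. \<Sum>k<n. d k x)" by (simp add: summable_iff_convergent)
    moreover have "(\<Sum>k<n. d k x) = U (r n) x - U (r 0) x" for n
      unfolding d_def by (rule sum_lessThan_telescope)
    ultimately have "convergent (\<lambda>n. U (r n) x - U (r 0) x)" by simp
    then have "convergent (\<lambda>n. (U (r n) x - U (r 0) x) + U (r 0) x)"
      by (intro convergent_add convergent_const)
    then show ?case by simp
  qed
  define u where "u x = lim (\<lambda>k. U (r k) x)" for x
  have [measurable]: "u \<in> borel_measurable N" unfolding u_def by measurable
  have near: "(\<integral>\<^sup>+x. ennreal ((cmod (U n x - u x))\<^sup>2) \<partial>N) \<le> ennreal e"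
    if "\<And>m. m \<ge> n0 \<Longrightarrow> ?q (\<lambda>x. U n x - U m x) \<le> e" for n n0 e
  proof -
    have "(\<integral>\<^sup>+x. ennreal ((cmod (U n x - u x))\<^sup>2) \<partial>N)
        = (\<integral>\<^sup>+x. liminf (\<lambda>k. ennreal ((cmod (U n x - U (r k) x))\<^sup>2)) \<partial>N)"
    proof (rule nn_integral_cong_AE)
      show "AE x in N. ennreal ((cmod (U n x - u x))\<^sup>2) = liminf (\<lambda>k. ennreal ((cmod (U n x - U (r k) x))\<^sup>2))"
        using conv
      proof eventually_elim
        case (elim x)
        then have "(\<lambda>k. U (r k) x) \<longlonglongrightarrow> u x" unfolding u_def by (simp add: convergent_LIMSEQ_iff)
        then have "(\<lambda>k. ennreal ((cmod (U n x - U (r k) x))\<^sup>2)) \<longlonglongrightarrow> ennreal ((cmod (U n x - u x))\<^sup>2)"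
          by (intro tendsto_ennrealI tendsto_intros)
        then show ?case by (metis lim_imp_Liminf sequentially_bot)
      qed
    qed
    also have "\<dots> \<le> liminf (\<lambda>k. \<integral>\<^sup>+x. ennreal ((cmod (U n x - U (r k) x))\<^sup>2) \<partial>N)"
      by (rule nn_integral_liminf) measurable
    also have "\<dots> = liminf (\<lambda>k. ennreal (?q (\<lambda>x. U n x - U (r k) x)))"
      using U by (simp add: L2_nn_integral L2.diff_in)
    also have "\<dots> \<le> limsup (\<lambda>k. ennreal (?q (\<lambda>x. U n x - U (r k) x)))"
      by (rule Liminf_le_Limsup) simp
    also have "\<dots> \<le> ennreal e"
    proof (rule Limsup_bounded)
      show "\<forall>\<^sub>F k in sequentially. ennreal (?q (\<lambda>x. U n x - U (r k) x)) \<le> ennreal e"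
        using eventually_ge_at_top[of n0]
      proof eventually_elim
        case (elim k)
        then show ?case using that[of "r k"] r_k[of k] by (intro ennreal_leI) auto
      qed
    qed
    finally show ?thesis .
  qed
  have diffL: "(\<lambda>x. U n x - u x) \<in> L2 N \<and> ?q (\<lambda>x. U n x - u x) \<le> e"
    if "\<And>m. m \<ge> n0 \<Longrightarrow> ?q (\<lambda>x. U n x - U m x) \<le> e" "0 \<le> e" for n n0 e
  proof -
    have *: "(\<integral>\<^sup>+x. ennreal ((cmod (U n x - u x))\<^sup>2) \<partial>N) \<le> ennreal e" using near[OF that(1)] by blast
    have "integrable N (\<lambda>x. (cmod (U n x - u x))\<^sup>2)"
      using * by (intro integrableI_bounded) (auto simp: le_less_trans[OF _ ennreal_less_top])
    then have L: "(\<lambda>x. U n x - u x) \<in> L2 N" by (simp add: L2_def)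
    then show ?thesis using * that(2) by (simp add: L2_nn_integral)
  qed
  have main: "\<exists>n0. \<forall>n\<ge>n0. (\<lambda>x. U n x - u x) \<in> L2 N \<and> ?q (\<lambda>x. U n x - u x) < e" if e: "e > 0" for e
  proof -
    have "e / 2 > 0" using e by simp
    then obtain n0 where n0: "\<And>m n. m \<ge> n0 \<Longrightarrow> n \<ge> n0 \<Longrightarrow> ?q (\<lambda>x. U m x - U n x) < e / 2"
      using cauchy by blast
    have "(\<lambda>x. U n x - u x) \<in> L2 N \<and> ?q (\<lambda>x. U n x - u x) < e" if "n \<ge> n0" for n
      using diffL[of n0 n "e/2"] n0[OF that] e by (smt (verit) field_sum_of_halves)
    then show ?thesis by blast
  qed
  obtain n0 where "(\<lambda>x. U n0 x - u x) \<in> L2 N" using main[of 1] by auto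
  from L2.diff_in[OF U[of n0] this] have uL: "u \<in> L2 N" by simp
  have "(\<lambda>n. ?q (\<lambda>x. U n x - u x)) \<longlonglongrightarrow> 0"
  proof (rule LIMSEQ_I)
    fix e :: real assume "e > 0"
    then obtain n0 where "\<forall>n\<ge>n0. (\<lambda>x. U n x - u x) \<in> L2 N \<and> ?q (\<lambda>x. U n x - u x) < e" using main by blast
    then show "\<exists>n0. \<forall>n\<ge>n0. norm (?q (\<lambda>x. U n x - u x) - 0) < e"
      by (intro exI[of _ n0]) (simp add: L2.nonneg abs_of_nonneg)
  qed
  then show "\<exists>u\<in>L2 N. (\<lambda>n. ?q (\<lambda>x. U n x - u x)) \<longlonglongrightarrow> 0" using uL by blast
qed

section \<open>Inequalities of Hoelder type\<close>

lemma young3: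
  fixes x y z a b c :: real
  assumes "0 \<le> x" "0 \<le> y" "0 \<le> z" "0 < a" "0 < b" "0 < c" "a + b + c = 1"
  shows "x powr a * y powr b * z powr c \<le> a * x + b * y + c * z"
proof (cases "x = 0 \<or> y = 0 \<or> z = 0")
  case True
  then have "x powr a * y powr b * z powr c = 0" by auto
  moreover have "0 \<le> a * x + b * y + c * z" using assms by simp
  ultimately show ?thesis by linarith
next
  case False
  then have pos: "0 < x" "0 < y" "0 < z" using assms by auto
  define w where "w = y powr (b / (b + c)) * z powr (c / (b + c))"
  have "w > 0" using pos by (simp add: w_def)
  have "w \<le> b / (b + c) * y + c / (b + c) * z"
    unfolding w_def using assms pos by (intro Youngs_inequality_0) (auto simp flip: add_divide_distrib)
  also have "\<dots> = (b * y + c * z) / (b + c)" by (simp add: add_divide_distrib)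
  finally have w: "(b + c) * w \<le> b * y + c * z" using assms by (simp add: pos_le_divide_eq mult.commute)
  have "x powr a * w powr (b + c) \<le> a * x + (b + c) * w"
    using assms pos \<open>w > 0\<close> by (intro Youngs_inequality_0) auto
  moreover have "w powr (b + c) = y powr b * z powr c"
    unfolding w_def using assms by (simp add: powr_mult powr_powr)
  ultimately show ?thesis using w by (simp add: mult.assoc)
qed

lemma holder3:
  fixes f g h :: "'a \<Rightarrow> real"
  assumes int: "integrable M f" "integrable M g" "integrable M h"
    and nn: "AE x in M. 0 \<le> f x" "AE x in M. 0 \<le> g x" "AE x in M. 0 \<le> h x"
    and abc: "0 < a" "0 < b" "0 < c" "a + b + c = 1"
  shows "integrable M (\<lambda>x. f x powr a * g x powr b * h x powr c)"
    and "(\<integral>x. f x powr a * g x powr b * h x powr c \<partial>M)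
      \<le> (\<integral>x. f x \<partial>M) powr a * (\<integral>x. g x \<partial>M) powr b * (\<integral>x. h x \<partial>M) powr c"
proof -
  have [measurable]: "f \<in> borel_measurable M" "g \<in> borel_measurable M" "h \<in> borel_measurable M"
    using int by auto
  have le: "AE x in M. norm (f x powr a * g x powr b * h x powr c) \<le> norm (a * f x + b * g x + c * h x)"
    using nn
  proof eventually_elim
    case (elim x)
    then show ?case using young3[OF elim abc] by simp
  qed
  show I: "integrable M (\<lambda>x. f x powr a * g x powr b * h x powr c)"
    by (rule Bochner_Integration.integrable_bound[OF _ _ le]) (use int in auto)
  define F where "F = (\<integral>x. f x \<partial>M)"
  define G where "G = (\<integral>x. g x \<partial>M)"
  define H where "H = (\<integral>x. h x \<partial>M)"
  have FGH: "0 \<le> F" "0 \<le> G" "0 \<le> H" unfolding F_def G_def H_def using nn by (auto intro: integral_nonneg_AE)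
  show "(\<integral>x. f x powr a * g x powr b * h x powr c \<partial>M)
      \<le> (\<integral>x. f x \<partial>M) powr a * (\<integral>x. g x \<partial>M) powr b * (\<integral>x. h x \<partial>M) powr c"
  proof (cases "F = 0 \<or> G = 0 \<or> H = 0")
    case True
    then have "(AE x in M. f x = 0) \<or> (AE x in M. g x = 0) \<or> (AE x in M. h x = 0)"
      unfolding F_def G_def H_def using int nn by (simp add: integral_nonneg_eq_0_iff_AE)
    then have "AE x in M. f x powr a * g x powr b * h x powr c = 0"
      by (elim disjE) (auto elim!: eventually_mono)
    then have "(\<integral>x. f x powr a * g x powr b * h x powr c \<partial>M) = 0"
      by (rule integral_eq_zero_AE)
    then show ?thesis by simp
  next
    case False
    then have pos: "0 < F" "0 < G" "0 < H" using FGH by auto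
    let ?C = "F powr a * G powr b * H powr c"
    have "(\<integral>x. f x powr a * g x powr b * h x powr c \<partial>M)
        \<le> (\<integral>x. ?C * (a * (f x / F) + b * (g x / G) + c * (h x / H)) \<partial>M)"
    proof (rule integral_mono_AE[OF I])
      show "integrable M (\<lambda>x. ?C * (a * (f x / F) + b * (g x / G) + c * (h x / H)))" using int by auto
      show "AE x in M. f x powr a * g x powr b * h x powr c \<le> ?C * (a * (f x / F) + b * (g x / G) + c * (h x / H))"
        using nn
      proof eventually_elim
        case (elim x)
        have "(f x / F) powr a * (g x / G) powr b * (h x / H) powr c \<le> a * (f x / F) + b * (g x / G) + c * (h x / H)"
          using elim pos abc by (intro young3) auto
        then have "?C * ((f x / F) powr a * (g x / G) powr b * (h x / H) powr c)
            \<le> ?C * (a * (f x / F) + b * (g x / G) + c * (h x / H))"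
          by (intro mult_left_mono) auto
        moreover have "?C * ((f x / F) powr a * (g x / G) powr b * (h x / H) powr c)
            = f x powr a * g x powr b * h x powr c"
          using elim pos by (simp add: powr_divide)
        ultimately show ?case by simp
      qed
    qed
    also have "\<dots> = ?C * (a * (F / F) + b * (G / G) + c * (H / H))"
      using int by (simp add: F_def G_def H_def)
    also have "\<dots> = ?C" using pos abc by simp
    finally show ?thesis by (simp add: F_def G_def H_def)
  qed
qed

lemma holder_sum:
  fixes f g :: "'i \<Rightarrow> real"
  assumes "finite I" "\<And>i. i \<in> I \<Longrightarrow> 0 \<le> f i" "\<And>i. i \<in> I \<Longrightarrow> 0 \<le> g i" "0 < a" "0 < b" "a + b = 1"
  shows "(\<Sum>i\<in>I. f i powr a * g i powr b) \<le> (\<Sum>i\<in>I. f i) powr a * (\<Sum>i\<in>I. g i) powr b"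
proof -
  have *: "integrable (count_space I) (f :: 'i \<Rightarrow> real)" for f using assms(1) by (rule integrable_count_space)
  have nn: "AE i in count_space I. 0 \<le> f i" "AE i in count_space I. 0 \<le> g i"
    using assms by (auto simp: AE_count_space)
  have half: "x powr (b/2) * x powr (b/2) = x powr b" for x :: real by (simp flip: powr_add)
  show ?thesis
    using holder3(2)[OF * * * nn nn(2), of a "b/2" "b/2"] assms
    by (simp add: lebesgue_integral_count_space_finite mult.assoc half)
qed

section \<open>Approximation by orthonormal step functions\<close>

lemma L2_simple_approx:
  assumes "f \<in> L2 N" "0 < \<delta>"
  shows "\<exists>S. simple_function N S \<and> S \<in> L2 N \<and> quad (L2_inner N) (\<lambda>x. f x - S x) < \<delta>"
proof -
  have [measurable]: "f \<in> borel_measurable N" using assms by (rule_tac L2_measurable)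
  obtain F where F: "\<And>i. simple_function N (F i)" "\<And>x. x \<in> space N \<Longrightarrow> (\<lambda>i. F i x) \<longlonglongrightarrow> f x"
    "\<And>i x. x \<in> space N \<Longrightarrow> cmod (F i x) \<le> 2 * cmod (f x)"
    using borel_measurable_implies_sequence_metric[of f N 0] by (simp, metis)
  have [measurable]: "F i \<in> borel_measurable N" for i using F(1) by (rule borel_measurable_simple_function)
  have FL: "F i \<in> L2 N" for i
    by (rule L2_bound[OF assms(1), of _ 2]) (use F(3) in auto)
  have "(\<lambda>i. \<integral>x. (cmod (f x - F i x))\<^sup>2 \<partial>N) \<longlonglongrightarrow> (\<integral>x. 0 \<partial>N)"
  proof (rule integral_dominated_convergence)
    show "integrable N (\<lambda>x. 9 * (cmod (f x))\<^sup>2)" using L2_integrable[OF assms(1)] by simp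
    show "AE x in N. (\<lambda>i. (cmod (f x - F i x))\<^sup>2) \<longlonglongrightarrow> 0"
    proof (rule AE_I2)
      fix x assume "x \<in> space N"
      then have "(\<lambda>i. (cmod (f x - F i x))\<^sup>2) \<longlonglongrightarrow> (cmod (f x - f x))\<^sup>2"
        by (intro tendsto_intros F)
      then show "(\<lambda>i. (cmod (f x - F i x))\<^sup>2) \<longlonglongrightarrow> 0" by simp
    qed
    show "AE x in N. norm ((cmod (f x - F i x))\<^sup>2) \<le> 9 * (cmod (f x))\<^sup>2" for i
    proof (rule AE_I2)
      fix x assume "x \<in> space N"
      then have "cmod (f x - F i x) \<le> 3 * cmod (f x)"
        using norm_triangle_ineq4[of "f x" "F i x"] F(3)[of x i] by simp
      then have "(cmod (f x - F i x))\<^sup>2 \<le> (3 * cmod (f x))\<^sup>2" by (intro power_mono) auto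
      then show "norm ((cmod (f x - F i x))\<^sup>2) \<le> 9 * (cmod (f x))\<^sup>2" by (simp add: power_mult_distrib)
    qed
  qed auto
  then have "(\<lambda>i. quad (L2_inner N) (\<lambda>x. f x - F i x)) \<longlonglongrightarrow> 0" by (simp add: quad_L2)
  then have "\<forall>\<^sub>F i in sequentially. quad (L2_inner N) (\<lambda>x. f x - F i x) < \<delta>"
    using assms(2) by (rule order_tendstoD)
  then obtain i where "quad (L2_inner N) (\<lambda>x. f x - F i x) < \<delta>" by (auto simp: eventually_sequentially)
  then show ?thesis using F(1) FL by blast
qed

text \<open>
  Finitely many elements of \<open>L\<^sup>2\<close> are approximated by their projections onto the span of a single
  finite orthonormal family of non-negative functions, namely normalized indicator functions of
  disjoint sets. The non-negativity is what makes the positivity of the resolvents usable.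
\<close>

lemma nonneg_orthonormal_approx:
  fixes \<psi> :: "'j \<Rightarrow> 'a \<Rightarrow> complex"
  assumes J: "finite J" "\<And>j. j \<in> J \<Longrightarrow> \<psi> j \<in> L2 N" and "0 < \<delta>"
  shows "\<exists>(I :: ('j \<Rightarrow> complex) set) \<rho>. psd_form.orthonormal (L2 N) (L2_inner N) (\<lambda>i x. complex_of_real (\<rho> i x)) I \<and>
     (\<forall>i x. 0 \<le> \<rho> i x) \<and>
     (\<forall>j\<in>J. quad (L2_inner N) (\<lambda>x. \<psi> j x - (\<Sum>i\<in>I. L2_inner N (\<psi> j) (\<lambda>x. complex_of_real (\<rho> i x)) * of_real (\<rho> i x))) < \<delta>)"
proof -
  have "\<forall>j\<in>J. \<exists>S. simple_function N S \<and> S \<in> L2 N \<and> quad (L2_inner N) (\<lambda>x. \<psi> j x - S x) < \<delta>"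
    using J(2) \<open>0 < \<delta>\<close> L2_simple_approx by blast
  then obtain S where S: "\<And>j. j \<in> J \<Longrightarrow> simple_function N (S j)" "\<And>j. j \<in> J \<Longrightarrow> S j \<in> L2 N"
    "\<And>j. j \<in> J \<Longrightarrow> quad (L2_inner N) (\<lambda>x. \<psi> j x - S j x) < \<delta>"
    by metis
  define \<Phi> where "\<Phi> x = restrict (\<lambda>j. S j x) J" for x
  define Y where "Y = \<Phi> ` space N"
  have "Y \<subseteq> (PiE J (\<lambda>j. S j ` space N))" unfolding Y_def \<Phi>_def by auto
  then have finY: "finite Y"
    using J(1) S(1) by (rule_tac finite_subset) (auto intro!: finite_PiE simp: simple_function_def)
  \<comment> \<open>the joint level sets of the simple functions\<close>
  define A where "A y = {x \<in> space N. \<forall>j\<in>J. S j x = y j}" for y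
  have A_sets [measurable]: "A y \<in> sets N" for y
    unfolding A_def using J(1) S(1) by (intro sets.sets_Collect_finite_All) (auto dest: simple_functionD(2))
  have A_disj: "\<not> (x \<in> A y \<and> x \<in> A y')" if "y \<in> Y" "y' \<in> Y" "y \<noteq> y'" for x y y'
  proof
    assume "x \<in> A y \<and> x \<in> A y'"
    then have "\<forall>j\<in>J. y j = y' j" by (auto simp: A_def)
    moreover have "y \<in> extensional J" "y' \<in> extensional J" using that by (auto simp: Y_def \<Phi>_def)
    ultimately have "y = y'" by (intro extensionalityI) auto
    then show False using that by simp
  qed
  define I where "I = {y \<in> Y. 0 < emeasure N (A y) \<and> emeasure N (A y) < \<infinity>}"
  have finI: "finite I" using finY by (simp add: I_def)
  define \<mu> where "\<mu> y = measure N (A y)" for y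
  have \<mu>_pos: "0 < \<mu> y" if "y \<in> I" for y
    using that unfolding I_def \<mu>_def by (simp add: measure_def enn2real_positive_iff)
  define \<rho> where "\<rho> y x = indicator (A y) x / sqrt (\<mu> y)" for y x
  have \<rho>_nonneg: "0 \<le> \<rho> y x" for y x by (simp add: \<rho>_def \<mu>_def)
  define e where "e y x = complex_of_real (\<rho> y x)" for y x
  have int_A: "integrable N (indicator (A y) :: 'a \<Rightarrow> real)" if "y \<in> I" for y
    using that by (simp add: I_def)
  have e_prod: "e y x * cnj (e y' x) = complex_of_real (if y = y' then indicator (A y) x / \<mu> y else 0)"
    if "y \<in> I" "y' \<in> I" for y y' x
    using A_disj[of y y' x] that \<mu>_pos[of y]
    by (auto simp: e_def \<rho>_def I_def indicator_def simp flip: of_real_mult)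
  have eL: "e y \<in> L2 N" if "y \<in> I" for y
  proof -
    have "(cmod (e y x))\<^sup>2 = indicator (A y) x / \<mu> y" for x
      using \<mu>_pos[OF that] by (auto simp: e_def \<rho>_def indicator_def norm_divide power_divide)
    moreover have "e y \<in> borel_measurable N" unfolding e_def \<rho>_def by measurable
    ultimately show ?thesis using int_A[OF that] by (simp add: L2_def)
  qed
  have e_on: "psd_form.orthonormal (L2 N) (L2_inner N) e I"
    unfolding L2.orthonormal_def
  proof (intro conjI ballI finI eL)
    fix y y' assume y: "y \<in> I" "y' \<in> I"
    have "L2_inner N (e y) (e y') = complex_of_real (\<integral>x. (if y = y' then indicator (A y) x / \<mu> y else 0) \<partial>N)"
      unfolding L2_inner_def e_prod[OF y] by (rule integral_complex_of_real)
    also have "\<dots> = (if y = y' then 1 else 0)"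
      using \<mu>_pos[OF y(1)] sets.sets_into_space[OF A_sets] by (auto simp: \<mu>_def Int_absorb2)
    finally show "L2_inner N (e y) (e y') = (if y = y' then 1 else 0)" .
  qed
  have S_eq: "AE x in N. S j x = (\<Sum>y\<in>I. (y j * sqrt (\<mu> y)) * e y x)" if j: "j \<in> J" for j
  proof -
    have "AE x in N. \<forall>y\<in>{y\<in>Y. emeasure N (A y) = 0}. x \<notin> A y"
      using finY by (intro AE_finite_allI) (auto intro!: AE_not_in simp: null_sets_def)
    then show ?thesis
    proof (rule AE_mp, intro AE_I2 impI)
      fix x assume x: "x \<in> space N" and nz: "\<forall>y\<in>{y\<in>Y. emeasure N (A y) = 0}. x \<notin> A y"
      have xA: "x \<in> A (\<Phi> x)" and \<Phi>Y: "\<Phi> x \<in> Y" using x by (auto simp: A_def \<Phi>_def Y_def)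
      have "(\<Sum>y\<in>I. (y j * sqrt (\<mu> y)) * e y x) = (\<Sum>y\<in>I. if y = \<Phi> x then \<Phi> x j else 0)"
      proof (intro sum.cong refl)
        fix y assume y: "y \<in> I"
        show "(y j * sqrt (\<mu> y)) * e y x = (if y = \<Phi> x then \<Phi> x j else 0)"
        proof (cases "y = \<Phi> x")
          case True
          then have "e y x = 1 / complex_of_real (sqrt (\<mu> y))" using xA by (simp add: e_def \<rho>_def)
          then show ?thesis using True \<mu>_pos[OF y] by simp
        next
          case False
          then have "x \<notin> A y" using A_disj[of y "\<Phi> x" x] y xA \<Phi>Y by (auto simp: I_def)
          then show ?thesis using False by (simp add: e_def \<rho>_def)
        qed
      qed
      also have "\<dots> = (if \<Phi> x \<in> I then S j x else 0)" using finI j by (auto simp: \<Phi>_def)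
      also have "\<dots> = S j x"
      proof (cases "\<Phi> x \<in> I")
        case False
        \<comment> \<open>a square-integrable simple function vanishes on its level sets of infinite measure\<close>
        have inf: "emeasure N (A (\<Phi> x)) = \<infinity>"
          using False nz xA \<Phi>Y by (auto simp: I_def less_top zero_less_iff_neq_zero)
        have "S j x = 0"
        proof (rule ccontr)
          assume nz: "S j x \<noteq> 0"
          have "integrable N (\<lambda>z. (cmod (S j x))\<^sup>2 * indicator (A (\<Phi> x)) z)"
          proof (rule Bochner_Integration.integrable_bound[OF L2_integrable[OF S(2)[OF j]]])
            show "AE z in N. norm ((cmod (S j x))\<^sup>2 * indicator (A (\<Phi> x)) z) \<le> norm ((cmod (S j z))\<^sup>2)"
              using j by (intro AE_I2) (auto simp: indicator_def A_def \<Phi>_def)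
          qed measurable
          then have "integrable N (indicator (A (\<Phi> x)) :: 'a \<Rightarrow> real)" using nz by simp
          then show False using inf sets.sets_into_space[OF A_sets] by (simp add: integrable_indicator_iff Int_absorb2)
        qed
        then show ?thesis using False by simp
      qed simp
      finally show "S j x = (\<Sum>y\<in>I. (y j * sqrt (\<mu> y)) * e y x)" by simp
    qed
  qed
  have "quad (L2_inner N) (\<lambda>x. \<psi> j x - (\<Sum>i\<in>I. L2_inner N (\<psi> j) (e i) * e i x)) < \<delta>" if j: "j \<in> J" for j
  proof -
    have "quad (L2_inner N) (\<lambda>x. \<psi> j x - (\<Sum>i\<in>I. L2_inner N (\<psi> j) (e i) * e i x))
        \<le> quad (L2_inner N) (\<lambda>x. \<psi> j x - (\<Sum>y\<in>I. (y j * sqrt (\<mu> y)) * e y x))"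
      by (rule L2.best_approximation[OF e_on J(2)[OF j]])
    also have "\<dots> = quad (L2_inner N) (\<lambda>x. \<psi> j x - S j x)"
    proof -
      have [measurable]: "\<psi> j \<in> borel_measurable N" "S j \<in> borel_measurable N"
        using J(2) S(2) j by (auto dest: L2_measurable)
      have [measurable]: "(\<lambda>x. \<Sum>y\<in>I. (y j * sqrt (\<mu> y)) * e y x) \<in> borel_measurable N"
        using L2_measurable[OF eL] by (intro borel_measurable_sum borel_measurable_times) auto
      show ?thesis
        unfolding quad_L2 using S_eq[OF j] by (intro integral_cong_AE) (auto elim!: eventually_mono)
    qed
    finally show ?thesis using S(3)[OF j] by simp
  qed
  then show ?thesis using e_on \<rho>_nonneg unfolding e_def by blast
qed

section \<open>A discrete differential inequality\<close>

text \<open>Bernoulli's inequality for real exponents.\<close>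

lemma bernoulli_powr:
  fixes x a :: real
  assumes "1 \<le> a" "0 \<le> x"
  shows "1 + a * x \<le> (1 + x) powr a"
proof -
  have pos: "0 < 1 + a * x" using assms by (simp add: add_pos_nonneg)
  have "(1 + a * x) powr (1 / a) * 1 powr (1 - 1 / a) \<le> 1 / a * (1 + a * x) + (1 - 1 / a) * 1"
    using assms pos by (intro Youngs_inequality_0) auto
  also have "\<dots> = 1 + x" using assms by (simp add: field_simps)
  finally have "((1 + a * x) powr (1 / a)) powr a \<le> (1 + x) powr a"
    using assms by (intro powr_mono2) auto
  then show ?thesis using assms pos by (simp add: powr_powr)
qed

text \<open>
  The implicit Euler scheme for \<open>h' = - h\<^bsup>1+b\<^esup>\<close> with step \<open>c\<close>: after \<open>n\<close> steps \<open>h\<close> is at most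
  \<open>(b c n)\<^bsup>-1/b\<^esup>\<close>, as for the differential equation, up to a factor that tends to one as \<open>c \<rightarrow> 0\<close>.
\<close>

lemma decay_bound:
  fixes h :: "nat \<Rightarrow> real"
  assumes bc: "0 < b" "0 < c" and "0 < n"
    and nn: "\<And>k. 0 \<le> h k" and step: "\<And>k. h (Suc k) + c * h (Suc k) powr (1 + b) \<le> h k"
    and H0: "h 0 \<le> H0"
  shows "h n \<le> (b * c * real n) powr (- 1 / b) * (1 + c * H0 powr b) powr ((1 + b) / b)"
proof (cases "h n = 0")
  case False
  have dec: "h (Suc k) \<le> h k" for k
  proof -
    have "0 \<le> c * h (Suc k) powr (1 + b)" using bc by simp
    then show ?thesis using step[of k] by linarith
  qed
  have anti: "h j \<le> h i" if "i \<le> j" for i j using dec that by (rule lift_Suc_antimono_le)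
  have pos: "0 < h k" if "k \<le> n" for k using anti[OF that] nn[of n] False by linarith
  define x0 where "x0 = c * H0 powr b"
  have x0: "0 \<le> x0" using bc by (simp add: x0_def)
  \<comment> \<open>\<open>h\<^bsup>-b\<^esup>\<close> grows at least by \<open>d\<close> in each step\<close>
  define d where "d = b * c * (1 + x0) powr (- (1 + b))"
  have inc: "h k powr (- b) + d \<le> h (Suc k) powr (- b)" if k: "k < n" for k
  proof -
    define h' where "h' = h (Suc k)"
    define x where "x = c * h' powr b"
    have h': "0 < h'" using k by (simp add: h'_def pos)
    have x: "0 < x" using bc h' by (simp add: x_def)
    have "h' \<le> H0" using anti[of 0 "Suc k"] H0 by (simp add: h'_def)
    then have xx0: "x \<le> x0" unfolding x_def x0_def using bc h' by (intro mult_left_mono powr_mono2) auto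
    have "h' * (1 + x) \<le> h k"
      using step[of k] h' by (simp add: x_def powr_add h'_def[symmetric] algebra_simps)
    then have "h k powr (- b) \<le> (h' * (1 + x)) powr (- b)"
      using bc x h' by (intro powr_mono2') auto
    also have "\<dots> = h' powr (- b) * (1 + x) powr (- b)" using x h' by (simp add: powr_mult)
    finally have 1: "h k powr (- b) \<le> h' powr (- b) * (1 + x) powr (- b)" .
    have "1 + (1 + b) * x \<le> (1 + x) powr (1 + b)" using bc x by (intro bernoulli_powr) auto
    then have "(1 + x + b * x) * (1 + x) powr (- (1 + b)) \<le> (1 + x) powr (1 + b) * (1 + x) powr (- (1 + b))"
      by (intro mult_right_mono) (auto simp: algebra_simps)
    also have "\<dots> = 1" using x by (simp flip: powr_add)
    also have "(1 + x + b * x) * (1 + x) powr (- (1 + b)) = (1 + x) powr (- b) + b * x * (1 + x) powr (- (1 + b))"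
    proof -
      have "(1 + x) powr (- b) = (1 + x) * (1 + x) powr (- (1 + b))"
        using x by (simp add: powr_mult_base)
      then show ?thesis by (simp add: algebra_simps)
    qed
    finally have "(1 + x) powr (- b) + b * x * (1 + x) powr (- (1 + b)) \<le> 1" .
    then have "h' powr (- b) * ((1 + x) powr (- b) + b * x * (1 + x) powr (- (1 + b))) \<le> h' powr (- b) * 1"
      by (intro mult_left_mono) auto
    moreover have "h' powr (- b) * (b * x * (1 + x) powr (- (1 + b))) = b * c * (1 + x) powr (- (1 + b))"
    proof -
      have "h' powr (- b) * x = c" using h' by (simp add: x_def powr_minus)
      moreover have "h' powr (- b) * (b * x * (1 + x) powr (- (1 + b)))
          = b * (h' powr (- b) * x) * (1 + x) powr (- (1 + b))"
        by (simp only: mult_ac)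
      ultimately show ?thesis by simp
    qed
    moreover have "d \<le> b * c * (1 + x) powr (- (1 + b))"
      unfolding d_def using bc x xx0 by (intro mult_left_mono powr_mono2') auto
    ultimately show ?thesis using 1 unfolding h'_def[symmetric] distrib_left mult_1_right by linarith
  qed
  have "real k * d \<le> h k powr (- b)" if "k \<le> n" for k
    using that
  proof (induction k)
    case (Suc k)
    then show ?case using inc[of k] by (simp add: algebra_simps)
  qed simp
  then have low: "real n * d \<le> h n powr (- b)" by simp
  have dpos: "0 < real n * d" using bc x0 \<open>0 < n\<close> by (simp add: d_def)
  have "h n = (h n powr (- b)) powr (- 1 / b)" using pos[of n] bc by (simp add: powr_powr)
  also have "\<dots> \<le> (real n * d) powr (- 1 / b)" using low dpos bc by (intro powr_mono2') auto
  also have "real n * d = (b * c * real n) * (1 + x0) powr (- (1 + b))" by (simp add: d_def)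
  also have "\<dots> powr (- 1 / b) = (b * c * real n) powr (- 1 / b) * (1 + x0) powr ((1 + b) / b)"
  proof -
    have "- (1 + b) * (- 1 / b) = (1 + b) / b" using bc by (simp add: field_simps)
    then have "((1 + x0) powr (- (1 + b))) powr (- 1 / b) = (1 + x0) powr ((1 + b) / b)"
      by (simp only: powr_powr)
    then show ?thesis using bc by (simp only: powr_mult)
  qed
  finally show ?thesis by (simp only: x0_def)
qed simp

section \<open>Forms satisfying a Sobolev inequality\<close>

lemma ae_nonneg_AE: "ae_nonneg N u \<Longrightarrow> AE x in N. u x = complex_of_real (cmod (u x))"
  unfolding ae_nonneg_def by (elim eventually_mono) (auto simp: complex_eq_iff cmod_def)

context psd_form
begin

text \<open>Functions with the same pairings need not be equal, but have the same norm.\<close>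

lemma quad_cong_weak:
  assumes "u \<in> H" "v \<in> H" "\<And>w. w \<in> H \<Longrightarrow> s u w = s v w"
  shows "quad s u = quad s v"
proof -
  have "s u u = cnj (s u v)" using assms herm by metis
  also have "s u v = s v v" using assms by blast
  finally show ?thesis by (simp add: quad_def)
qed

lemma form_complete_equiv:
  assumes form_complete "psd_form H s'" "0 < c"
    and le: "\<And>u. u \<in> H \<Longrightarrow> c * quad s u \<le> quad s' u" "\<And>u. u \<in> H \<Longrightarrow> quad s' u \<le> C * quad s u"
  shows "psd_form.form_complete H s'"
proof -
  interpret s': psd_form H s' by fact
  show ?thesis
    unfolding s'.form_complete_def
  proof (intro allI impI, elim conjE)
    fix U :: "nat \<Rightarrow> _"
    assume U: "\<forall>n. U n \<in> H" and cauchy: "\<forall>e>0. \<exists>n0. \<forall>m\<ge>n0. \<forall>n\<ge>n0. quad s' (\<lambda>x. U m x - U n x) < e"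
    have "\<exists>n0. \<forall>m\<ge>n0. \<forall>n\<ge>n0. quad s (\<lambda>x. U m x - U n x) < e" if "e > 0" for e
    proof -
      obtain n0 where n0: "\<And>m n. m \<ge> n0 \<Longrightarrow> n \<ge> n0 \<Longrightarrow> quad s' (\<lambda>x. U m x - U n x) < c * e"
        using cauchy \<open>0 < c\<close> \<open>e > 0\<close> by (meson mult_pos_pos)
      have "quad s (\<lambda>x. U m x - U n x) < e" if "m \<ge> n0" "n \<ge> n0" for m n
      proof -
        have "c * quad s (\<lambda>x. U m x - U n x) < c * e"
          using n0[OF that] le(1)[OF diff_in, of "U m" "U n"] U by simp
        then show ?thesis using \<open>0 < c\<close> by simp
      qed
      then show ?thesis by blast
    qed
    then obtain u where u: "u \<in> H" "(\<lambda>n. quad s (\<lambda>x. U n x - u x)) \<longlonglongrightarrow> 0"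
      using \<open>form_complete\<close> U unfolding form_complete_def by blast
    have "(\<lambda>n. C * quad s (\<lambda>x. U n x - u x)) \<longlonglongrightarrow> 0"
      by (rule tendsto_mult_right_zero[OF u(2)])
    moreover have d: "(\<lambda>x. U n x - u x) \<in> H" for n using U u(1) by (intro diff_in) auto
    ultimately have "(\<lambda>n. quad s' (\<lambda>x. U n x - u x)) \<longlonglongrightarrow> 0"
      using tendsto_zero_le[of "\<lambda>n. quad s' (\<lambda>x. U n x - u x)", OF s'.nonneg[OF d] le(2)[OF d]] by blast
    then show "\<exists>u\<in>H. (\<lambda>n. quad s' (\<lambda>x. U n x - u x)) \<longlonglongrightarrow> 0" using u(1) by blast
  qed
qed

end

text \<open>
  The setting of the Li--Yau argument: a complete form \<open>s\<close> on \<open>D \<subseteq> L\<^sup>2\<close> that does not increase under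
  \<open>u \<mapsto> \<bar>Re u\<bar>\<close> and satisfies a Sobolev inequality with exponent \<open>2p/(p - 1)\<close> and constant \<open>S\<close>, and a
  weight \<open>V \<ge> 0\<close> in \<open>L\<^sup>p\<close>.
\<close>

locale weighted_form = psd_form D s
  for D :: "('a \<Rightarrow> complex) set" and s +
  fixes M :: "'a measure" and V :: "'a \<Rightarrow> real" and p S :: real
  assumes complete_s: "form_complete"
    and D_L2: "D \<subseteq> L2 M"
    and abs_in: "u \<in> D \<Longrightarrow> (\<lambda>x. complex_of_real \<bar>Re (u x)\<bar>) \<in> D"
    and abs_le: "u \<in> D \<Longrightarrow> quad s (\<lambda>x. complex_of_real \<bar>Re (u x)\<bar>) \<le> quad s u"
    and p: "1 < p" and S: "0 < S"
    and sob_int: "u \<in> D \<Longrightarrow> integrable M (\<lambda>x. cmod (u x) powr (2 * p / (p - 1)))"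
    and sob: "u \<in> D \<Longrightarrow> S * (\<integral>x. cmod (u x) powr (2 * p / (p - 1)) \<partial>M) powr ((p - 1) / p) \<le> quad s u"
    and V_meas [measurable]: "V \<in> borel_measurable M"
    and V_nonneg: "AE x in M. 0 \<le> V x"
    and V_int: "integrable M (\<lambda>x. V x powr p)"
begin

text \<open>The measure \<open>V(x) dx\<close>, whose \<open>L\<^sup>2\<close> space is denoted \<open>L\<^sup>2(V)\<close> in the comments.\<close>

definition N :: "'a measure" where "N = density M (\<lambda>x. ennreal (V x))"

definition Vp :: real where "Vp = (\<integral>x. V x powr p \<partial>M)"

abbreviation inner_N where "inner_N \<equiv> L2_inner N"
abbreviation quad_N where "quad_N \<equiv> quad (L2_inner N)"

lemma sets_N [measurable_cong]: "sets N = sets M"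
  by (simp add: N_def)

lemma integrable_N_iff:
  fixes f :: "'a \<Rightarrow> 'b :: {banach, second_countable_topology}"
  shows "f \<in> borel_measurable M \<Longrightarrow> integrable N f \<longleftrightarrow> integrable M (\<lambda>x. V x *\<^sub>R f x)"
  unfolding N_def using V_nonneg by (simp add: integrable_density)

lemma integral_N:
  fixes f :: "'a \<Rightarrow> 'b :: {banach, second_countable_topology}"
  shows "f \<in> borel_measurable M \<Longrightarrow> (\<integral>x. f x \<partial>N) = (\<integral>x. V x *\<^sub>R f x \<partial>M)"
  unfolding N_def using V_nonneg by (simp add: integral_density)

lemma D_meas [measurable_dest]: "u \<in> D \<Longrightarrow> u \<in> borel_measurable M"
  using D_L2 L2_measurable by blast

lemma L2_N_meas: "u \<in> L2 N \<Longrightarrow> u \<in> borel_measurable M"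
  using L2_measurable[of u N] by (simp add: measurable_cong_sets[OF sets_N refl])

lemma Vp_nonneg: "0 \<le> Vp"
  unfolding Vp_def by simp

text \<open>Hoelder's inequality and the Sobolev inequality bound the weighted norm by the form.\<close>

lemma weight_bound:
  assumes u: "u \<in> D"
  shows "u \<in> L2 N" and "quad_N u \<le> Vp powr (1 / p) / S * quad s u"
proof -
  let ?q = "2 * p / (p - 1)"
  have um [measurable]: "u \<in> borel_measurable M" using u by (rule D_meas)
  have e: "1 / p + 1 / ?q + 1 / ?q = 1" using p by (simp add: field_simps)
  note h = holder3[OF V_int sob_int[OF u] sob_int[OF u], of "1/p" "1/?q" "1/?q"]
  have eq: "AE x in M. (V x powr p) powr (1/p) * (cmod (u x) powr ?q) powr (1/?q) * (cmod (u x) powr ?q) powr (1/?q)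
      = V x * (cmod (u x))\<^sup>2"
    using V_nonneg by eventually_elim (use p in \<open>simp add: powr_powr power2_eq_square\<close>)
  have "integrable M (\<lambda>x. V x * (cmod (u x))\<^sup>2)"
    using h(1) p e by (subst integrable_cong_AE[OF _ _ eq, symmetric]) auto
  then show uL: "u \<in> L2 N" by (simp add: L2_def integrable_N_iff measurable_cong_sets[OF sets_N refl])
  let ?X = "\<integral>x. cmod (u x) powr ?q \<partial>M"
  have "quad_N u = (\<integral>x. V x * (cmod (u x))\<^sup>2 \<partial>M)" by (simp add: quad_L2 integral_N)
  also have "\<dots> = (\<integral>x. (V x powr p) powr (1/p) * (cmod (u x) powr ?q) powr (1/?q) * (cmod (u x) powr ?q) powr (1/?q) \<partial>M)"
    by (rule integral_cong_AE[symmetric, OF _ _ eq]) auto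
  also have "\<dots> \<le> Vp powr (1/p) * ?X powr (1/?q) * ?X powr (1/?q)"
    unfolding Vp_def using h(2) p e by auto
  also have "\<dots> = Vp powr (1/p) * ?X powr ((p - 1) / p)"
  proof -
    have "1 / ?q + 1 / ?q = (p - 1) / p" using p by (simp add: field_simps)
    then show ?thesis by (simp only: mult.assoc powr_add[symmetric])
  qed
  also have "\<dots> \<le> Vp powr (1/p) * (quad s u / S)"
    using sob[OF u] S by (intro mult_left_mono) (auto simp: field_simps)
  finally show "quad_N u \<le> Vp powr (1 / p) / S * quad s u" by simp
qed

subsection \<open>The resolvents\<close>

lemma riesz_N:
  assumes "f \<in> L2 N"
  shows "\<exists>w\<in>D. \<forall>v\<in>D. s w v = inner_N f v"
proof (rule riesz[OF complete_s])
  show "inner_N f (\<lambda>x. a * u x + b * v x) = cnj a * inner_N f u + cnj b * inner_N f v"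
    if "u \<in> D" "v \<in> D" for u v a b
    using that weight_bound(1) assms by (intro L2.lin_right) auto
  show "(cmod (inner_N f v))\<^sup>2 \<le> (quad_N f * (Vp powr (1 / p) / S)) * quad s v" if "v \<in> D" for v
  proof -
    have "(cmod (inner_N f v))\<^sup>2 \<le> quad_N f * quad_N v"
      using weight_bound(1)[OF that] assms by (intro L2.cauchy_schwarz) auto
    also have "\<dots> \<le> quad_N f * (Vp powr (1 / p) / S * quad s v)"
      using weight_bound(2)[OF that] L2.nonneg[OF assms] by (intro mult_left_mono) auto
    finally show ?thesis by (simp add: mult.assoc)
  qed
qed

text \<open>
  \<open>K = A\<^sup>-\<^sup>1\<close> and \<open>R \<epsilon> = (1 + \<epsilon> A)\<^sup>-\<^sup>1\<close>, where \<open>A\<close> is the operator of the form \<open>s\<close> in \<open>L\<^sup>2(V)\<close>. Their values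
  are chosen representatives: they are determined by the weak equations up to functions on which
  \<open>s\<close> vanishes, and are linear in that sense only.
\<close>

definition K :: "('a \<Rightarrow> complex) \<Rightarrow> 'a \<Rightarrow> complex" where
  "K f = (SOME w. w \<in> D \<and> (\<forall>v\<in>D. s w v = inner_N f v))"

lemma K: "f \<in> L2 N \<Longrightarrow> K f \<in> D" "f \<in> L2 N \<Longrightarrow> v \<in> D \<Longrightarrow> s (K f) v = inner_N f v"
  using someI_ex[of "\<lambda>w. w \<in> D \<and> (\<forall>v\<in>D. s w v = inner_N f v)"] riesz_N[of f]
  unfolding K_def by blast+

definition R :: "real \<Rightarrow> ('a \<Rightarrow> complex) \<Rightarrow> 'a \<Rightarrow> complex" where
  "R \<epsilon> f = (SOME w. w \<in> D \<and> (\<forall>v\<in>D. of_real \<epsilon> * s w v + inner_N w v = inner_N f v))"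

context
  fixes \<epsilon> :: real
  assumes \<epsilon>: "0 < \<epsilon>"
begin

text \<open>The form of the operator \<open>1 + \<epsilon> A\<close>.\<close>

definition s\<^sub>\<epsilon> where "s\<^sub>\<epsilon> u v = of_real \<epsilon> * s u v + inner_N u v"

lemma quad_s\<epsilon>: "quad s\<^sub>\<epsilon> u = \<epsilon> * quad s u + quad_N u"
  by (simp add: quad_def s\<^sub>\<epsilon>_def)

lemma psd_s\<epsilon>: "psd_form D s\<^sub>\<epsilon>"
proof
  show "fun_subspace D" by (rule subspace)
  show "s\<^sub>\<epsilon> (\<lambda>x. a * u x + b * v x) w = a * s\<^sub>\<epsilon> u w + b * s\<^sub>\<epsilon> v w" if "u \<in> D" "v \<in> D" "w \<in> D" for a b u v w
    using that weight_bound(1) by (simp add: s\<^sub>\<epsilon>_def lin L2.lin algebra_simps)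
  show "s\<^sub>\<epsilon> v u = cnj (s\<^sub>\<epsilon> u v)" if "u \<in> D" "v \<in> D" for u v
    using that weight_bound(1) herm[of u v] L2.herm[of u N v] by (simp add: s\<^sub>\<epsilon>_def)
  show "0 \<le> quad s\<^sub>\<epsilon> u" if "u \<in> D" for u
    using that weight_bound(1) \<epsilon> nonneg L2.nonneg
    by (auto simp: quad_s\<epsilon> intro!: add_nonneg_nonneg mult_nonneg_nonneg)
qed

lemma complete_s\<epsilon>: "psd_form.form_complete D s\<^sub>\<epsilon>"
proof (rule form_complete_equiv[OF complete_s psd_s\<epsilon> \<epsilon>])
  show "\<epsilon> * quad s u \<le> quad s\<^sub>\<epsilon> u" if "u \<in> D" for u
    using L2.nonneg[OF weight_bound(1)[OF that]] by (simp add: quad_s\<epsilon>)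
  show "quad s\<^sub>\<epsilon> u \<le> (\<epsilon> + Vp powr (1 / p) / S) * quad s u" if "u \<in> D" for u
    using weight_bound(2)[OF that] by (simp add: quad_s\<epsilon> distrib_right)
qed

lemma R:
  assumes "f \<in> L2 N"
  shows "R \<epsilon> f \<in> D" "v \<in> D \<Longrightarrow> of_real \<epsilon> * s (R \<epsilon> f) v + inner_N (R \<epsilon> f) v = inner_N f v"
proof -
  interpret e: psd_form D "s\<^sub>\<epsilon>" by (rule psd_s\<epsilon>)
  have "\<exists>w\<in>D. \<forall>v\<in>D. s\<^sub>\<epsilon> w v = inner_N f v"
  proof (rule e.riesz[OF complete_s\<epsilon>])
    show "inner_N f (\<lambda>x. a * u x + b * v x) = cnj a * inner_N f u + cnj b * inner_N f v"
      if "u \<in> D" "v \<in> D" for u v a b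
      using that weight_bound(1) assms by (intro L2.lin_right) auto
    show "(cmod (inner_N f v))\<^sup>2 \<le> quad_N f * quad s\<^sub>\<epsilon> v" if "v \<in> D" for v
    proof -
      have "(cmod (inner_N f v))\<^sup>2 \<le> quad_N f * quad_N v"
        using weight_bound(1)[OF that] assms by (intro L2.cauchy_schwarz) auto
      also have "\<dots> \<le> quad_N f * quad s\<^sub>\<epsilon> v"
        using nonneg[OF that] \<epsilon> L2.nonneg[OF assms] by (intro mult_left_mono) (auto simp: quad_s\<epsilon>)
      finally show ?thesis .
    qed
  qed
  then have "\<exists>w. w \<in> D \<and> (\<forall>v\<in>D. of_real \<epsilon> * s w v + inner_N w v = inner_N f v)"
    unfolding s\<^sub>\<epsilon>_def by blast
  from someI_ex[OF this]
  show "R \<epsilon> f \<in> D" "v \<in> D \<Longrightarrow> of_real \<epsilon> * s (R \<epsilon> f) v + inner_N (R \<epsilon> f) v = inner_N f v"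
    unfolding R_def by blast+
qed

lemma R_L2: "f \<in> L2 N \<Longrightarrow> R \<epsilon> f \<in> L2 N"
  using R(1) weight_bound(1) by blast

lemma Rk_L2: "f \<in> L2 N \<Longrightarrow> (R \<epsilon> ^^ k) f \<in> L2 N"
  by (induction k) (auto intro: R_L2)

lemma R_symmetric:
  assumes "f \<in> L2 N" "g \<in> L2 N"
  shows "inner_N (R \<epsilon> f) g = inner_N f (R \<epsilon> g)"
proof -
  have "inner_N (R \<epsilon> f) g = cnj (inner_N g (R \<epsilon> f))"
    using assms R_L2 by (intro L2.herm) auto
  also have "\<dots> = cnj (of_real \<epsilon> * s (R \<epsilon> g) (R \<epsilon> f) + inner_N (R \<epsilon> g) (R \<epsilon> f))"
    using assms R by simp
  also have "\<dots> = of_real \<epsilon> * s (R \<epsilon> f) (R \<epsilon> g) + inner_N (R \<epsilon> f) (R \<epsilon> g)"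
    using herm[of "R \<epsilon> g" "R \<epsilon> f"] L2.herm[of "R \<epsilon> g" N "R \<epsilon> f"] assms R(1) R_L2 by simp
  also have "\<dots> = inner_N f (R \<epsilon> g)" using assms R by simp
  finally show ?thesis .
qed

lemma Rk_symmetric:
  "f \<in> L2 N \<Longrightarrow> g \<in> L2 N \<Longrightarrow> inner_N ((R \<epsilon> ^^ k) f) g = inner_N f ((R \<epsilon> ^^ k) g)"
proof (induction k arbitrary: g)
  case (Suc k)
  have "inner_N ((R \<epsilon> ^^ Suc k) f) g = inner_N ((R \<epsilon> ^^ k) f) (R \<epsilon> g)"
    using Suc.prems by (simp add: R_symmetric Rk_L2)
  also have "\<dots> = inner_N f ((R \<epsilon> ^^ k) (R \<epsilon> g))" using Suc R_L2 by blast
  finally show ?case by (simp add: funpow_swap1)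
qed simp

lemma R_identity:
  assumes "f \<in> L2 N"
  shows "\<epsilon> * quad s (R \<epsilon> f) + quad_N (R \<epsilon> f) = Re (inner_N f (R \<epsilon> f))"
  using R(2)[OF assms R(1)[OF assms]] by (simp add: quad_def complex_eq_iff)

lemma R_contraction:
  assumes "f \<in> L2 N"
  shows "quad_N (R \<epsilon> f) \<le> quad_N f"
proof -
  have "quad_N (R \<epsilon> f) \<le> Re (inner_N f (R \<epsilon> f))"
    using R_identity[OF assms] mult_nonneg_nonneg[OF less_imp_le[OF \<epsilon>] nonneg[OF R(1)[OF assms]]] by linarith
  also have "\<dots> \<le> cmod (inner_N f (R \<epsilon> f))" by (rule complex_Re_le_cmod)
  also have "\<dots> \<le> sqrt (quad_N f) * sqrt (quad_N (R \<epsilon> f))"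
    using assms R_L2 by (intro L2.cauchy_schwarz_sqrt)
  also have "\<dots> \<le> (quad_N f + quad_N (R \<epsilon> f)) / 2"
    using arith_geo_mean_sqrt[of "quad_N f" "quad_N (R \<epsilon> f)"] L2.nonneg[OF assms] L2.nonneg[OF R_L2[OF assms]]
    by (simp add: real_sqrt_mult)
  finally show ?thesis by simp
qed

lemma Rk_contraction: "f \<in> L2 N \<Longrightarrow> quad_N ((R \<epsilon> ^^ k) f) \<le> quad_N f"
  by (induction k) (auto intro: order_trans[OF R_contraction] Rk_L2)

text \<open>
  The resolvent preserves positivity: up to functions of norm zero, \<open>R f\<close> is the unique minimizer
  of \<open>\<epsilon> s[u] + \<parallel>u\<parallel>\<^sup>2 - 2 Re \<langle>f,u\<rangle>\<close> in \<open>D\<close>, with the norm of \<open>L\<^sup>2(V)\<close>, and for \<open>f \<ge> 0\<close> replacing \<open>u\<close> by \<open>\<bar>Re u\<bar>\<close> does not increase this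
  functional.
\<close>

lemma R_nonneg:
  assumes f: "f \<in> L2 N" "ae_nonneg N f"
  shows "ae_nonneg N (R \<epsilon> f)"
proof -
  interpret e: psd_form D "s\<^sub>\<epsilon>" by (rule psd_s\<epsilon>)
  define u where "u = R \<epsilon> f"
  define v where "v = (\<lambda>x. complex_of_real \<bar>Re (u x)\<bar>)"
  have uD: "u \<in> D" unfolding u_def using f by (intro R)
  have vD: "v \<in> D" unfolding v_def using abs_in[OF uD] .
  have uL: "u \<in> L2 N" "v \<in> L2 N" using uD vD weight_bound(1) by auto
  have [measurable]: "u \<in> borel_measurable N" "f \<in> borel_measurable N" "v \<in> borel_measurable N"
    using uL f by (auto dest: L2_measurable)
  have su: "s\<^sub>\<epsilon> u w = inner_N f w" if "w \<in> D" for w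
    using R(2)[OF f(1) that] by (simp add: s\<^sub>\<epsilon>_def u_def)
  have qv: "quad_N v \<le> quad_N u"
    unfolding quad_L2
  proof (rule integral_mono)
    show "(cmod (v x))\<^sup>2 \<le> (cmod (u x))\<^sup>2" for x
      by (simp add: v_def cmod_power2)
  qed (use uL L2_integrable in auto)
  have fv: "Re (inner_N f u) \<le> Re (inner_N f v)"
  proof -
    have "(\<integral>x. Re (f x * cnj (u x)) \<partial>N) \<le> (\<integral>x. Re (f x * cnj (v x)) \<partial>N)"
    proof (rule integral_mono_AE)
      show "AE x in N. Re (f x * cnj (u x)) \<le> Re (f x * cnj (v x))"
        using f(2) unfolding ae_nonneg_def
        by eventually_elim (auto simp: v_def intro!: mult_left_mono)
    qed (intro integrable_Re L2_inner_integrable f uL)+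
    moreover have "(\<integral>x. Re (f x * cnj (w x)) \<partial>N) = Re (inner_N f w)" if "w \<in> L2 N" for w
      unfolding L2_inner_def by (rule integral_Re[OF L2_inner_integrable[OF f(1) that]])
    ultimately show ?thesis using uL by simp
  qed
  have "quad s\<^sub>\<epsilon> (\<lambda>x. v x - u x) = quad s\<^sub>\<epsilon> v - 2 * Re (s\<^sub>\<epsilon> v u) + quad s\<^sub>\<epsilon> u"
    by (rule e.quad_diff[OF vD uD])
  also have "s\<^sub>\<epsilon> v u = cnj (inner_N f v)" using e.herm[OF uD vD] su[OF vD] by simp
  also have "quad s\<^sub>\<epsilon> u = Re (inner_N f u)" using su[OF uD] by (simp add: quad_def)
  finally have "quad s\<^sub>\<epsilon> (\<lambda>x. v x - u x) = quad s\<^sub>\<epsilon> v - 2 * Re (inner_N f v) + Re (inner_N f u)" by simp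
  moreover have "quad s\<^sub>\<epsilon> v \<le> Re (inner_N f u)"
  proof -
    have "quad s\<^sub>\<epsilon> v \<le> quad s\<^sub>\<epsilon> u"
      unfolding quad_s\<epsilon> using abs_le[OF uD] qv \<epsilon> by (auto simp: v_def intro!: add_mono mult_left_mono)
    then show ?thesis using su[OF uD] by (simp add: quad_def)
  qed
  ultimately have "quad s\<^sub>\<epsilon> (\<lambda>x. v x - u x) \<le> 0" using fv by simp
  moreover have dD: "(\<lambda>x. v x - u x) \<in> D" "(\<lambda>x. v x - u x) \<in> L2 N" using vD uD diff_in weight_bound(1) by auto
  ultimately have "quad_N (\<lambda>x. v x - u x) = 0"
    using mult_nonneg_nonneg[OF less_imp_le[OF \<epsilon>] nonneg[OF dD(1)]] L2.nonneg[OF dD(2)]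
    unfolding quad_s\<epsilon> by linarith
  then have "AE x in N. v x - u x = 0" using L2_null_AE[OF dD(2)] by blast
  then show ?thesis
    unfolding ae_nonneg_def u_def[symmetric]
    by eventually_elim (auto simp: v_def complex_eq_iff)
qed

lemma Rk_nonneg: "f \<in> L2 N \<Longrightarrow> ae_nonneg N f \<Longrightarrow> ae_nonneg N ((R \<epsilon> ^^ k) f)"
  by (induction k) (auto intro: R_nonneg Rk_L2)

text \<open>
  The discrete derivative of \<open>k \<mapsto> \<langle>w, A\<^sup>-\<^sup>1 R\<^sup>2\<^sup>k w\<rangle>\<close>, which is the value \<open>quad s\<close> of \<open>K R\<^sup>k w\<close>:
  \<open>K w\<close> and \<open>K R w + \<epsilon> R w\<close> have the same pairings.
\<close>

lemma decrement:
  assumes w: "w \<in> L2 N"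
  shows "quad s (K (R \<epsilon> w)) + 2 * \<epsilon> * quad_N (R \<epsilon> w) \<le> quad s (K w)"
proof -
  define z where "z = (\<lambda>x. 1 * K (R \<epsilon> w) x + of_real \<epsilon> * R \<epsilon> w x)"
  have D: "K (R \<epsilon> w) \<in> D" "R \<epsilon> w \<in> D" "K w \<in> D" using w R K R_L2 by auto
  have zD: "z \<in> D" unfolding z_def using D by (intro comb_in)
  have "quad s (K w) = quad s z"
  proof (rule quad_cong_weak[OF D(3) zD])
    fix v assume v: "v \<in> D"
    have "s z v = inner_N (R \<epsilon> w) v + of_real \<epsilon> * s (R \<epsilon> w) v"
      unfolding z_def using lin[OF D(1,2) v, of 1 "of_real \<epsilon>"] K(2)[OF R_L2[OF w] v] by simp
    also have "\<dots> = inner_N w v" using R(2)[OF w v] by (simp add: add.commute)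
    finally show "s (K w) v = s z v" using K(2)[OF w v] by simp
  qed
  also have "\<dots> = quad s (K (R \<epsilon> w)) + 2 * \<epsilon> * Re (s (K (R \<epsilon> w)) (R \<epsilon> w)) + \<epsilon>\<^sup>2 * quad s (R \<epsilon> w)"
    unfolding z_def using quad_comb[OF D(1,2), of 1 "of_real \<epsilon>"] by simp
  also have "s (K (R \<epsilon> w)) (R \<epsilon> w) = inner_N (R \<epsilon> w) (R \<epsilon> w)" using K(2) R_L2 w D(2) by blast
  finally show ?thesis using nonneg[OF D(2)] by (simp add: quad_def)
qed

text \<open>
  Lower bound for \<open>\<langle>\<psi>, A\<^sup>-\<^sup>1 R\<^sup>2\<^sup>k \<psi>\<rangle>\<close>, where \<open>A\<close> is the operator of \<open>s\<close> in \<open>L\<^sup>2(V)\<close>: a step of the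
  iteration keeps the Rayleigh quotient at most one and decreases the norm by at most the factor
  \<open>1 + \<epsilon>\<close>.
\<close>

lemma rayleigh_step:
  assumes w: "w \<in> D" "quad s w \<le> quad_N w"
  shows "quad s (R \<epsilon> w) \<le> quad_N (R \<epsilon> w)" "quad_N w \<le> (1 + \<epsilon>)\<^sup>2 * quad_N (R \<epsilon> w)"
proof -
  have wL: "w \<in> L2 N" using w weight_bound by auto
  define w' where "w' = R \<epsilon> w"
  have w': "w' \<in> D" "w' \<in> L2 N" unfolding w'_def using R(1) R_L2 wL by auto
  define x where "x = quad_N w"
  \<comment> \<open>\<open>x\<close>, \<open>P\<close> and \<open>y\<close> are the moments of orders \<open>0, -1, -2\<close> of the spectral measure of \<open>1 + \<epsilon> A\<close> at \<open>w\<close>\<close>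
  define P where "P = Re (inner_N w w')"
  define y where "y = quad_N w'"
  define s' where "s' = quad s w'"
  define \<sigma> where "\<sigma> = Re (s w' w)"
  have nn: "0 \<le> x" "0 \<le> y" "0 \<le> s'" unfolding x_def y_def s'_def using wL w' L2.nonneg nonneg by auto
  have P1: "P = \<epsilon> * s' + y" using R_identity[OF wL] by (simp add: P_def s'_def y_def w'_def)
  have P2: "x = \<epsilon> * \<sigma> + P"
  proof -
    have "of_real \<epsilon> * s w' w + inner_N w' w = inner_N w w" using R(2)[OF wL w(1)] by (simp add: w'_def)
    moreover have "Re (inner_N w' w) = P" using L2.herm[OF wL w'(2)] by (simp add: P_def)
    ultimately show ?thesis by (simp add: x_def quad_def \<sigma>_def complex_eq_iff)
  qed
  have CS1: "P\<^sup>2 \<le> x * y"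
  proof -
    have "P\<^sup>2 \<le> (cmod (inner_N w w'))\<^sup>2" unfolding P_def by (simp add: cmod_power2)
    also have "\<dots> \<le> x * y" unfolding x_def y_def by (intro L2.cauchy_schwarz wL w')
    finally show ?thesis .
  qed
  have CS2: "\<sigma>\<^sup>2 \<le> x * s'"
  proof -
    have "\<sigma>\<^sup>2 \<le> (cmod (s w' w))\<^sup>2" unfolding \<sigma>_def by (simp add: cmod_power2)
    also have "\<dots> \<le> s' * quad s w" unfolding s'_def by (intro cauchy_schwarz w w')
    also have "\<dots> \<le> s' * x" unfolding x_def using w nn by (intro mult_left_mono) auto
    finally show ?thesis by (simp add: mult.commute)
  qed
  have Py: "y \<le> P" using P1 nn \<epsilon> by simp
  have P0: "0 \<le> P" using Py nn by simp
  have "s' \<le> y \<and> x \<le> (1 + \<epsilon>)\<^sup>2 * y"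
  proof (cases "P = 0")
    case True
    then have "y = 0" "s' = 0" using P1 Py nn \<epsilon> by auto
    then have "\<sigma> = 0" using CS2 by simp
    then have "x = 0" using P2 True by simp
    then show ?thesis using \<open>s' = 0\<close> \<open>y = 0\<close> by simp
  next
    case False
    then have Ppos: "P > 0" using P0 by simp
    then have xpos: "x > 0" using CS1 nn by (cases "x = 0") auto
    have "(x - P)\<^sup>2 = \<epsilon>\<^sup>2 * \<sigma>\<^sup>2" using P2 by (simp add: power_mult_distrib[symmetric])
    also have "\<dots> \<le> \<epsilon>\<^sup>2 * (x * s')" using CS2 by (intro mult_left_mono) auto
    also have "\<dots> = \<epsilon> * (x * P - x * y)" using P1 by (simp add: power2_eq_square algebra_simps)
    also have "\<dots> \<le> \<epsilon> * (x * P - P\<^sup>2)" using CS1 \<epsilon> by (intro mult_left_mono) auto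
    finally have *: "(x - P) * (x - P) \<le> (\<epsilon> * P) * (x - P)" by (simp add: power2_eq_square algebra_simps)
    have "P * P \<le> x * P" using CS1 mult_left_mono[OF Py, of x] nn by (simp add: power2_eq_square)
    then have "P \<le> x" using Ppos by simp
    have "x - P \<le> \<epsilon> * P"
    proof (cases "x = P")
      case False
      then have "0 < x - P" using \<open>P \<le> x\<close> by simp
      with * show ?thesis by (simp only: mult_le_cancel_right_pos)
    qed (use \<epsilon> Ppos in simp)
    then have xP: "x \<le> (1 + \<epsilon>) * P" by (simp add: algebra_simps)
    have "P * x \<le> P * ((1 + \<epsilon>) * P)" using xP Ppos by (intro mult_left_mono) auto
    also have "\<dots> \<le> (1 + \<epsilon>) * (x * y)" using CS1 \<epsilon> by (simp add: power2_eq_square mult_left_mono mult.left_commute)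
    finally have "x * P \<le> x * ((1 + \<epsilon>) * y)" by (simp add: mult_ac)
    then have Pyb: "P \<le> (1 + \<epsilon>) * y" using xpos by simp
    have "\<epsilon> * s' \<le> \<epsilon> * y" using Pyb P1 by (simp add: algebra_simps)
    then have "s' \<le> y" using \<epsilon> by simp
    moreover have "x \<le> (1 + \<epsilon>) * ((1 + \<epsilon>) * y)"
      using xP mult_left_mono[OF Pyb, of "1 + \<epsilon>"] \<epsilon> by linarith
    ultimately show ?thesis by (simp add: power2_eq_square mult.assoc)
  qed
  then show "quad s (R \<epsilon> w) \<le> quad_N (R \<epsilon> w)" "quad_N w \<le> (1 + \<epsilon>)\<^sup>2 * quad_N (R \<epsilon> w)"
    by (simp_all add: x_def y_def s'_def w'_def)
qed

lemma rayleigh_lower_bound: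
  assumes "\<psi> \<in> D" "quad s \<psi> \<le> 1" "quad_N \<psi> = 1"
  shows "1 \<le> (1 + \<epsilon>) ^ (2 * k) * quad s (K ((R \<epsilon> ^^ k) \<psi>))"
proof -
  define w where "w k = (R \<epsilon> ^^ k) \<psi>" for k
  have w: "w k \<in> D \<and> quad s (w k) \<le> quad_N (w k) \<and> 1 \<le> (1 + \<epsilon>) ^ (2 * k) * quad_N (w k)" for k
  proof (induction k)
    case (Suc k)
    have Suc_w: "w (Suc k) = R \<epsilon> (w k)" by (simp add: w_def)
    have "1 \<le> (1 + \<epsilon>) ^ (2 * k) * quad_N (w k)" using Suc by blast
    also have "\<dots> \<le> (1 + \<epsilon>) ^ (2 * k) * ((1 + \<epsilon>)\<^sup>2 * quad_N (w (Suc k)))"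
      unfolding Suc_w using Suc rayleigh_step(2)[of "w k"] \<epsilon> by (intro mult_left_mono) auto
    finally have "1 \<le> (1 + \<epsilon>) ^ (2 * Suc k) * quad_N (w (Suc k))"
      by (simp add: power2_eq_square mult_ac)
    then show ?case using Suc rayleigh_step(1)[of "w k"] R(1)[OF weight_bound(1), of "w k"] by (simp add: Suc_w)
  qed (use assms in \<open>simp add: w_def\<close>)
  define W where "W = w k"
  have W: "W \<in> D" "quad s W \<le> quad_N W" "1 \<le> (1 + \<epsilon>) ^ (2 * k) * quad_N W" using w W_def by auto
  have WL: "W \<in> L2 N" using W weight_bound by auto
  have pos: "quad_N W > 0"
    using W(3) \<epsilon> L2.nonneg[OF WL] by (cases "quad_N W = 0") auto
  have "s (K W) W = inner_N W W" using K(2)[OF WL W(1)] .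
  then have "(quad_N W)\<^sup>2 \<le> (cmod (s (K W) W))\<^sup>2" by (simp add: quad_def cmod_power2)
  also have "\<dots> \<le> quad s (K W) * quad s W" by (intro cauchy_schwarz K WL W)
  also have "\<dots> \<le> quad s (K W) * quad_N W" using W nonneg K(1)[OF WL] by (intro mult_left_mono) auto
  finally have "quad_N W \<le> quad s (K W)" using pos by (simp add: power2_eq_square)
  then have "(1 + \<epsilon>) ^ (2 * k) * quad_N W \<le> (1 + \<epsilon>) ^ (2 * k) * quad s (K W)"
    using \<epsilon> by (intro mult_left_mono) auto
  then show ?thesis using W(3) by (simp add: W_def w_def)
qed

end

subsection \<open>The dual Sobolev inequality\<close>

text \<open>The function of \<open>L\<^sup>2(V)\<close>-norm \<open>(\<integral>V\<^sup>p)\<^bsup>1/2\<^esup>\<close> against which non-negative functions are tested.\<close>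

definition W :: "'a \<Rightarrow> complex" where "W x = complex_of_real (V x powr ((p - 1) / 2))"

lemma W_meas [measurable]: "W \<in> borel_measurable M"
  unfolding W_def by measurable

lemma W_squared: "(cmod (W x))\<^sup>2 = V x powr (p - 1)"
  by (simp add: W_def power2_eq_square flip: powr_add)

lemma V_W_squared: "AE x in M. V x * (cmod (W x))\<^sup>2 = V x powr p"
  using V_nonneg
proof eventually_elim
  case (elim x)
  show ?case unfolding W_squared using elim by (cases "V x = 0") (auto simp: powr_mult_base)
qed

lemma W_L2: "W \<in> L2 N" and quad_W: "quad_N W = Vp"
proof -
  have "integrable M (\<lambda>x. V x * (cmod (W x))\<^sup>2)"
    using V_int by (subst integrable_cong_AE[OF _ _ V_W_squared]) auto
  then show "W \<in> L2 N" by (simp add: L2_def integrable_N_iff measurable_cong_sets[OF sets_N refl])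
  have "quad_N W = (\<integral>x. V x * (cmod (W x))\<^sup>2 \<partial>M)" by (simp add: quad_L2 integral_N)
  also have "\<dots> = Vp" unfolding Vp_def using V_W_squared by (intro integral_cong_AE) auto
  finally show "quad_N W = Vp" .
qed

text \<open>
  For non-negative \<open>w\<close>, Hoelder's inequality interpolates \<open>V w\<close> in the dual of \<open>L\<^sup>q\<close> between the
  norm of \<open>w\<close> in \<open>L\<^sup>2(V)\<close> and its pairing with \<open>W\<close>.
\<close>

lemma dual_sobolev:
  assumes w: "w \<in> L2 N" "ae_nonneg N w"
  shows "quad s (K w) \<le> (1 / S) * (quad_N w powr ((p - 1) / p) * ((cmod (inner_N w W))\<^sup>2) powr (1 / p))"
proof -
  let ?q = "2 * p / (p - 1)"
  define g where "g = K w"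
  have gD: "g \<in> D" unfolding g_def using w by (intro K)
  have gL: "g \<in> L2 N" using gD weight_bound by auto
  have [measurable]: "g \<in> borel_measurable M" using gD by (rule D_meas)
  have [measurable]: "w \<in> borel_measurable M" using w(1) by (rule L2_N_meas)
  have wW: "integrable N (\<lambda>x. w x * cnj (W x))" using w W_L2 by (intro L2_inner_integrable)
  \<comment> \<open>\<open>V \<bar>w g\<bar>\<close> is the geometric mean of \<open>\<bar>g\<bar>\<^sup>q\<close>, \<open>V \<bar>w\<bar>\<^sup>2\<close> and \<open>V \<bar>w W\<bar>\<close> with weights \<open>1/q\<close>, \<open>1/q\<close> and \<open>1/p\<close>\<close>
  have e: "1 / ?q + 1 / ?q + 1 / p = 1" using p by (simp add: field_simps)
  define f1 where "f1 x = cmod (g x) powr ?q" for x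
  define f2 where "f2 x = V x * (cmod (w x))\<^sup>2" for x
  define f3 where "f3 x = V x * cmod (w x * cnj (W x))" for x
  have i1: "integrable M f1" unfolding f1_def by (rule sob_int[OF gD])
  have i2: "integrable M f2"
    using L2_integrable[OF w(1)] unfolding f2_def by (simp add: integrable_N_iff)
  have i3: "integrable M f3"
    using integrable_norm[OF wW] unfolding f3_def by (simp add: integrable_N_iff)
  have n1: "AE x in M. 0 \<le> f1 x" by (simp add: f1_def)
  have n2: "AE x in M. 0 \<le> f2 x" using V_nonneg by eventually_elim (simp add: f2_def)
  have n3: "AE x in M. 0 \<le> f3 x" using V_nonneg by eventually_elim (simp add: f3_def)
  note h = holder3[OF i1 i2 i3 n1 n2 n3, of "1/?q" "1/?q" "1/p"]
  have eq: "AE x in M. f1 x powr (1/?q) * f2 x powr (1/?q) * f3 x powr (1/p) = V x * cmod (w x * cnj (g x))"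
    using V_nonneg
  proof eventually_elim
    case (elim x)
    have q: "1 / ?q = (p - 1) / (2 * p)" using p by simp
    show ?case
    proof (cases "V x = 0 \<or> w x = 0")
      case True
      then show ?thesis by (auto simp: f2_def f3_def)
    next
      case False
      then have pos: "V x > 0" "cmod (w x) > 0" using elim by auto
      have "f1 x powr (1/?q) = cmod (g x)" using p by (simp add: f1_def powr_powr)
      moreover have "f2 x powr (1/?q) = V x powr ((p - 1) / (2 * p)) * cmod (w x) powr ((p - 1) / p)"
      proof -
        have "(cmod (w x))\<^sup>2 = cmod (w x) powr 2" using pos by simp
        moreover have "2 * ((p - 1) / (2 * p)) = (p - 1) / p" using p by (simp add: field_simps)
        ultimately show ?thesis unfolding q f2_def using pos by (simp only: powr_mult powr_powr)
      qed
      moreover have "f3 x powr (1/p) = V x powr ((p + 1) / (2 * p)) * cmod (w x) powr (1 / p)"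
      proof -
        have "f3 x = V x powr ((p + 1) / 2) * cmod (w x)"
        proof -
          have "V x * V x powr ((p - 1) / 2) = V x powr (1 + (p - 1) / 2)"
            using pos by (simp add: powr_mult_base)
          also have "1 + (p - 1) / 2 = (p + 1) / 2" by (simp add: field_simps)
          finally show ?thesis by (simp add: f3_def W_def norm_mult)
        qed
        then show ?thesis using pos by (simp add: powr_mult powr_powr)
      qed
      ultimately have "f1 x powr (1/?q) * f2 x powr (1/?q) * f3 x powr (1/p)
        = cmod (g x) * (V x powr ((p - 1) / (2 * p)) * V x powr ((p + 1) / (2 * p)))
            * (cmod (w x) powr ((p - 1) / p) * cmod (w x) powr (1 / p))" by (simp add: mult_ac)
      also have "V x powr ((p - 1) / (2 * p)) * V x powr ((p + 1) / (2 * p)) = V x"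
      proof -
        have "(p - 1) / (2 * p) + (p + 1) / (2 * p) = 1" using p by (simp add: field_simps)
        then show ?thesis using pos by (simp flip: powr_add)
      qed
      also have "cmod (w x) powr ((p - 1) / p) * cmod (w x) powr (1 / p) = cmod (w x)"
      proof -
        have "(p - 1) / p + 1 / p = 1" using p by (simp add: field_simps)
        then show ?thesis using pos by (simp flip: powr_add)
      qed
      finally show ?thesis by (simp add: norm_mult)
    qed
  qed
  have "\<integral>x. f2 x \<partial>M = quad_N w" by (simp add: f2_def quad_L2 integral_N)
  moreover have "\<integral>x. f3 x \<partial>M = cmod (inner_N w W)"
  proof -
    have "\<integral>x. f3 x \<partial>M = (\<integral>x. cmod (w x * cnj (W x)) \<partial>N)" by (simp add: f3_def integral_N)
    also have "complex_of_real \<dots> = inner_N w W"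
      unfolding L2_inner_def integral_complex_of_real[symmetric]
    proof (rule integral_cong_AE)
      show "AE x in N. complex_of_real (cmod (w x * cnj (W x))) = w x * cnj (W x)"
        using ae_nonneg_AE[OF w(2)] by eventually_elim (simp add: W_def norm_mult)
    qed (use w(1) W_L2 in \<open>auto dest!: L2_measurable\<close>)
    finally have "complex_of_real (\<integral>x. f3 x \<partial>M) = inner_N w W" .
    moreover have "0 \<le> (\<integral>x. f3 x \<partial>M)" using n3 by (rule integral_nonneg_AE)
    ultimately show ?thesis by (metis abs_of_nonneg norm_of_real)
  qed
  ultimately have H: "(\<integral>x. V x * cmod (w x * cnj (g x)) \<partial>M)
      \<le> (\<integral>x. f1 x \<partial>M) powr (1/?q) * (quad_N w powr (1/?q) * cmod (inner_N w W) powr (1/p))"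
    using h(2) p e integral_cong_AE[OF _ _ eq] i1 i2 i3 by (simp add: mult.assoc)
  define X where "X = quad s g"
  define B where "B = quad_N w powr (1/?q) * cmod (inner_N w W) powr (1/p)"
  have X0: "0 \<le> X" unfolding X_def by (rule nonneg[OF gD])
  have "X = Re (inner_N w g)" using K(2)[OF w(1) gD] by (simp add: X_def quad_def g_def)
  also have "\<dots> \<le> cmod (inner_N w g)" by (rule complex_Re_le_cmod)
  also have "\<dots> \<le> (\<integral>x. cmod (w x * cnj (g x)) \<partial>N)" unfolding L2_inner_def by (rule integral_norm_bound)
  also have "\<dots> = (\<integral>x. V x * cmod (w x * cnj (g x)) \<partial>M)" by (simp add: integral_N)
  also have "\<dots> \<le> (\<integral>x. f1 x \<partial>M) powr (1/?q) * B" using H by (simp add: B_def)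
  finally have XB: "X \<le> (\<integral>x. f1 x \<partial>M) powr (1/?q) * B" .
  have "X * X \<le> ((\<integral>x. f1 x \<partial>M) powr (1/?q) * B) * ((\<integral>x. f1 x \<partial>M) powr (1/?q) * B)"
    using XB X0 by (intro mult_mono) auto
  also have "\<dots> = (\<integral>x. f1 x \<partial>M) powr ((p - 1) / p) * B\<^sup>2"
  proof -
    have "1 / ?q + 1 / ?q = (p - 1) / p" using p by (simp add: field_simps)
    then have "(\<integral>x. f1 x \<partial>M) powr (1/?q) * (\<integral>x. f1 x \<partial>M) powr (1/?q) = (\<integral>x. f1 x \<partial>M) powr ((p - 1) / p)"
      by (simp only: powr_add[symmetric])
    then show ?thesis by (simp add: power2_eq_square mult_ac)
  qed
  also have "\<dots> \<le> (X / S) * B\<^sup>2"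
    using sob[OF gD] S by (intro mult_right_mono) (auto simp: X_def f1_def field_simps)
  finally have XX: "X * X \<le> X * (B\<^sup>2 / S)" by simp
  have "X \<le> B\<^sup>2 / S"
  proof (cases "X = 0")
    case False
    then have "0 < X" using X0 by simp
    with XX show ?thesis by (simp only: mult_le_cancel_left_pos)
  qed (use S in simp)
  also have "B\<^sup>2 = quad_N w powr ((p - 1) / p) * ((cmod (inner_N w W))\<^sup>2) powr (1 / p)"
  proof -
    have "1 / ?q + 1 / ?q = (p - 1) / p" using p by (simp add: field_simps)
    then have "quad_N w powr (1/?q) * quad_N w powr (1/?q) = quad_N w powr ((p - 1) / p)"
      by (simp only: powr_add[symmetric])
    then show ?thesis by (simp add: B_def power2_eq_square powr_mult mult_ac)
  qed
  finally show ?thesis by (simp add: X_def g_def)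
qed

lemma quad_K_le:
  assumes w: "w \<in> L2 N"
  shows "quad s (K w) \<le> Vp powr (1 / p) / S * quad_N w"
proof -
  define X where "X = quad s (K w)"
  define C where "C = Vp powr (1 / p) / S"
  have D: "K w \<in> D" by (rule K(1)[OF w])
  have X0: "0 \<le> X" unfolding X_def by (rule nonneg[OF D])
  have "X = Re (inner_N w (K w))" using K(2)[OF w D] by (simp add: X_def quad_def)
  also have "\<dots> \<le> cmod (inner_N w (K w))" by (rule complex_Re_le_cmod)
  finally have "X * X \<le> (cmod (inner_N w (K w)))\<^sup>2"
    using X0 by (simp add: power2_eq_square mult_mono)
  also have "\<dots> \<le> quad_N w * quad_N (K w)" using w D weight_bound(1) by (intro L2.cauchy_schwarz) auto
  also have "\<dots> \<le> quad_N w * (C * X)"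
    using weight_bound(2)[OF D] L2.nonneg[OF w] by (intro mult_left_mono) (auto simp: C_def X_def)
  finally have XX: "X * X \<le> X * (C * quad_N w)" by (simp add: mult_ac)
  have "X \<le> C * quad_N w"
  proof (cases "X = 0")
    case False
    then have "0 < X" using X0 by simp
    with XX show ?thesis by (simp only: mult_le_cancel_left_pos)
  qed (use S L2.nonneg[OF w] in \<open>simp add: C_def\<close>)
  then show ?thesis by (simp add: X_def C_def)
qed

subsection \<open>The bound on orthonormal families with small energy\<close>

text \<open>
  Summing the dual Sobolev inequality over an orthonormal family: the pairings with \<open>W\<close> are moved
  to \<open>R\<^sup>k W\<close> and summed by Bessel's inequality.
\<close>

lemma family_step:
  assumes \<epsilon>: "0 < \<epsilon>" and e: "psd_form.orthonormal (L2 N) inner_N e I" "\<And>i. i \<in> I \<Longrightarrow> ae_nonneg N (e i)"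
  shows "(\<Sum>i\<in>I. quad s (K ((R \<epsilon> ^^ k) (e i))))
     \<le> (1 / S) * ((\<Sum>i\<in>I. quad_N ((R \<epsilon> ^^ k) (e i))) powr ((p - 1) / p) * Vp powr (1 / p))"
proof -
  have fin: "finite I" and eL: "i \<in> I \<Longrightarrow> e i \<in> L2 N" for i using e(1) by (auto simp: L2.orthonormal_def)
  let ?w = "\<lambda>i. (R \<epsilon> ^^ k) (e i)"
  have w: "?w i \<in> L2 N" "ae_nonneg N (?w i)" if "i \<in> I" for i
    using eL[OF that] e(2)[OF that] Rk_L2[OF \<epsilon>] Rk_nonneg[OF \<epsilon>] by auto
  have "(\<Sum>i\<in>I. quad s (K (?w i)))
      \<le> (\<Sum>i\<in>I. (1 / S) * (quad_N (?w i) powr ((p - 1) / p) * ((cmod (inner_N (?w i) W))\<^sup>2) powr (1 / p)))"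
    using w by (intro sum_mono dual_sobolev) auto
  also have "\<dots> = (1 / S) * (\<Sum>i\<in>I. quad_N (?w i) powr ((p - 1) / p) * ((cmod (inner_N (?w i) W))\<^sup>2) powr (1 / p))"
    by (rule sum_distrib_left[symmetric])
  also have "\<dots> \<le> (1 / S) * ((\<Sum>i\<in>I. quad_N (?w i)) powr ((p - 1) / p) * (\<Sum>i\<in>I. (cmod (inner_N (?w i) W))\<^sup>2) powr (1 / p))"
    using S p w fin L2.nonneg by (intro mult_left_mono holder_sum) (auto simp: field_simps)
  also have "\<dots> \<le> (1 / S) * ((\<Sum>i\<in>I. quad_N (?w i)) powr ((p - 1) / p) * Vp powr (1 / p))"
  proof -
    have "(\<Sum>i\<in>I. (cmod (inner_N (?w i) W))\<^sup>2) = (\<Sum>i\<in>I. (cmod (inner_N ((R \<epsilon> ^^ k) W) (e i)))\<^sup>2)"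
    proof (intro sum.cong refl)
      fix i assume i: "i \<in> I"
      have "inner_N (?w i) W = inner_N (e i) ((R \<epsilon> ^^ k) W)" by (rule Rk_symmetric[OF \<epsilon> eL[OF i] W_L2])
      also have "\<dots> = cnj (inner_N ((R \<epsilon> ^^ k) W) (e i))" by (rule L2.herm[OF Rk_L2[OF \<epsilon> W_L2] eL[OF i]])
      finally show "(cmod (inner_N (?w i) W))\<^sup>2 = (cmod (inner_N ((R \<epsilon> ^^ k) W) (e i)))\<^sup>2" by simp
    qed
    also have "\<dots> \<le> quad_N ((R \<epsilon> ^^ k) W)" by (rule L2.bessel[OF e(1) Rk_L2[OF \<epsilon> W_L2]])
    also have "\<dots> \<le> Vp" using Rk_contraction[OF \<epsilon> W_L2] by (simp add: quad_W)
    finally have "(\<Sum>i\<in>I. (cmod (inner_N (?w i) W))\<^sup>2) powr (1 / p) \<le> Vp powr (1 / p)"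
      using p by (intro powr_mono2) (auto intro: sum_nonneg)
    then show ?thesis using S by (intro mult_left_mono) auto
  qed
  finally show ?thesis .
qed

text \<open>
  The value of \<open>\<epsilon>\<close> makes \<open>2 n \<epsilon> = p - 1\<close>. The last factor tends to one as \<open>n \<rightarrow> \<infinity>\<close> for a fixed
  family.
\<close>

lemma family_decay:
  assumes Vp: "0 < Vp" and e: "psd_form.orthonormal (L2 N) inner_N e I" "\<And>i. i \<in> I \<Longrightarrow> ae_nonneg N (e i)"
    and n: "0 < n" and \<epsilon>: "\<epsilon> = (p - 1) / (2 * real n)"
    and H0: "H0 = (\<Sum>i\<in>I. quad s (K (e i)))"
  shows "(\<Sum>i\<in>I. quad s (K ((R \<epsilon> ^^ n) (e i))))
    \<le> S powr (- p) * Vp *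
       (1 + 2 * \<epsilon> * (S * Vp powr (- 1 / p)) powr (p / (p - 1)) * H0 powr (1 / (p - 1))) powr p"
proof -
  define a where "a = S * Vp powr (- 1 / p)"
  define b where "b = 1 / (p - 1)"
  define c where "c = 2 * \<epsilon> * a powr (p / (p - 1))"
  have \<epsilon>pos: "0 < \<epsilon>" using p n by (simp add: \<epsilon>)
  have a: "0 < a" using S Vp by (simp add: a_def)
  have b: "0 < b" "1 + b = p / (p - 1)" "(1 + b) / b = p" "- 1 / b = - (p - 1)" using p by (simp_all add: b_def field_simps)
  have c: "0 < c" using \<epsilon>pos a by (simp add: c_def)
  have eL: "i \<in> I \<Longrightarrow> e i \<in> L2 N" for i using e(1) by (auto simp: L2.orthonormal_def)
  define h where "h k = (\<Sum>i\<in>I. quad s (K ((R \<epsilon> ^^ k) (e i))))" for k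
  define g where "g k = (\<Sum>i\<in>I. quad_N ((R \<epsilon> ^^ k) (e i)))" for k
  have g0: "0 \<le> g k" for k unfolding g_def using eL Rk_L2[OF \<epsilon>pos] by (intro sum_nonneg L2.nonneg) auto
  have h0: "0 \<le> h k" for k unfolding h_def using eL Rk_L2[OF \<epsilon>pos] by (intro sum_nonneg nonneg K) auto
  have hg: "a powr (p / (p - 1)) * h k powr (1 + b) \<le> g k" for k
  proof -
    have "h k \<le> (1 / S) * (g k powr ((p - 1) / p) * Vp powr (1 / p))"
      unfolding h_def g_def by (rule family_step[OF \<epsilon>pos e])
    then have "a * h k \<le> a * ((1 / S) * (g k powr ((p - 1) / p) * Vp powr (1 / p)))"
      using a by (intro mult_left_mono) auto
    also have "\<dots> = g k powr ((p - 1) / p)"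
      using S Vp by (simp add: a_def powr_minus field_simps)
    finally have "(a * h k) powr (p / (p - 1)) \<le> (g k powr ((p - 1) / p)) powr (p / (p - 1))"
      using p a h0[of k] by (intro powr_mono2) auto
    also have "\<dots> = g k" using p g0[of k] by (simp add: powr_powr)
    finally show ?thesis using a h0[of k] by (simp add: powr_mult b(2))
  qed
  have "h n \<le> (b * c * real n) powr (- 1 / b) * (1 + c * H0 powr b) powr ((1 + b) / b)"
  proof (rule decay_bound[OF b(1) c n h0])
    show "h 0 \<le> H0" by (simp add: h_def H0)
    fix k
    have "h (Suc k) + 2 * \<epsilon> * g (Suc k) \<le> h k"
      unfolding h_def g_def sum_distrib_left sum.distrib[symmetric]
      using decrement[OF \<epsilon>pos Rk_L2[OF \<epsilon>pos eL]] by (intro sum_mono) simp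
    moreover have "c * h (Suc k) powr (1 + b) \<le> 2 * \<epsilon> * g (Suc k)"
      using mult_left_mono[OF hg[of "Suc k"], of "2 * \<epsilon>"] \<epsilon>pos by (simp add: c_def mult.assoc)
    ultimately show "h (Suc k) + c * h (Suc k) powr (1 + b) \<le> h k" by linarith
  qed
  moreover have "b * c * real n = a powr (p / (p - 1))" using n p by (simp add: b_def c_def \<epsilon> field_simps)
  moreover have "(a powr (p / (p - 1))) powr (- (p - 1)) = S powr (- p) * Vp"
  proof -
    have "(a powr (p / (p - 1))) powr (- (p - 1)) = a powr (- p)"
    proof -
      have "p / (p - 1) * - (p - 1) = - p" using p by (simp add: field_simps)
      then show ?thesis by (simp only: powr_powr)
    qed
    also have "\<dots> = S powr (- p) * Vp" using S Vp p by (simp add: a_def powr_mult powr_powr)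
    finally show ?thesis .
  qed
  ultimately show ?thesis unfolding b(3,4) by (simp add: h_def c_def a_def b_def)
qed

text \<open>The operator \<open>K R\<^sup>n\<close> is linear up to null functions of \<open>s\<close>.\<close>

lemma KRk_weak:
  assumes "0 < \<epsilon>" "f \<in> L2 N" "v \<in> D"
  shows "s (K ((R \<epsilon> ^^ n) f)) v = inner_N f ((R \<epsilon> ^^ n) v)"
  using K(2)[OF Rk_L2[OF assms(1,2)] assms(3)] Rk_symmetric[OF assms(1,2) weight_bound(1)[OF assms(3)]] by simp

lemma KRk_split:
  assumes \<epsilon>: "0 < \<epsilon>" and \<eta>: "0 < \<eta>" and f: "f \<in> L2 N" and e: "\<And>i. i \<in> I \<Longrightarrow> e i \<in> L2 N"
  shows "quad s (K ((R \<epsilon> ^^ n) f)) \<le> (1 + \<eta>) * quad s (\<lambda>x. \<Sum>i\<in>I. m i * K ((R \<epsilon> ^^ n) (e i)) x)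
     + (1 + 1 / \<eta>) * (Vp powr (1 / p) / S * quad_N (\<lambda>x. f x - (\<Sum>i\<in>I. m i * e i x)))"
proof -
  let ?C = "\<lambda>f. K ((R \<epsilon> ^^ n) f)"
  define r where "r = (\<lambda>x. f x - (\<Sum>i\<in>I. m i * e i x))"
  define z where "z = (\<lambda>x. \<Sum>i\<in>I. m i * ?C (e i) x)"
  have rL: "r \<in> L2 N" unfolding r_def using f e by (intro L2.diff_in L2.sum_in)
  have CD: "?C g \<in> D" if "g \<in> L2 N" for g using that K(1) Rk_L2[OF \<epsilon>] by blast
  have zD: "z \<in> D" unfolding z_def using e CD by (intro sum_in) auto
  have "quad s (?C f) = quad s (\<lambda>x. z x + ?C r x)"
  proof (rule quad_cong_weak)
    fix v assume v: "v \<in> D"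
    have vL: "(R \<epsilon> ^^ n) v \<in> L2 N" using v weight_bound(1) Rk_L2[OF \<epsilon>] by blast
    have "s (\<lambda>x. z x + ?C r x) v = s z v + s (?C r) v" using zD CD[OF rL] v by (rule add_left)
    also have "s z v = (\<Sum>i\<in>I. m i * s (?C (e i)) v)"
      unfolding z_def using e CD v by (intro sum_left) auto
    also have "\<dots> = (\<Sum>i\<in>I. m i * inner_N (e i) ((R \<epsilon> ^^ n) v))"
      using e v by (simp add: KRk_weak[OF \<epsilon>])
    also have "\<dots> = inner_N (\<lambda>x. \<Sum>i\<in>I. m i * e i x) ((R \<epsilon> ^^ n) v)"
      using e vL by (intro L2.sum_left[symmetric]) auto
    also have "s (?C r) v = inner_N f ((R \<epsilon> ^^ n) v) - inner_N (\<lambda>x. \<Sum>i\<in>I. m i * e i x) ((R \<epsilon> ^^ n) v)"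
      unfolding KRk_weak[OF \<epsilon> rL v] unfolding r_def using f e vL by (intro L2.diff_left L2.sum_in) auto
    finally show "s (?C f) v = s (\<lambda>x. z x + ?C r x) v" using KRk_weak[OF \<epsilon> f v] by simp
  qed (use f rL zD CD add_in in auto)
  also have "\<dots> \<le> (1 + \<eta>) * quad s z + (1 + 1 / \<eta>) * quad s (?C r)"
    using zD CD[OF rL] \<eta> by (rule quad_add_le)
  also have "\<dots> \<le> (1 + \<eta>) * quad s z + (1 + 1 / \<eta>) * (Vp powr (1 / p) / S * quad_N r)"
  proof (intro add_left_mono mult_left_mono)
    have "quad s (?C r) \<le> Vp powr (1 / p) / S * quad_N ((R \<epsilon> ^^ n) r)"
      by (rule quad_K_le[OF Rk_L2[OF \<epsilon> rL]])
    also have "\<dots> \<le> Vp powr (1 / p) / S * quad_N r"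
      using Rk_contraction[OF \<epsilon> rL] S by (intro mult_left_mono) auto
    finally show "quad s (?C r) \<le> Vp powr (1 / p) / S * quad_N r" .
  qed (use \<eta> in simp)
  finally show ?thesis by (simp only: z_def r_def)
qed

text \<open>
  In the proof \<open>n \<rightarrow> \<infinity>\<close> for a fixed family approximating the \<open>\<psi> j\<close>, and then the error \<open>\<eta>\<close> of the
  approximation tends to zero.
\<close>

theorem orthonormal_card_bound:
  assumes \<psi>: "psd_form.orthonormal (L2 N) inner_N \<psi> J" "\<And>j. j \<in> J \<Longrightarrow> \<psi> j \<in> D" "\<And>j. j \<in> J \<Longrightarrow> quad s (\<psi> j) \<le> 1"
  shows "real (card J) \<le> exp (p - 1) * (S powr (- p) * Vp)"
proof (cases "J = {}")
  case True
  then show ?thesis using Vp_nonneg by simp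
next
  case False
  have finJ: "finite J" and \<psi>L: "j \<in> J \<Longrightarrow> \<psi> j \<in> L2 N" for j using \<psi>(1) by (auto simp: L2.orthonormal_def)
  have \<psi>1: "quad_N (\<psi> j) = 1" if "j \<in> J" for j using \<psi>(1) that by (simp add: L2.orthonormal_def quad_def)
  have Vp: "0 < Vp"
  proof -
    obtain j where j: "j \<in> J" using False by blast
    have "Vp \<noteq> 0"
    proof
      assume "Vp = 0"
      then show False using weight_bound(2)[OF \<psi>(2)[OF j]] \<psi>1[OF j] by simp
    qed
    then show ?thesis using Vp_nonneg by simp
  qed
  define C where "C = Vp powr (1 / p) / S"
  define B where "B = S powr (- p) * Vp"
  have C: "0 < C" using Vp S by (simp add: C_def)
  have main: "real (card J) * exp (- (p - 1)) \<le> (1 + \<eta>) * B + \<eta> * real (card J)" if \<eta>: "0 < \<eta>" for \<eta>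
  proof -
    \<comment> \<open>the accuracy for which the error term of \<open>KRk_split\<close> is at most \<open>\<eta>\<close>\<close>
    define \<delta> where "\<delta> = \<eta> / ((1 + 1 / \<eta>) * C)"
    have \<delta>: "0 < \<delta>" using \<eta> C by (simp add: \<delta>_def add_pos_pos)
    have \<delta>C: "(1 + 1 / \<eta>) * (C * \<delta>) = \<eta>"
    proof -
      have "(1 + 1 / \<eta>) * C \<noteq> 0" using \<eta> C by (simp add: add_pos_pos less_imp_neq[symmetric])
      then show ?thesis by (simp add: \<delta>_def)
    qed
    obtain I :: "('b \<Rightarrow> complex) set" and \<rho> where
      e_on: "psd_form.orthonormal (L2 N) inner_N (\<lambda>i x. complex_of_real (\<rho> i x)) I" and
      \<rho>: "\<And>i x. 0 \<le> \<rho> i x" and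
      close: "\<And>j. j \<in> J \<Longrightarrow> quad_N (\<lambda>x. \<psi> j x - (\<Sum>i\<in>I. inner_N (\<psi> j) (\<lambda>x. complex_of_real (\<rho> i x)) * of_real (\<rho> i x))) < \<delta>"
      using nonneg_orthonormal_approx[OF finJ \<psi>L \<delta>, of "\<lambda>j. j"] by blast
    define e where "e = (\<lambda>i x. complex_of_real (\<rho> i x))"
    have e: "psd_form.orthonormal (L2 N) inner_N e I" "\<And>i. ae_nonneg N (e i)"
      using e_on \<rho> by (auto simp: e_def ae_nonneg_def)
    have finI: "finite I" and eL: "i \<in> I \<Longrightarrow> e i \<in> L2 N" for i using e(1) by (auto simp: L2.orthonormal_def)
    define m where "m j i = inner_N (\<psi> j) (e i)" for j i
    have m_contr: "(\<Sum>j\<in>J. (cmod (\<Sum>i\<in>I. m j i * x i))\<^sup>2) \<le> (\<Sum>i\<in>I. (cmod (x i))\<^sup>2)" for x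
    proof -
      define \<xi> where "\<xi> = (\<lambda>z. \<Sum>i\<in>I. cnj (x i) * e i z)"
      have \<xi>L: "\<xi> \<in> L2 N" unfolding \<xi>_def using eL by (intro L2.sum_in)
      have "cmod (\<Sum>i\<in>I. m j i * x i) = cmod (inner_N \<xi> (\<psi> j))" if j: "j \<in> J" for j
      proof -
        have "inner_N (\<psi> j) \<xi> = (\<Sum>i\<in>I. cnj (cnj (x i)) * inner_N (\<psi> j) (e i))"
          unfolding \<xi>_def using eL \<psi>L[OF j] by (intro L2.sum_right) auto
        then have "(\<Sum>i\<in>I. m j i * x i) = inner_N (\<psi> j) \<xi>" by (simp add: m_def mult.commute)
        then show ?thesis by (simp only: L2.herm[OF \<psi>L[OF j] \<xi>L] complex_mod_cnj)
      qed
      then have "(\<Sum>j\<in>J. (cmod (\<Sum>i\<in>I. m j i * x i))\<^sup>2) = (\<Sum>j\<in>J. (cmod (inner_N \<xi> (\<psi> j)))\<^sup>2)" by simp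
      also have "\<dots> \<le> quad_N \<xi>" by (rule L2.bessel[OF \<psi>(1) \<xi>L])
      also have "\<dots> = (\<Sum>i\<in>I. (cmod (x i))\<^sup>2)" unfolding \<xi>_def by (subst L2.orthonormal_quad_sum[OF e(1)]) simp
      finally show ?thesis .
    qed
    define H0 where "H0 = (\<Sum>i\<in>I. quad s (K (e i)))"
    define E where "E n = (p - 1) / (2 * real n)" for n :: nat
    define A where "A = (S * Vp powr (- 1 / p)) powr (p / (p - 1)) * H0 powr (1 / (p - 1))"
    have bound: "real (card J) \<le> (1 + E n) ^ (2 * n) * ((1 + \<eta>) * (B * (1 + 2 * E n * A) powr p) + \<eta> * real (card J))"
      if n: "0 < n" for n
    proof -
      have En: "0 < E n" using p n by (simp add: E_def)
      let ?C = "\<lambda>f. K ((R (E n) ^^ n) f)"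
      have CD: "?C f \<in> D" if "f \<in> L2 N" for f using that K(1) Rk_L2[OF En] by blast
      have "real (card J) = (\<Sum>j\<in>J. 1)" by simp
      also have "\<dots> \<le> (\<Sum>j\<in>J. (1 + E n) ^ (2 * n) * quad s (?C (\<psi> j)))"
        using \<psi> \<psi>1 by (intro sum_mono rayleigh_lower_bound En) auto
      also have "\<dots> = (1 + E n) ^ (2 * n) * (\<Sum>j\<in>J. quad s (?C (\<psi> j)))"
        by (rule sum_distrib_left[symmetric])
      also have "\<dots> \<le> (1 + E n) ^ (2 * n) * ((1 + \<eta>) * (B * (1 + 2 * E n * A) powr p) + \<eta> * real (card J))"
      proof (intro mult_left_mono)
        have "(\<Sum>j\<in>J. quad s (?C (\<psi> j))) \<le> (\<Sum>j\<in>J. (1 + \<eta>) * quad s (\<lambda>x. \<Sum>i\<in>I. m j i * ?C (e i) x) + \<eta>)"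
        proof (intro sum_mono)
          fix j assume j: "j \<in> J"
          have "quad s (?C (\<psi> j)) \<le> (1 + \<eta>) * quad s (\<lambda>x. \<Sum>i\<in>I. m j i * ?C (e i) x)
             + (1 + 1 / \<eta>) * (C * quad_N (\<lambda>x. \<psi> j x - (\<Sum>i\<in>I. m j i * e i x)))"
            unfolding C_def using En \<eta> \<psi>L[OF j] eL by (intro KRk_split)
          also have "\<dots> \<le> (1 + \<eta>) * quad s (\<lambda>x. \<Sum>i\<in>I. m j i * ?C (e i) x) + (1 + 1 / \<eta>) * (C * \<delta>)"
            using close[OF j] \<eta> C by (intro add_left_mono mult_left_mono) (auto simp: m_def e_def)
          finally show "quad s (?C (\<psi> j)) \<le> (1 + \<eta>) * quad s (\<lambda>x. \<Sum>i\<in>I. m j i * ?C (e i) x) + \<eta>"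
            unfolding \<delta>C .
        qed
        also have "\<dots> = (1 + \<eta>) * (\<Sum>j\<in>J. quad s (\<lambda>x. \<Sum>i\<in>I. m j i * ?C (e i) x)) + \<eta> * real (card J)"
          by (simp add: sum.distrib sum_distrib_left)
        also have "(\<Sum>j\<in>J. quad s (\<lambda>x. \<Sum>i\<in>I. m j i * ?C (e i) x)) \<le> (\<Sum>i\<in>I. quad s (?C (e i)))"
          using eL CD by (intro trace_contraction[OF finI _ m_contr]) auto
        also have "\<dots> \<le> B * (1 + 2 * E n * A) powr p"
          using family_decay[OF Vp e n, of "E n" H0] by (simp add: B_def A_def E_def H0_def mult.assoc)
        finally show "(\<Sum>j\<in>J. quad s (?C (\<psi> j))) \<le> (1 + \<eta>) * (B * (1 + 2 * E n * A) powr p) + \<eta> * real (card J)"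
          using \<eta> by simp
      qed (use En in auto)
      finally show ?thesis .
    qed
    have E0: "E \<longlonglongrightarrow> 0" 
    proof -
      have "(\<lambda>n. (p - 1) / 2 / real n) \<longlonglongrightarrow> 0" by (rule lim_const_over_n)
      then show ?thesis by (simp add: E_def[abs_def])
    qed
    have lim1: "(\<lambda>n. (1 + E n) ^ (2 * n)) \<longlonglongrightarrow> exp (p - 1)"
    proof -
      have "(\<lambda>n. (1 + (p - 1) / real n) ^ n) \<longlonglongrightarrow> exp (p - 1)"
        by (rule tendsto_exp_limit_sequentially)
      then have "(\<lambda>n. (1 + (p - 1) / real (2 * n)) ^ (2 * n)) \<longlonglongrightarrow> exp (p - 1)"
        by (rule LIMSEQ_subseq_LIMSEQ[where f = "\<lambda>n. 2 * n", unfolded o_def]) (simp add: strict_mono_def)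
      then show ?thesis by (simp add: E_def)
    qed
    have "(\<lambda>n. (1 + E n) ^ (2 * n) * ((1 + \<eta>) * (B * (1 + 2 * E n * A) powr p) + \<eta> * real (card J)))
        \<longlonglongrightarrow> exp (p - 1) * ((1 + \<eta>) * (B * (1 + 2 * 0 * A) powr p) + \<eta> * real (card J))"
      by (intro tendsto_intros lim1 E0) auto
    then have "real (card J) \<le> exp (p - 1) * ((1 + \<eta>) * (B * (1 + 2 * 0 * A) powr p) + \<eta> * real (card J))"
      by (rule LIMSEQ_le_const) (use bound in \<open>auto intro!: exI[of _ 1]\<close>)
    then have "real (card J) * exp (- (p - 1))
        \<le> exp (p - 1) * ((1 + \<eta>) * (B * (1 + 2 * 0 * A) powr p) + \<eta> * real (card J)) * exp (- (p - 1))"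
      by (rule mult_right_mono) simp
    also have "\<dots> = (1 + \<eta>) * B + \<eta> * real (card J)" by (simp flip: exp_add)
    finally show ?thesis .
  qed
  have "((\<lambda>\<eta>. (1 + \<eta>) * B + \<eta> * real (card J)) \<longlongrightarrow> (1 + 0) * B + 0 * real (card J)) (at_right 0)"
    by (intro tendsto_intros)
  then have "real (card J) * exp (- (p - 1)) \<le> (1 + 0) * B + 0 * real (card J)"
    by (rule tendsto_lowerbound[OF _ eventually_mono[OF eventually_at_right_less main]]) auto
  then have "exp (p - 1) * (real (card J) * exp (- (p - 1))) \<le> exp (p - 1) * B"
    by (intro mult_left_mono) auto
  moreover have "exp (p - 1) * (real (card J) * exp (- (p - 1))) = real (card J)" by (simp flip: exp_add)
  ultimately show ?thesis by (simp only: B_def)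
qed

end

section \<open>Counting eigenvalues of semibounded forms\<close>

text \<open>
  A square matrix with independent rows has a left inverse. Orthonormalizing the rows gives \<open>n\<close>
  orthonormal vectors of \<open>\<complex>\<^sup>n\<close>; the squared distances of the unit vectors to their span add up to
  \<open>n - n = 0\<close>.
\<close>

lemma independent_rows_invertible:
  fixes A :: "nat \<Rightarrow> nat \<Rightarrow> complex"
  assumes indep: "\<And>c. (\<And>j. j < n \<Longrightarrow> (\<Sum>i<n. c i * A i j) = 0) \<Longrightarrow> (\<forall>i<n. c i = 0)"
  shows "\<exists>P. \<forall>k<n. \<forall>j<n. (\<Sum>m<n. P k m * A m j) = (if k = j then 1 else 0)"
proof -
  define s where "s u v = (\<Sum>j<n. u j * cnj (v j))" for u v :: "nat \<Rightarrow> complex"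
  have quad_s: "quad s u = (\<Sum>j<n. (cmod (u j))\<^sup>2)" for u
    unfolding quad_def s_def by (simp add: complex_norm_square[symmetric] del: of_real_power)
  interpret C: psd_form UNIV s
  proof
    show "s (\<lambda>x. a * u x + b * v x) w = a * s u w + b * s v w" for u v w a b
      by (simp add: s_def sum.distrib sum_distrib_left algebra_simps)
    show "s v u = cnj (s u v)" for u v by (simp add: s_def mult.commute)
  qed (auto simp: fun_subspace_def quad_s sum_nonneg)
  have "\<exists>a. C.orthonormal (\<lambda>i x. \<Sum>k\<in>{..<n}. a i k * A k x) {..<n}"
  proof (rule C.gram_schmidt)
    fix c assume "\<exists>i\<in>{..<n}. c i \<noteq> (0::complex)"
    then obtain j where "j < n" "(\<Sum>i<n. c i * A i j) \<noteq> 0" using indep[of c] by auto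
    then show "0 < quad s (\<lambda>x. \<Sum>i\<in>{..<n}. c i * A i x)"
      unfolding quad_s by (intro sum_pos2[of _ j]) auto
  qed auto
  then obtain a where a: "C.orthonormal (\<lambda>i x. \<Sum>k<n. a i k * A k x) {..<n}" by blast
  define e where "e = (\<lambda>i x. \<Sum>k<n. a i k * A k x)"
  have e: "C.orthonormal e {..<n}" using a by (simp add: e_def)
  have e1: "quad s (e i) = 1" if "i < n" for i using e that by (simp add: C.orthonormal_def quad_def)
  define d where "d k = (\<lambda>j. if j = k then 1 else 0 :: complex)" for k :: nat
  have d_inner: "s (d k) v = cnj (v k)" if "k < n" for k v
  proof -
    have "s (d k) v = (\<Sum>j<n. if j = k then cnj (v k) else 0)" unfolding s_def d_def by (intro sum.cong) auto
    then show ?thesis using that by simp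
  qed
  have dist: "quad s (\<lambda>x. d k x - (\<Sum>i<n. s (d k) (e i) * e i x)) = 1 - (\<Sum>i<n. (cmod (e i k))\<^sup>2)" if "k < n" for k
    using C.quad_diff_orthonormal[OF e, of "d k" "\<lambda>i. s (d k) (e i)"] d_inner[OF that]
    by (simp add: quad_def[of s "d k"]) (simp add: d_def)
  have "(\<Sum>k<n. quad s (\<lambda>x. d k x - (\<Sum>i<n. s (d k) (e i) * e i x))) = real n - (\<Sum>k<n. \<Sum>i<n. (cmod (e i k))\<^sup>2)"
    by (simp add: dist sum_subtractf)
  also have "(\<Sum>k<n. \<Sum>i<n. (cmod (e i k))\<^sup>2) = (\<Sum>i<n. quad s (e i))"
    unfolding quad_s by (rule sum.swap)
  also have "\<dots> = real n" by (simp add: e1)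
  finally have "(\<Sum>k<n. quad s (\<lambda>x. d k x - (\<Sum>i<n. s (d k) (e i) * e i x))) = 0" by simp
  then have zero: "quad s (\<lambda>x. d k x - (\<Sum>i<n. s (d k) (e i) * e i x)) = 0" if "k < n" for k
    using that sum_nonneg_eq_0_iff[of "{..<n}" "\<lambda>k. quad s (\<lambda>x. d k x - (\<Sum>i<n. s (d k) (e i) * e i x))"] C.nonneg
    by simp
  have d_eq: "d k j = (\<Sum>i<n. cnj (e i k) * e i j)" if "k < n" "j < n" for k j
    using zero[OF that(1)] that by (simp add: quad_s sum_nonneg_eq_0_iff d_inner)
  have "(\<Sum>m<n. (\<Sum>i<n. cnj (e i k) * a i m) * A m j) = (if k = j then 1 else 0)" if "k < n" "j < n" for k j
  proof -
    have "(\<Sum>m<n. (\<Sum>i<n. cnj (e i k) * a i m) * A m j) = (\<Sum>i<n. cnj (e i k) * (\<Sum>m<n. a i m * A m j))"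
      unfolding sum_distrib_left sum_distrib_right by (subst sum.swap) (simp add: mult.assoc)
    also have "\<dots> = (\<Sum>i<n. cnj (e i k) * e i j)" by (simp only: e_def)
    also have "\<dots> = d k j" by (rule d_eq[OF that, symmetric])
    finally show ?thesis unfolding d_def by (cases "k = j") simp_all
  qed
  then show ?thesis by (intro exI[of _ "\<lambda>k m. \<Sum>i<n. cnj (e i k) * a i m"] allI impI)
qed

context psd_form
begin

lemma sqrt_quad_add: "u \<in> H \<Longrightarrow> v \<in> H \<Longrightarrow> sqrt (quad s (\<lambda>x. u x + v x)) \<le> sqrt (quad s u) + sqrt (quad s v)"
proof (rule real_le_lsqrt)
  assume uv: "u \<in> H" "v \<in> H"
  show "0 \<le> sqrt (quad s u) + sqrt (quad s v)" using uv nonneg by simp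
  have "Re (s u v) \<le> sqrt (quad s u) * sqrt (quad s v)"
    using cauchy_schwarz_sqrt[OF uv] complex_Re_le_cmod[of "s u v"] by linarith
  then show "quad s (\<lambda>x. u x + v x) \<le> (sqrt (quad s u) + sqrt (quad s v))\<^sup>2"
    using uv nonneg by (simp add: quad_add power2_sum)
qed

lemma sqrt_quad_sum:
  assumes "finite I" "\<And>i. i \<in> I \<Longrightarrow> u i \<in> H"
  shows "sqrt (quad s (\<lambda>x. \<Sum>i\<in>I. c i * u i x)) \<le> (\<Sum>i\<in>I. cmod (c i) * sqrt (quad s (u i)))"
  using assms
proof (induction I)
  case (insert i I)
  have "sqrt (quad s (\<lambda>x. c i * u i x + (\<Sum>i\<in>I. c i * u i x)))
      \<le> sqrt (quad s (\<lambda>x. c i * u i x)) + sqrt (quad s (\<lambda>x. \<Sum>i\<in>I. c i * u i x))"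
    using insert by (intro sqrt_quad_add scale_in sum_in) auto
  also have "sqrt (quad s (\<lambda>x. c i * u i x)) = cmod (c i) * sqrt (quad s (u i))"
    using insert by (simp add: quad_scale real_sqrt_mult)
  finally show ?case using insert by simp
qed (simp add: quad_zero)

end

text \<open>
  The form \<open>a\<close> is bounded and coercive relative to the complete form \<open>s\<^sub>0\<close>, and subspaces on which
  \<open>a[u] < -\<tau> \<parallel>u\<parallel>\<^sup>2\<close> for \<open>u \<noteq> 0\<close> have dimension at most \<open>n\<^sub>m\<^sub>a\<^sub>x\<close>.
\<close>

locale form_below = herm_form D a
  for D :: "('a \<Rightarrow> complex) set" and a +
  fixes M :: "'a measure" and s\<^sub>0 and C\<^sub>0 C \<delta>\<^sub>0 C\<^sub>1 \<tau> n\<^sub>m\<^sub>a\<^sub>x :: real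
  assumes D_L2: "D \<subseteq> L2 M"
    and s0: "psd_form D s\<^sub>0" "psd_form.form_complete D s\<^sub>0"
    and L2_le: "u \<in> D \<Longrightarrow> quad (L2_inner M) u \<le> C\<^sub>0 * quad s\<^sub>0 u"
    and bdd: "u \<in> D \<Longrightarrow> v \<in> D \<Longrightarrow> (cmod (a u v))\<^sup>2 \<le> C * (quad s\<^sub>0 u * quad s\<^sub>0 v)"
    and coercive: "u \<in> D \<Longrightarrow> \<delta>\<^sub>0 * quad s\<^sub>0 u \<le> quad a u + C\<^sub>1 * quad (L2_inner M) u" "0 < \<delta>\<^sub>0"
    and null: "u \<in> D \<Longrightarrow> v \<in> D \<Longrightarrow> AE x in M. u x = 0 \<Longrightarrow> a u v = 0"
    and neg_bound: "(\<And>i. i < n \<Longrightarrow> g i \<in> D) \<Longrightarrow>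
        (\<And>c. \<exists>i<n. c i \<noteq> 0 \<Longrightarrow>
           quad a (\<lambda>x. \<Sum>i<n. c i * g i x) + \<tau> * quad (L2_inner M) (\<lambda>x. \<Sum>i<n. c i * g i x) < 0) \<Longrightarrow>
        real n \<le> n\<^sub>m\<^sub>a\<^sub>x"
begin

sublocale s0: psd_form D s\<^sub>0 by (rule s0)

abbreviation inner where "inner \<equiv> L2_inner M"
abbreviation quad\<^sub>2 where "quad\<^sub>2 \<equiv> quad (L2_inner M)"
abbreviation A where "A \<equiv> form_operator M D a"

lemma DL: "u \<in> D \<Longrightarrow> u \<in> L2 M" using D_L2 by blast

text \<open>The form \<open>a[u] + \<tau> \<parallel>u\<parallel>\<^sup>2\<close>.\<close>

definition B where "B u v = a u v + of_real \<tau> * inner u v"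

lemma quad_B: "quad B u = quad a u + \<tau> * quad\<^sub>2 u"
  by (simp add: quad_def B_def)

sublocale B: herm_form D B
  using herm_form_add_scaled[OF herm_form_axioms L2.herm_form_axioms D_L2, of \<tau>]
  unfolding B_def[abs_def] .

text \<open>Families that are orthonormal for \<open>-B\<close>; their members with index at least \<open>n\<close> are irrelevant.\<close>

definition neg_orthonormal :: "(nat \<Rightarrow> 'a \<Rightarrow> complex) \<Rightarrow> nat \<Rightarrow> bool" where
  "neg_orthonormal g n \<longleftrightarrow> (\<forall>i<n. g i \<in> D) \<and> (\<forall>i<n. \<forall>j<n. B (g i) (g j) = (if i = j then -1 else 0))"

lemma neg_orthonormal_quad:
  assumes "neg_orthonormal g n"
  shows "quad B (\<lambda>x. \<Sum>i<n. c i * g i x) = - (\<Sum>i<n. (cmod (c i))\<^sup>2)"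
proof -
  have "B (\<lambda>x. \<Sum>i<n. c i * g i x) (\<lambda>x. \<Sum>i<n. c i * g i x) = (\<Sum>i<n. \<Sum>j<n. c i * cnj (c j) * B (g i) (g j))"
    using assms by (intro B.sum_sum) (auto simp: neg_orthonormal_def)
  also have "\<dots> = (\<Sum>i<n. \<Sum>j<n. if j = i then - (c i * cnj (c i)) else 0)"
    using assms by (intro sum.cong refl) (auto simp: neg_orthonormal_def)
  also have "\<dots> = (\<Sum>i<n. of_real (- ((cmod (c i))\<^sup>2)))"
    by (simp add: complex_norm_square del: of_real_power)
  finally show ?thesis unfolding quad_def by (simp add: sum_negf)
qed

lemma neg_orthonormal_bound:
  assumes "neg_orthonormal g n"
  shows "real n \<le> n\<^sub>m\<^sub>a\<^sub>x"
proof (rule neg_bound)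
  show "g i \<in> D" if "i < n" for i using assms that by (simp add: neg_orthonormal_def)
  fix c assume "\<exists>i<n. c i \<noteq> (0::complex)"
  then obtain i where "i < n" "c i \<noteq> 0" by blast
  then have "0 < (\<Sum>i<n. (cmod (c i))\<^sup>2)" by (intro sum_pos2[of _ i]) auto
  then show "quad a (\<lambda>x. \<Sum>i<n. c i * g i x) + \<tau> * quad\<^sub>2 (\<lambda>x. \<Sum>i<n. c i * g i x) < 0"
    using neg_orthonormal_quad[OF assms] by (simp add: quad_B)
qed

text \<open>
  On the \<open>B\<close>-orthogonal complement of a maximal negative family, \<open>B\<close> is non-negative. Hence \<open>B\<close>
  becomes non-negative when the rank one forms of the family are added.
\<close>

lemma maximal_negative_family:
  obtains g n where "neg_orthonormal g n" "\<And>u. u \<in> D \<Longrightarrow> 0 \<le> quad B u + (\<Sum>j<n. (cmod (B u (g j)))\<^sup>2)"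
proof -
  define S where "S = {n. \<exists>g. neg_orthonormal g n}"
  have "neg_orthonormal undefined 0" by (simp add: neg_orthonormal_def)
  then have "0 \<in> S" by (auto simp: S_def)
  have "S \<subseteq> {..nat \<lceil>n\<^sub>m\<^sub>a\<^sub>x\<rceil>}"
  proof
    fix n assume "n \<in> S"
    then have "real n \<le> n\<^sub>m\<^sub>a\<^sub>x" using neg_orthonormal_bound by (auto simp: S_def)
    then have "real n \<le> real (nat \<lceil>n\<^sub>m\<^sub>a\<^sub>x\<rceil>)" using real_nat_ceiling_ge[of n\<^sub>m\<^sub>a\<^sub>x] by linarith
    then show "n \<in> {..nat \<lceil>n\<^sub>m\<^sub>a\<^sub>x\<rceil>}" by simp
  qed
  then have finS: "finite S" by (rule finite_subset) simp
  define n where "n = Max S"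
  have "n \<in> S" using \<open>0 \<in> S\<close> finS unfolding n_def by (intro Max_in) auto
  then obtain g where g: "neg_orthonormal g n" by (auto simp: S_def)
  have gD: "g i \<in> D" if "i < n" for i using g that by (simp add: neg_orthonormal_def)
  have "0 \<le> quad B u + (\<Sum>j<n. (cmod (B u (g j)))\<^sup>2)" if u: "u \<in> D" for u
  proof (rule ccontr)
    assume neg: "\<not> ?thesis"
    define z where "z = (\<lambda>x. \<Sum>j<n. B u (g j) * g j x)"
    define v where "v = (\<lambda>x. u x + z x)"
    have zD: "z \<in> D" unfolding z_def using gD by (intro sum_in) auto
    have vD: "v \<in> D" unfolding v_def using u zD by (rule add_in)
    have vg: "B v (g i) = 0" if i: "i < n" for i
    proof -
      have "B z (g i) = (\<Sum>j<n. B u (g j) * B (g j) (g i))" unfolding z_def using gD i by (intro B.sum_left) auto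
      also have "\<dots> = (\<Sum>j<n. if j = i then - B u (g i) else 0)"
        using g i by (intro sum.cong) (auto simp: neg_orthonormal_def)
      also have "\<dots> = - B u (g i)" using i by simp
      finally show ?thesis unfolding v_def using u zD gD[OF i] by (simp add: B.add_left)
    qed
    have "B u z = (\<Sum>j<n. cnj (B u (g j)) * B u (g j))" unfolding z_def using gD u by (intro B.sum_right) auto
    also have "\<dots> = of_real (\<Sum>j<n. (cmod (B u (g j)))\<^sup>2)"
      by (simp add: complex_norm_square mult.commute del: of_real_power)
    finally have "B u z = of_real (\<Sum>j<n. (cmod (B u (g j)))\<^sup>2)" .
    then have "quad B v = quad B u + (\<Sum>j<n. (cmod (B u (g j)))\<^sup>2)"
      unfolding v_def using u zD neg_orthonormal_quad[OF g, of "\<lambda>j. B u (g j)"] by (simp add: B.quad_add flip: z_def)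
    then have Bv: "quad B v < 0" using neg by simp
    define r where "r = complex_of_real (1 / sqrt (- quad B v))"
    define h where "h i = (if i = n then (\<lambda>x. r * v x) else g i)" for i
    have "neg_orthonormal h (Suc n)"
      unfolding neg_orthonormal_def
    proof (intro conjI allI impI)
      show "h i \<in> D" if "i < Suc n" for i using that gD vD scale_in by (auto simp: h_def less_Suc_eq)
      fix i j assume ij: "i < Suc n" "j < Suc n"
      have nn: "B (h n) (h n) = -1"
      proof -
        have "B (h n) (h n) = r * cnj r * B v v"
          unfolding h_def using vD by (simp add: B.scale_left B.scale_right scale_in)
        also have "B v v = of_real (quad B v)" by (rule B.self[OF vD])
        also have "r * cnj r = of_real (1 / (- quad B v))"
          using Bv by (simp add: r_def flip: of_real_mult)
        finally have "B (h n) (h n) = of_real (1 / (- quad B v) * quad B v)" by (simp only: of_real_mult)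
        then show ?thesis using Bv by simp
      qed
      have ni: "B (h n) (h i) = 0" "B (h i) (h n) = 0" if i: "i < n" for i
      proof -
        show *: "B (h n) (h i) = 0" unfolding h_def using i vD vg[OF i] gD[OF i] by (simp add: B.scale_left)
        have "h n \<in> D" "h i \<in> D" using i vD scale_in gD by (auto simp: h_def)
        then show "B (h i) (h n) = 0" using B.herm[of "h n" "h i"] * by simp
      qed
      have gg: "B (h i) (h j) = (if i = j then -1 else 0)" if "i < n" "j < n" for i j
        using g that by (simp add: h_def neg_orthonormal_def)
      show "B (h i) (h j) = (if i = j then -1 else 0)"
        using ij nn ni gg by (auto simp: less_Suc_eq)
    qed
    then have "Suc n \<in> S" by (auto simp: S_def)
    then show False using Max_ge[OF finS, of "Suc n"] by (simp add: n_def)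
  qed
  then show thesis using that g by blast
qed

text \<open>
  Stretching the family by \<open>\<surd>2\<close> gains a multiple of the rank one forms as a lower bound, so that the
  functionals \<open>B(\<cdot>, h j)\<close> are bounded with respect to the modified form.
\<close>

lemma negative_directions:
  obtains h n where "\<And>j. j < (n::nat) \<Longrightarrow> h j \<in> D"
    "\<And>u. u \<in> D \<Longrightarrow> (\<Sum>j<n. (cmod (B u (h j)))\<^sup>2) / 2 \<le> quad B u + (\<Sum>j<n. (cmod (B u (h j)))\<^sup>2)"
proof -
  obtain g n where g: "neg_orthonormal g n"
    and Bg: "\<And>u. u \<in> D \<Longrightarrow> 0 \<le> quad B u + (\<Sum>j<n. (cmod (B u (g j)))\<^sup>2)"
    by (rule maximal_negative_family) blast
  have gD: "g j \<in> D" if "j < n" for j using g that by (simp add: neg_orthonormal_def)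
  define h where "h j = (\<lambda>x. complex_of_real (sqrt 2) * g j x)" for j
  have hD: "h j \<in> D" if "j < n" for j unfolding h_def using gD[OF that] by (rule scale_in)
  have "(\<Sum>j<n. (cmod (B u (h j)))\<^sup>2) / 2 \<le> quad B u + (\<Sum>j<n. (cmod (B u (h j)))\<^sup>2)" if u: "u \<in> D" for u
  proof -
    have "(\<Sum>j<n. (cmod (B u (h j)))\<^sup>2) = (\<Sum>j<n. 2 * (cmod (B u (g j)))\<^sup>2)"
      unfolding h_def using u gD by (intro sum.cong) (auto simp: B.scale_right norm_mult power_mult_distrib)
    then show ?thesis using Bg[OF u] by (simp flip: sum_distrib_left)
  qed
  then show thesis using that hD by blast
qed

text \<open>
  Below \<open>-\<tau>\<close> the spectrum consists of eigenvalues: \<open>a - l\<close> is a finite rank perturbation of a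
  complete positive form \<open>b\<close>, so that solving \<open>(a - l) u = f\<close> reduces to a finite linear system.
\<close>

theorem resolvent_or_eigenvalue:
  assumes l: "l < - \<tau>"
  shows "complex_of_real l \<in> resolvent_set M A \<or> is_eigenvalue M A (complex_of_real l)"
proof (rule disjCI)
  assume not_ev: "\<not> is_eigenvalue M A (complex_of_real l)"
  define \<delta> where "\<delta> = - \<tau> - l"
  have \<delta>: "0 < \<delta>" using l by (simp add: \<delta>_def)
  obtain g and n :: nat where gD: "\<And>j. j < n \<Longrightarrow> g j \<in> D"
    and Bg: "\<And>u. u \<in> D \<Longrightarrow> (\<Sum>j<n. (cmod (B u (g j)))\<^sup>2) / 2 \<le> quad B u + (\<Sum>j<n. (cmod (B u (g j)))\<^sup>2)"
    by (rule negative_directions) blast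
  have sum0: "0 \<le> (\<Sum>j<n. (cmod (B u (g j)))\<^sup>2)" for u by (simp add: sum_nonneg)
  define al where "al u v = a u v - of_real l * inner u v" for u v
  define b where "b u v = al u v + (\<Sum>j<n. B u (g j) * cnj (B v (g j)))" for u v
  have quad_b: "quad b u = quad B u + \<delta> * quad\<^sub>2 u + (\<Sum>j<n. (cmod (B u (g j)))\<^sup>2)" for u
  proof -
    have "Re (\<Sum>j<n. B u (g j) * cnj (B u (g j))) = (\<Sum>j<n. (cmod (B u (g j)))\<^sup>2)"
      by (simp add: complex_norm_square[symmetric] del: of_real_power)
    then show ?thesis by (simp add: quad_def b_def al_def B_def \<delta>_def algebra_simps del: Re_sum)
  qed
  have b_lower: "\<delta> * quad\<^sub>2 u \<le> quad b u" if "u \<in> D" for u using Bg[OF that] sum0[of u] unfolding quad_b by linarith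
  interpret b: psd_form D b
  proof
    show "fun_subspace D" by (rule subspace)
    show "b (\<lambda>x. \<alpha> * u x + \<beta> * v x) w = \<alpha> * b u w + \<beta> * b v w" if "u \<in> D" "v \<in> D" "w \<in> D" for \<alpha> \<beta> u v w
      using that DL gD
      by (simp add: b_def al_def lin L2.lin B.lin algebra_simps sum.distrib sum_distrib_left)
    show "b v u = cnj (b u v)" if "u \<in> D" "v \<in> D" for u v
      using that DL herm[of u v] L2.herm[of u M v] by (simp add: b_def al_def mult.commute)
    show "0 \<le> quad b u" if "u \<in> D" for u
      using b_lower[OF that] \<delta> L2.nonneg[OF DL[OF that]] by (meson less_imp_le mult_nonneg_nonneg order_trans)
  qed
  have b_complete: "b.form_complete"
  proof (rule s0.form_complete_equiv[OF s0(2) b.psd_form_axioms])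
    define k1 where "k1 = 1 + (\<bar>C\<^sub>1\<bar> + \<bar>l\<bar>) / \<delta>"
    have k1: "0 < k1" using \<delta> by (simp add: k1_def add_pos_nonneg)
    show "0 < \<delta>\<^sub>0 / k1" using k1 coercive(2) by simp
    show "\<delta>\<^sub>0 / k1 * quad s\<^sub>0 u \<le> quad b u" if u: "u \<in> D" for u
    proof -
      have q2: "0 \<le> quad\<^sub>2 u" using L2.nonneg[OF DL[OF u]] .
      have "quad a u \<le> quad b u + l * quad\<^sub>2 u"
        using sum0[of u] by (simp add: quad_b quad_B \<delta>_def algebra_simps)
      then have "\<delta>\<^sub>0 * quad s\<^sub>0 u \<le> quad b u + (l + C\<^sub>1) * quad\<^sub>2 u"
        using coercive(1)[OF u] by (simp add: algebra_simps)
      also have "\<dots> \<le> quad b u + (\<bar>C\<^sub>1\<bar> + \<bar>l\<bar>) * quad\<^sub>2 u" using q2 by (intro add_left_mono mult_right_mono) auto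
      also have "\<dots> \<le> quad b u + (\<bar>C\<^sub>1\<bar> + \<bar>l\<bar>) * (quad b u / \<delta>)"
        using b_lower[OF u] \<delta> by (intro add_left_mono mult_left_mono) (auto simp: field_simps)
      also have "\<dots> = quad b u * k1" by (simp add: k1_def algebra_simps)
      finally show ?thesis using k1 by (simp add: field_simps)
    qed
    define k2 where "k2 = sqrt \<bar>C\<bar> + \<bar>l\<bar> * \<bar>C\<^sub>0\<bar> + (\<Sum>j<n. 2 * \<bar>C\<bar> * quad s\<^sub>0 (g j) + 2 * \<tau>\<^sup>2 * (\<bar>C\<^sub>0\<bar> * quad\<^sub>2 (g j)))"
    show "quad b u \<le> k2 * quad s\<^sub>0 u" if u: "u \<in> D" for u
    proof -
      have s0u: "0 \<le> quad s\<^sub>0 u" using s0.nonneg[OF u] .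
      have q2: "0 \<le> quad\<^sub>2 u" "quad\<^sub>2 u \<le> \<bar>C\<^sub>0\<bar> * quad s\<^sub>0 u"
        using L2.nonneg[OF DL[OF u]] L2_le[OF u] mult_right_mono[OF abs_ge_self[of C\<^sub>0] s0u] by auto
      have ba: "quad b u = quad a u - l * quad\<^sub>2 u + (\<Sum>j<n. (cmod (B u (g j)))\<^sup>2)"
        by (simp add: quad_b quad_B \<delta>_def algebra_simps)
      have "quad a u \<le> cmod (a u u)" by (simp add: quad_def complex_Re_le_cmod)
      also have "\<dots> \<le> sqrt (\<bar>C\<bar> * (quad s\<^sub>0 u)\<^sup>2)"
      proof (rule real_le_rsqrt)
        show "(cmod (a u u))\<^sup>2 \<le> \<bar>C\<bar> * (quad s\<^sub>0 u)\<^sup>2"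
          using bdd[OF u u] mult_right_mono[OF abs_ge_self[of C], of "(quad s\<^sub>0 u)\<^sup>2"] by (simp add: power2_eq_square)
      qed
      also have "\<dots> = sqrt \<bar>C\<bar> * quad s\<^sub>0 u" using s0u by (simp add: real_sqrt_mult)
      finally have a_le: "quad a u \<le> sqrt \<bar>C\<bar> * quad s\<^sub>0 u" .
      have "- l * quad\<^sub>2 u \<le> \<bar>l\<bar> * quad\<^sub>2 u" using q2 by (intro mult_right_mono) auto
      also have "\<dots> \<le> \<bar>l\<bar> * (\<bar>C\<^sub>0\<bar> * quad s\<^sub>0 u)" using q2 by (intro mult_left_mono) auto
      finally have l_le: "- l * quad\<^sub>2 u \<le> \<bar>l\<bar> * \<bar>C\<^sub>0\<bar> * quad s\<^sub>0 u" by simp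
      have "(\<Sum>j<n. (cmod (B u (g j)))\<^sup>2) \<le> (\<Sum>j<n. (2 * \<bar>C\<bar> * quad s\<^sub>0 (g j) + 2 * \<tau>\<^sup>2 * (\<bar>C\<^sub>0\<bar> * quad\<^sub>2 (g j))) * quad s\<^sub>0 u)"
      proof (rule sum_mono)
        fix j assume "j \<in> {..<n}"
        then have gj: "g j \<in> D" using gD by simp
        have "(cmod (B u (g j)))\<^sup>2 \<le> 2 * (cmod (a u (g j)))\<^sup>2 + 2 * \<tau>\<^sup>2 * (cmod (inner u (g j)))\<^sup>2"
          unfolding B_def using cmod_comb_squared[of 1 "a u (g j)" "of_real \<tau>" "inner u (g j)"] by simp
        also have "\<dots> \<le> 2 * (\<bar>C\<bar> * (quad s\<^sub>0 u * quad s\<^sub>0 (g j))) + 2 * \<tau>\<^sup>2 * ((\<bar>C\<^sub>0\<bar> * quad s\<^sub>0 u) * quad\<^sub>2 (g j))"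
        proof (intro add_mono mult_left_mono)
          show "(cmod (a u (g j)))\<^sup>2 \<le> \<bar>C\<bar> * (quad s\<^sub>0 u * quad s\<^sub>0 (g j))"
            using bdd[OF u gj] mult_right_mono[OF abs_ge_self[of C], of "quad s\<^sub>0 u * quad s\<^sub>0 (g j)"] s0u s0.nonneg[OF gj]
            by simp
          have "(cmod (inner u (g j)))\<^sup>2 \<le> quad\<^sub>2 u * quad\<^sub>2 (g j)" using DL u gj by (intro L2.cauchy_schwarz) auto
          also have "\<dots> \<le> (\<bar>C\<^sub>0\<bar> * quad s\<^sub>0 u) * quad\<^sub>2 (g j)" using q2 L2.nonneg[OF DL[OF gj]] by (intro mult_right_mono)
          finally show "(cmod (inner u (g j)))\<^sup>2 \<le> (\<bar>C\<^sub>0\<bar> * quad s\<^sub>0 u) * quad\<^sub>2 (g j)" .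
        qed auto
        finally show "(cmod (B u (g j)))\<^sup>2 \<le> (2 * \<bar>C\<bar> * quad s\<^sub>0 (g j) + 2 * \<tau>\<^sup>2 * (\<bar>C\<^sub>0\<bar> * quad\<^sub>2 (g j))) * quad s\<^sub>0 u"
          by (simp add: algebra_simps)
      qed
      then show ?thesis unfolding ba k2_def distrib_right sum_distrib_right using a_le l_le by linarith
    qed
  qed
  have "\<exists>w\<in>D. \<forall>v\<in>D. b w v = cnj (B v (g j))" if j: "j < n" for j
  proof (rule b.riesz[OF b_complete])
    show "cnj (B (\<lambda>x. \<alpha> * u x + \<beta> * v x) (g j)) = cnj \<alpha> * cnj (B u (g j)) + cnj \<beta> * cnj (B v (g j))"
      if "u \<in> D" "v \<in> D" for \<alpha> \<beta> u v using that gD[OF j] by (simp add: B.lin)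
    show "(cmod (cnj (B v (g j))))\<^sup>2 \<le> 2 * quad b v" if v: "v \<in> D" for v
    proof -
      define \<Sigma> where "\<Sigma> = (\<Sum>i<n. (cmod (B v (g i)))\<^sup>2)"
      have 1: "0 \<le> \<delta> * quad\<^sub>2 v" using \<delta> L2.nonneg[OF DL[OF v]] by simp
      have 2: "(cmod (B v (g j)))\<^sup>2 \<le> \<Sigma>" unfolding \<Sigma>_def using j by (intro member_le_sum) auto
      have 3: "\<Sigma> / 2 \<le> quad B v + \<Sigma>" unfolding \<Sigma>_def by (rule Bg[OF v])
      have "\<Sigma> / 2 \<le> quad b v" unfolding quad_b \<Sigma>_def[symmetric] using 1 3 by linarith
      then have "\<Sigma> \<le> 2 * quad b v" by simp
      then show ?thesis unfolding complex_mod_cnj using 2 by (rule order_trans[rotated])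
    qed
  qed
  then obtain k where kD: "\<And>j. j < n \<Longrightarrow> k j \<in> D" and k: "\<And>j v. j < n \<Longrightarrow> v \<in> D \<Longrightarrow> b (k j) v = cnj (B v (g j))"
    by metis
  have bk: "b u (k j) = B u (g j)" if "j < n" "u \<in> D" for u j
    using b.herm[OF kD[OF that(1)] that(2)] k[OF that] by simp
  have al_eq: "al u v = b u v - (\<Sum>j<n. b u (k j) * b (k j) v)" if "u \<in> D" "v \<in> D" for u v
    using that by (simp add: b_def[of u v] k bk)
  have eig: "AE x in M. u x = 0" if u: "u \<in> D" and al0: "\<And>v. v \<in> D \<Longrightarrow> al u v = 0" for u
  proof -
    have "a u v = inner (\<lambda>x. of_real l * u x) v" if "v \<in> D" for v
      using al0[OF that] u that DL by (simp add: al_def L2.scale_left)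
    moreover have "(\<lambda>x. of_real l * u x) \<in> L2 M" using DL[OF u] by (rule L2.scale_in)
    ultimately have "u \<in> eigenspace A (of_real l)" using u by (simp add: eigenspace_def form_operator_def)
    then show ?thesis using not_ev by (auto simp: is_eigenvalue_def)
  qed
  \<comment> \<open>\<open>al u = f\<close> is equivalent to \<open>u = w + \<Sum>\<^sub>j b(u, k j) k j\<close> with \<open>b w = f\<close>, a linear system for the \<open>b(u, k j)\<close>\<close>
  define \<Gamma> where "\<Gamma> i j = b (k i) (k j)" for i j
  have bsum: "b (\<lambda>x. \<Sum>i<n. c i * k i x) v = (\<Sum>i<n. c i * b (k i) v)" if "v \<in> D" for c v
    using kD that by (intro b.sum_left) auto
  have sumD: "(\<lambda>x. \<Sum>i<n. c i * k i x) \<in> D" for c using kD by (intro sum_in) auto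
  have "\<exists>P. \<forall>i<n. \<forall>j<n. (\<Sum>m<n. P i m * ((if m = j then 1 else 0) - \<Gamma> m j)) = (if i = j then 1 else 0)"
  proof (rule independent_rows_invertible)
    fix c :: "nat \<Rightarrow> complex"
    assume c0: "(\<Sum>i<n. c i * ((if i = j then 1 else 0) - \<Gamma> i j)) = 0" if "j < n" for j
    have c_eq: "c j = (\<Sum>i<n. c i * \<Gamma> i j)" if "j < n" for j
    proof -
      have "(\<Sum>i<n. c i * ((if i = j then 1 else 0) - \<Gamma> i j)) = (\<Sum>i<n. (if i = j then c j else 0) - c i * \<Gamma> i j)"
        by (intro sum.cong) (auto simp: algebra_simps)
      then show ?thesis using c0[OF that] that by (simp add: sum_subtractf)
    qed
    define u where "u = (\<lambda>x. \<Sum>i<n. c i * k i x)"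
    have uD: "u \<in> D" unfolding u_def by (rule sumD)
    have buk: "b u (k j) = c j" if "j < n" for j
      unfolding u_def using bsum[OF kD[OF that]] c_eq[OF that] by (simp add: \<Gamma>_def)
    have "al u v = 0" if v: "v \<in> D" for v
      unfolding al_eq[OF uD v] using buk bsum[OF v, of c] by (simp add: u_def[symmetric])
    then have u0: "AE x in M. u x = 0" using eig[OF uD] by blast
    have "B u (g j) = 0" if j: "j < n" for j
    proof -
      have "inner u (g j) = (\<integral>x. 0 \<partial>M)"
        unfolding L2_inner_def using u0 DL[OF uD] DL[OF gD[OF j]]
        by (intro integral_cong_AE) (auto dest!: L2_measurable elim!: eventually_mono)
      then show ?thesis using null[OF uD gD[OF j] u0] by (simp add: B_def)
    qed
    then show "\<forall>i<n. c i = 0" using buk bk[OF _ uD] by simp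
  qed
  then obtain P where P: "\<And>i j. i < n \<Longrightarrow> j < n \<Longrightarrow>
      (\<Sum>m<n. P i m * ((if m = j then 1 else 0) - \<Gamma> m j)) = (if i = j then 1 else 0)" by blast
  define C' where "C' = 1 / \<delta> + (\<Sum>j<n. \<Sum>i<n. sqrt (quad\<^sub>2 (k i)) * cmod (P i j) * sqrt (quad\<^sub>2 (k j)))"
  have solve: "\<exists>u\<in>D. (\<forall>v\<in>D. al u v = inner f v) \<and> sqrt (quad\<^sub>2 u) \<le> C' * sqrt (quad\<^sub>2 f)" if f: "f \<in> L2 M" for f
  proof -
    have f0: "0 \<le> quad\<^sub>2 f" using L2.nonneg[OF f] .
    have "\<exists>w\<in>D. \<forall>v\<in>D. b w v = inner f v"
    proof (rule b.riesz[OF b_complete])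
      show "inner f (\<lambda>x. \<alpha> * u x + \<beta> * v x) = cnj \<alpha> * inner f u + cnj \<beta> * inner f v"
        if "u \<in> D" "v \<in> D" for \<alpha> \<beta> u v using that DL f by (intro L2.lin_right) auto
      show "(cmod (inner f v))\<^sup>2 \<le> (quad\<^sub>2 f / \<delta>) * quad b v" if v: "v \<in> D" for v
      proof -
        have "(cmod (inner f v))\<^sup>2 \<le> quad\<^sub>2 f * quad\<^sub>2 v" using DL[OF v] f by (intro L2.cauchy_schwarz)
        also have "\<dots> \<le> quad\<^sub>2 f * (quad b v / \<delta>)"
          using b_lower[OF v] \<delta> f0 by (intro mult_left_mono) (auto simp: field_simps)
        finally show ?thesis by simp
      qed
    qed
    then obtain w where w: "w \<in> D" "\<And>v. v \<in> D \<Longrightarrow> b w v = inner f v" by blast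
    define d where "d j = inner f (k j)" for j
    define c where "c j = (\<Sum>i<n. d i * P i j)" for j
    have c_eq: "d j + (\<Sum>i<n. c i * \<Gamma> i j) = c j" if j: "j < n" for j
    proof -
      have "(\<Sum>m<n. c m * ((if m = j then 1 else 0) - \<Gamma> m j))
          = (\<Sum>i<n. d i * (\<Sum>m<n. P i m * ((if m = j then 1 else 0) - \<Gamma> m j)))"
        unfolding c_def sum_distrib_left sum_distrib_right by (subst sum.swap) (simp add: mult.assoc)
      also have "\<dots> = (\<Sum>i<n. if i = j then d j else 0)" using P j by (intro sum.cong) auto
      also have "\<dots> = d j" using j by simp
      finally have "(\<Sum>m<n. c m * ((if m = j then 1 else 0) - \<Gamma> m j)) = d j" .
      moreover have "(\<Sum>m<n. c m * ((if m = j then 1 else 0) - \<Gamma> m j)) = (\<Sum>m<n. (if m = j then c j else 0) - c m * \<Gamma> m j)"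
        by (intro sum.cong) (auto simp: algebra_simps)
      ultimately have "c j - (\<Sum>i<n. c i * \<Gamma> i j) = d j" using j by (simp add: sum_subtractf)
      then show ?thesis by (metis diff_add_cancel)
    qed
    define z where "z = (\<lambda>x. \<Sum>i<n. c i * k i x)"
    define u where "u = (\<lambda>x. w x + z x)"
    have zD: "z \<in> D" unfolding z_def by (rule sumD)
    have uD: "u \<in> D" unfolding u_def using w zD by (intro add_in)
    have buv: "b u v = inner f v + (\<Sum>i<n. c i * b (k i) v)" if v: "v \<in> D" for v
      unfolding u_def using b.add_left[OF w(1) zD v] w(2)[OF v] bsum[OF v] by (simp add: z_def)
    have buk: "b u (k j) = c j" if "j < n" for j
      using buv[OF kD[OF that]] c_eq[OF that] by (simp add: d_def \<Gamma>_def)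
    have "al u v = inner f v" if v: "v \<in> D" for v
      unfolding al_eq[OF uD v] buv[OF v] using buk by simp
    moreover have "sqrt (quad\<^sub>2 u) \<le> C' * sqrt (quad\<^sub>2 f)"
    proof -
      have wq: "\<delta> * quad\<^sub>2 w \<le> sqrt (quad\<^sub>2 f) * sqrt (quad\<^sub>2 w)"
      proof -
        have "\<delta> * quad\<^sub>2 w \<le> quad b w" by (rule b_lower[OF w(1)])
        also have "\<dots> = Re (inner f w)" using w(2)[OF w(1)] by (simp add: quad_def)
        also have "\<dots> \<le> cmod (inner f w)" by (rule complex_Re_le_cmod)
        also have "\<dots> \<le> sqrt (quad\<^sub>2 f) * sqrt (quad\<^sub>2 w)" by (intro L2.cauchy_schwarz_sqrt f DL w)
        finally show ?thesis .
      qed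
      have w_le: "sqrt (quad\<^sub>2 w) \<le> sqrt (quad\<^sub>2 f) / \<delta>"
      proof (cases "quad\<^sub>2 w = 0")
        case False
        then have pos: "0 < sqrt (quad\<^sub>2 w)" using L2.nonneg[OF DL[OF w(1)]] by simp
        have "(\<delta> * sqrt (quad\<^sub>2 w)) * sqrt (quad\<^sub>2 w) \<le> sqrt (quad\<^sub>2 f) * sqrt (quad\<^sub>2 w)"
          using wq L2.nonneg[OF DL[OF w(1)]] by (simp add: mult.assoc)
        then have "\<delta> * sqrt (quad\<^sub>2 w) \<le> sqrt (quad\<^sub>2 f)" using pos by (simp only: mult_le_cancel_right_pos)
        then show ?thesis using \<delta> by (simp add: field_simps)
      qed (use f0 \<delta> in simp)
      have "sqrt (quad\<^sub>2 u) \<le> sqrt (quad\<^sub>2 w) + sqrt (quad\<^sub>2 z)"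
        unfolding u_def using w zD DL by (intro L2.sqrt_quad_add) auto
      also have "sqrt (quad\<^sub>2 z) \<le> (\<Sum>j<n. cmod (c j) * sqrt (quad\<^sub>2 (k j)))"
        unfolding z_def using kD DL by (intro L2.sqrt_quad_sum) auto
      also have "\<dots> \<le> (\<Sum>j<n. (\<Sum>i<n. (sqrt (quad\<^sub>2 f) * sqrt (quad\<^sub>2 (k i))) * cmod (P i j)) * sqrt (quad\<^sub>2 (k j)))"
      proof (intro sum_mono mult_right_mono)
        fix j
        have "cmod (c j) \<le> (\<Sum>i<n. cmod (d i * P i j))" unfolding c_def by (rule norm_sum)
        also have "\<dots> \<le> (\<Sum>i<n. (sqrt (quad\<^sub>2 f) * sqrt (quad\<^sub>2 (k i))) * cmod (P i j))"
          unfolding norm_mult d_def using f DL kD by (intro sum_mono mult_right_mono L2.cauchy_schwarz_sqrt) auto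
        finally show "cmod (c j) \<le> (\<Sum>i<n. (sqrt (quad\<^sub>2 f) * sqrt (quad\<^sub>2 (k i))) * cmod (P i j))" .
      qed (use kD DL L2.nonneg in auto)
      finally show ?thesis using w_le
        by (simp add: C'_def sum_distrib_left sum_distrib_right mult_ac distrib_left)
    qed
    ultimately show ?thesis using uD by blast
  qed
  show "complex_of_real l \<in> resolvent_set M A"
    unfolding resolvent_set_def mem_Collect_eq
  proof (intro conjI ballI exI)
    fix f assume f: "f \<in> L2 M"
    obtain u where u: "u \<in> D" "\<And>v. v \<in> D \<Longrightarrow> al u v = inner f v" using solve[OF f] by blast
    define F where "F = (\<lambda>x. 1 * f x + of_real l * u x)"
    have FL: "F \<in> L2 M" unfolding F_def using f DL[OF u(1)] by (intro L2.comb_in)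
    have "a u v = inner F v" if v: "v \<in> D" for v
      unfolding F_def using u(2)[OF v] L2.lin[OF f DL[OF u(1)] DL[OF v], of 1 "of_real l"]
      by (simp add: al_def algebra_simps)
    then have "(u, F) \<in> A" using u(1) FL by (simp add: form_operator_def)
    then show "\<exists>(u, F)\<in>A. AE x in M. F x - of_real l * u x = f x"
      by (rule rev_bexI) (simp add: F_def)
  next
    fix uf assume "uf \<in> A"
    then obtain u F where uF: "uf = (u, F)" and u: "u \<in> D" and F: "F \<in> L2 M" and aF: "\<And>v. v \<in> D \<Longrightarrow> a u v = inner F v"
      by (auto simp: form_operator_def)
    define f where "f = (\<lambda>x. F x - of_real l * u x)"
    have fL: "f \<in> L2 M" unfolding f_def using F DL[OF u] by (intro L2.diff_in L2.scale_in)
    have al_u: "al u v = inner f v" if v: "v \<in> D" for v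
      unfolding f_def al_def using aF[OF v] F DL[OF u] DL[OF v]
      by (simp add: L2.diff_left L2.scale_in L2.scale_left)
    obtain u' where u': "u' \<in> D" "\<And>v. v \<in> D \<Longrightarrow> al u' v = inner f v" "sqrt (quad\<^sub>2 u') \<le> C' * sqrt (quad\<^sub>2 f)"
      using solve[OF fL] by blast
    have "AE x in M. u x - u' x = 0"
    proof (rule eig)
      show "(\<lambda>x. u x - u' x) \<in> D" using u u' by (intro diff_in)
      show "al (\<lambda>x. u x - u' x) v = 0" if v: "v \<in> D" for v
      proof -
        have "al (\<lambda>x. u x - u' x) v = al u v - al u' v"
          unfolding al_def using u u' v DL by (simp add: diff_left L2.diff_left algebra_simps)
        then show ?thesis using al_u[OF v] u'(2)[OF v] by simp
      qed
    qed
    then have "quad\<^sub>2 u = quad\<^sub>2 u'"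
      unfolding quad_L2 using DL[OF u] DL[OF u'(1)]
      by (intro integral_cong_AE) (auto dest!: L2_measurable elim!: eventually_mono)
    then show "case uf of (u, F) \<Rightarrow> L2_norm M u \<le> C' * L2_norm M (\<lambda>x. F x - of_real l * u x)"
      using u'(3) by (simp add: uF L2_norm_sqrt f_def)
  qed
qed

end

text \<open>A bounded dimension is a natural number, and is attained.\<close>

lemma ae_dim_attained:
  assumes "\<And>F. finite F \<Longrightarrow> F \<subseteq> E \<Longrightarrow> ae_independent M F \<Longrightarrow> real (card F) \<le> m"
  shows "\<exists>F. finite F \<and> F \<subseteq> E \<and> ae_independent M F \<and> ae_dim M E = of_nat (card F)"
proof -
  define S where "S = {card F | F. finite F \<and> F \<subseteq> E \<and> ae_independent M F}"
  have "S \<subseteq> {..nat \<lceil>m\<rceil>}"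
  proof
    fix n assume "n \<in> S"
    then have "real n \<le> m" using assms by (auto simp: S_def)
    then have "real n \<le> real (nat \<lceil>m\<rceil>)" using real_nat_ceiling_ge[of m] by linarith
    then show "n \<in> {..nat \<lceil>m\<rceil>}" by simp
  qed
  then have fin: "finite S" by (rule finite_subset) simp
  have "card {} \<in> S" unfolding S_def by (intro CollectI exI[of _ "{}"]) (simp add: ae_independent_def)
  then have ne: "S \<noteq> {}" by blast
  have "ae_dim M E = Sup (of_nat ` S)"
    unfolding ae_dim_def S_def by (intro arg_cong[where f = Sup]) auto
  also have "\<dots> = of_nat (Max S)"
  proof (rule Sup_eqI)
    fix y :: ennreal assume "y \<in> of_nat ` S"
    then show "y \<le> (of_nat (Max S) :: ennreal)" using fin by (auto intro: Max_ge)
  next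
    fix y :: ennreal assume "\<And>z. z \<in> of_nat ` S \<Longrightarrow> z \<le> y"
    then show "of_nat (Max S) \<le> y" using Max_in[OF fin ne] by blast
  qed
  finally have "ae_dim M E = of_nat (Max S)" .
  moreover have "Max S \<in> S" using fin ne by (rule Max_in)
  ultimately show ?thesis unfolding S_def by auto
qed

context form_below
begin

lemma eigenspace_iff: "u \<in> eigenspace A z \<longleftrightarrow> u \<in> D \<and> (\<forall>v\<in>D. a u v = z * inner u v)"
  unfolding eigenspace_def form_operator_def using DL L2.scale_in[of u M z] L2.scale_left[of u M _ z] by auto

text \<open>
  Eigenfunctions of distinct eigenvalues are orthogonal, so independent eigenfunctions for
  eigenvalues below \<open>-\<tau>\<close> span a subspace on which \<open>a[u] < -\<tau> \<parallel>u\<parallel>\<^sup>2\<close> for \<open>u \<noteq> 0\<close>.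
\<close>

lemma eigenfunctions_card_bound:
  fixes \<Lambda> :: "real set"
  assumes \<Lambda>: "finite \<Lambda>" "\<Lambda> \<subseteq> {..<- \<tau>}"
    and F: "\<And>l. l \<in> \<Lambda> \<Longrightarrow> finite (F l)" "\<And>l. l \<in> \<Lambda> \<Longrightarrow> F l \<subseteq> eigenspace A (of_real l)"
      "\<And>l. l \<in> \<Lambda> \<Longrightarrow> ae_independent M (F l)"
  shows "real (\<Sum>l\<in>\<Lambda>. card (F l)) \<le> n\<^sub>m\<^sub>a\<^sub>x"
proof -
  define I where "I = Sigma \<Lambda> F"
  have finI: "finite I" unfolding I_def using \<Lambda> F by (intro finite_SigmaI) auto
  obtain h where h: "bij_betw h {..<card I} I"
    using ex_bij_betw_nat_finite[OF finI] by (auto simp: atLeast0LessThan)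
  have FD: "u \<in> D" if "l \<in> \<Lambda>" "u \<in> F l" for l u using F(2) that eigenspace_iff by blast
  have "real (card I) \<le> n\<^sub>m\<^sub>a\<^sub>x"
  proof (rule neg_bound)
    have hI: "h i \<in> I" if "i < card I" for i using bij_betwE[OF h] that by auto
    show "snd (h i) \<in> D" if "i < card I" for i using hI[OF that] FD by (auto simp: I_def)
    fix c :: "nat \<Rightarrow> complex" assume c: "\<exists>i<card I. c i \<noteq> 0"
    define e where "e y = c (inv_into {..<card I} h y)" for y
    have e: "e (h i) = c i" if "i < card I" for i
      unfolding e_def using bij_betw_inv_into_left[OF h, of i] that by simp
    define U where "U l = (\<lambda>x. \<Sum>u\<in>F l. e (l, u) * u x)" for l
    have UD: "U l \<in> D" if "l \<in> \<Lambda>" for l unfolding U_def using FD[OF that] by (intro sum_in) auto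
    have aU: "a (U l) v = of_real l * inner (U l) v" if l: "l \<in> \<Lambda>" and v: "v \<in> D" for l v
    proof -
      have "a (U l) v = (\<Sum>u\<in>F l. e (l, u) * a u v)"
        unfolding U_def using FD[OF l] v by (intro sum_left) auto
      also have "\<dots> = of_real l * (\<Sum>u\<in>F l. e (l, u) * inner u v)"
        unfolding sum_distrib_left using F(2)[OF l] v eigenspace_iff by (intro sum.cong) auto
      also have "(\<Sum>u\<in>F l. e (l, u) * inner u v) = inner (U l) v"
        unfolding U_def using FD[OF l] v DL by (intro L2.sum_left[symmetric]) auto
      finally show ?thesis .
    qed
    have orth: "inner (U l) (U l') = 0" if l: "l \<in> \<Lambda>" "l' \<in> \<Lambda>" "l \<noteq> l'" for l l'
    proof -
      have "of_real l * inner (U l) (U l') = a (U l) (U l')" using aU l UD by simp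
      also have "\<dots> = cnj (a (U l') (U l))" using l UD by (intro herm)
      also have "\<dots> = of_real l' * cnj (inner (U l') (U l))" using aU l UD by simp
      also have "cnj (inner (U l') (U l)) = inner (U l) (U l')"
        using L2.herm[OF DL[OF UD[OF l(2)]] DL[OF UD[OF l(1)]]] by simp
      finally show ?thesis using l(3) by simp
    qed
    have BU: "B (U l) (U l') = (if l' = l then of_real ((l + \<tau>) * quad\<^sub>2 (U l)) else 0)" if l: "l \<in> \<Lambda>" "l' \<in> \<Lambda>" for l l'
    proof -
      have "B (U l) (U l') = of_real (l + \<tau>) * inner (U l) (U l')"
        unfolding B_def using aU l UD by (simp add: distrib_right)
      then show ?thesis using orth[OF l] L2.self[OF DL[OF UD[OF l(1)]]] by auto
    qed
    have sum_eq: "(\<lambda>x. \<Sum>i<card I. c i * snd (h i) x) = (\<lambda>x. \<Sum>l\<in>\<Lambda>. 1 * U l x)"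
    proof
      fix x
      have "(\<Sum>i<card I. c i * snd (h i) x) = (\<Sum>i<card I. e (h i) * snd (h i) x)"
        by (intro sum.cong) (auto simp: e)
      also have "\<dots> = (\<Sum>y\<in>I. e y * snd y x)" by (rule sum.reindex_bij_betw[OF h])
      also have "\<dots> = (\<Sum>l\<in>\<Lambda>. \<Sum>u\<in>F l. e (l, u) * u x)"
        unfolding I_def using \<Lambda> F by (subst sum.Sigma) (auto simp: case_prod_beta)
      finally show "(\<Sum>i<card I. c i * snd (h i) x) = (\<Sum>l\<in>\<Lambda>. 1 * U l x)" by (simp add: U_def)
    qed
    have "B (\<lambda>x. \<Sum>l\<in>\<Lambda>. 1 * U l x) (\<lambda>x. \<Sum>l\<in>\<Lambda>. 1 * U l x) = (\<Sum>l\<in>\<Lambda>. \<Sum>l'\<in>\<Lambda>. 1 * cnj 1 * B (U l) (U l'))"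
      using UD by (intro B.sum_sum) auto
    also have "\<dots> = (\<Sum>l\<in>\<Lambda>. \<Sum>l'\<in>\<Lambda>. if l' = l then of_real ((l + \<tau>) * quad\<^sub>2 (U l)) else 0)"
      by (intro sum.cong refl) (simp add: BU)
    also have "\<dots> = of_real (\<Sum>l\<in>\<Lambda>. (l + \<tau>) * quad\<^sub>2 (U l))"
      using \<Lambda>(1) by simp
    finally have "quad B (\<lambda>x. \<Sum>l\<in>\<Lambda>. 1 * U l x) = (\<Sum>l\<in>\<Lambda>. (l + \<tau>) * quad\<^sub>2 (U l))" by (simp add: quad_def)
    moreover have "0 < (\<Sum>l\<in>\<Lambda>. - ((l + \<tau>) * quad\<^sub>2 (U l)))"
    proof -
      obtain i where i: "i < card I" "c i \<noteq> 0" using c by blast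
      obtain l u where lu: "h i = (l, u)" "l \<in> \<Lambda>" "u \<in> F l" using hI[OF i(1)] by (auto simp: I_def)
      have "e (l, u) \<noteq> 0" using e[OF i(1)] i(2) lu by simp
      then have "\<not> (AE x in M. U l x = 0)"
        using F(3)[OF lu(2)] lu(3) unfolding ae_independent_def U_def by fastforce
      then have "quad\<^sub>2 (U l) \<noteq> 0" using L2_null_AE[OF DL[OF UD[OF lu(2)]]] by blast
      then have pos: "0 < quad\<^sub>2 (U l)" using L2.nonneg[OF DL[OF UD[OF lu(2)]]] by simp
      show ?thesis
      proof (rule sum_pos2[OF \<Lambda>(1) lu(2)])
        show "0 < - ((l + \<tau>) * quad\<^sub>2 (U l))" using pos \<Lambda>(2) lu(2) by (auto intro!: mult_neg_pos)
        show "0 \<le> - ((l' + \<tau>) * quad\<^sub>2 (U l'))" if "l' \<in> \<Lambda>" for l'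
          using L2.nonneg[OF DL[OF UD[OF that]]] \<Lambda>(2) that by (auto intro!: mult_nonpos_nonneg)
      qed
    qed
    ultimately show "quad a (\<lambda>x. \<Sum>i<card I. c i * snd (h i) x) + \<tau> * quad\<^sub>2 (\<lambda>x. \<Sum>i<card I. c i * snd (h i) x) < 0"
      unfolding sum_eq quad_B[symmetric] by (simp add: sum_negf)
  qed
  then show ?thesis using \<Lambda> F by (simp add: I_def)
qed

theorem eigenvalue_count_bound: "eigenvalue_count M A (- \<tau>) \<le> ennreal n\<^sub>m\<^sub>a\<^sub>x"
proof -
  have "eigenvalue_count M A (- \<tau>) = (\<Sum>\<^sub>\<infinity>l\<in>{..<- \<tau>}. ae_dim M (eigenspace A (complex_of_real l)))"
    unfolding eigenvalue_count_def using resolvent_or_eigenvalue by auto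
  also have "\<dots> = (SUP \<Lambda>\<in>{\<Lambda>. finite \<Lambda> \<and> \<Lambda> \<subseteq> {..<- \<tau>}}. \<Sum>l\<in>\<Lambda>. ae_dim M (eigenspace A (complex_of_real l)))"
    by (rule nonneg_infsum_complete) simp
  also have "\<dots> \<le> ennreal n\<^sub>m\<^sub>a\<^sub>x"
  proof (rule SUP_least)
    fix \<Lambda> assume "\<Lambda> \<in> {\<Lambda>. finite \<Lambda> \<and> \<Lambda> \<subseteq> {..<- \<tau>}}"
    then have \<Lambda>: "finite \<Lambda>" "\<Lambda> \<subseteq> {..<- \<tau>}" by auto
    have "\<exists>F. finite F \<and> F \<subseteq> eigenspace A (of_real l) \<and> ae_independent M F \<and>
        ae_dim M (eigenspace A (of_real l)) = of_nat (card F)" if l: "l \<in> \<Lambda>" for l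
    proof (rule ae_dim_attained)
      fix F assume "finite F" "F \<subseteq> eigenspace A (complex_of_real l)" "ae_independent M F"
      then show "real (card F) \<le> n\<^sub>m\<^sub>a\<^sub>x"
        using eigenfunctions_card_bound[of "{l}" "\<lambda>_. F"] \<Lambda>(2) l by auto
    qed
    then obtain F where F: "\<And>l. l \<in> \<Lambda> \<Longrightarrow> finite (F l) \<and> F l \<subseteq> eigenspace A (of_real l) \<and> ae_independent M (F l) \<and>
        ae_dim M (eigenspace A (of_real l)) = of_nat (card (F l))" by metis
    have "(\<Sum>l\<in>\<Lambda>. ae_dim M (eigenspace A (complex_of_real l))) = of_nat (\<Sum>l\<in>\<Lambda>. card (F l))"
      using F by simp
    also have "\<dots> = ennreal (real (\<Sum>l\<in>\<Lambda>. card (F l)))" by (simp add: ennreal_of_nat_eq_real_of_nat)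
    also have "\<dots> \<le> ennreal n\<^sub>m\<^sub>a\<^sub>x"
      using F \<Lambda> by (intro ennreal_leI eigenfunctions_card_bound) auto
    finally show "(\<Sum>l\<in>\<Lambda>. ae_dim M (eigenspace A (complex_of_real l))) \<le> ennreal n\<^sub>m\<^sub>a\<^sub>x" .
  qed
  finally show ?thesis .
qed

end

section \<open>From the Sobolev inequality to the bound on eigenvalues\<close>

text \<open>Closed non-negative forms, not necessarily densely defined.\<close>

locale closed_nonneg_form =
  fixes M :: "'a measure" and D :: "('a \<Rightarrow> complex) set" and t
  assumes hermitian: "hermitian_form M D t" and nonneg_t: "nonneg_form D t" and closed: "closed_form M D t"
begin

lemma D_L2: "D \<subseteq> L2 M"
  using hermitian by (simp add: hermitian_form_def)

lemma DL: "u \<in> D \<Longrightarrow> u \<in> L2 M" using D_L2 by blast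

lemma D_meas [measurable_dest]: "u \<in> D \<Longrightarrow> u \<in> borel_measurable M"
  using DL L2_measurable by blast

lemma herm_form_t: "herm_form D t"
  using hermitian unfolding hermitian_form_def by unfold_locales blast+

sublocale t: psd_form D t
proof -
  interpret herm_form D t by (rule herm_form_t)
  show "psd_form D t" using nonneg_t by unfold_locales (auto simp: nonneg_form_def)
qed

abbreviation inner where "inner \<equiv> L2_inner M"
abbreviation quad\<^sub>2 where "quad\<^sub>2 \<equiv> quad (L2_inner M)"

lemma t_null:
  assumes "u \<in> D" "v \<in> D" "AE x in M. u x = 0"
  shows "t u v = 0"
proof -
  have "\<forall>u\<in>D. \<forall>u'\<in>borel_measurable M. (AE x in M. u x = u' x) \<longrightarrow> u' \<in> D \<and> (\<forall>w\<in>D. t u' w = t u w)"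
    using hermitian unfolding hermitian_form_def by (elim conjE)
  from bspec[OF bspec[OF this assms(1)], of "\<lambda>x. 0"] have "t (\<lambda>x. 0) v = t u v"
    using assms(2,3) by simp
  then show ?thesis using t.zero_left[OF assms(2)] by simp
qed

text \<open>The form of \<open>T + \<tau>\<close>.\<close>

definition shift :: "real \<Rightarrow> ('a \<Rightarrow> complex) \<Rightarrow> ('a \<Rightarrow> complex) \<Rightarrow> complex" where
  "shift \<tau> u v = t u v + of_real \<tau> * inner u v"

lemma quad_shift: "quad (shift \<tau>) u = quad t u + \<tau> * quad\<^sub>2 u"
  by (simp add: quad_def shift_def)

lemma psd_shift:
  assumes "0 \<le> \<tau>"
  shows "psd_form D (shift \<tau>)"
proof -
  interpret herm_form D "shift \<tau>"
    using herm_form_add_scaled[OF herm_form_t L2.herm_form_axioms D_L2, of \<tau>]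
    unfolding shift_def[abs_def] .
  show ?thesis
    by unfold_locales (simp add: quad_shift t.nonneg L2.nonneg[OF DL] assms)
qed

lemma complete_shift:
  assumes \<tau>: "0 < \<tau>"
  shows "psd_form.form_complete D (shift \<tau>)"
proof -
  interpret s: psd_form D "shift \<tau>" using \<tau> by (intro psd_shift) simp
  show ?thesis
    unfolding s.form_complete_def
  proof (intro allI impI, elim conjE)
    fix U :: "nat \<Rightarrow> 'a \<Rightarrow> complex"
    assume U: "\<forall>n. U n \<in> D"
      and cauchy: "\<forall>e>0. \<exists>n0. \<forall>m\<ge>n0. \<forall>n\<ge>n0. quad (shift \<tau>) (\<lambda>x. U m x - U n x) < e"
    have d: "(\<lambda>x. U m x - U n x) \<in> D" for m n using U t.diff_in by blast
    have le: "\<tau> * quad\<^sub>2 (\<lambda>x. U m x - U n x) \<le> quad (shift \<tau>) (\<lambda>x. U m x - U n x)"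
      "quad t (\<lambda>x. U m x - U n x) \<le> quad (shift \<tau>) (\<lambda>x. U m x - U n x)" for m n
      using t.nonneg[OF d] L2.nonneg[OF DL[OF d]] \<tau> by (simp_all add: quad_shift)
    have "\<exists>n0. \<forall>m\<ge>n0. \<forall>n\<ge>n0. quad\<^sub>2 (\<lambda>x. U m x - U n x) < e" if "0 < e" for e
    proof -
      have "0 < \<tau> * e" using \<tau> that by simp
      then obtain n0 where n0: "\<forall>m\<ge>n0. \<forall>n\<ge>n0. quad (shift \<tau>) (\<lambda>x. U m x - U n x) < \<tau> * e"
        using cauchy by blast
      have "quad\<^sub>2 (\<lambda>x. U m x - U n x) < e" if "m \<ge> n0" "n \<ge> n0" for m n
      proof -
        have "\<tau> * quad\<^sub>2 (\<lambda>x. U m x - U n x) < \<tau> * e" using le(1)[of m n] n0 that by (meson le_less_trans)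
        then show ?thesis using \<tau> by simp
      qed
      then show ?thesis by blast
    qed
    then obtain u where u: "u \<in> L2 M" "(\<lambda>n. quad\<^sub>2 (\<lambda>x. U n x - u x)) \<longlonglongrightarrow> 0"
      using L2_complete[of M] U DL unfolding L2.form_complete_def by blast
    have "(\<lambda>n. L2_norm M (\<lambda>x. U n x - u x)) \<longlonglongrightarrow> 0"
      unfolding L2_norm_sqrt using tendsto_real_sqrt[OF u(2)] by simp
    moreover have "\<exists>n0. \<forall>m\<ge>n0. \<forall>n\<ge>n0. \<bar>quad t (\<lambda>x. U m x - U n x)\<bar> < e" if e: "0 < e" for e
    proof -
      obtain n0 where n0: "\<forall>m\<ge>n0. \<forall>n\<ge>n0. quad (shift \<tau>) (\<lambda>x. U m x - U n x) < e"
        using cauchy e by blast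
      have "\<bar>quad t (\<lambda>x. U m x - U n x)\<bar> < e" if "m \<ge> n0" "n \<ge> n0" for m n
        using le(2)[of m n] t.nonneg[OF d, of m n] n0 that by (simp add: order.strict_trans1)
      then show ?thesis by blast
    qed
    ultimately have "u \<in> D" "(\<lambda>n. quad t (\<lambda>x. U n x - u x)) \<longlonglongrightarrow> 0"
      using closed U u(1) unfolding closed_form_def by blast+
    moreover have "(\<lambda>n. quad t (\<lambda>x. U n x - u x) + \<tau> * quad\<^sub>2 (\<lambda>x. U n x - u x)) \<longlonglongrightarrow> 0 + \<tau> * 0"
      using calculation(2) u(2) by (intro tendsto_add tendsto_mult tendsto_const)
    ultimately show "\<exists>u\<in>D. (\<lambda>n. quad (shift \<tau>) (\<lambda>x. U n x - u x)) \<longlonglongrightarrow> 0"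
      by (auto simp: quad_shift)
  qed
qed

lemma form_minus_eq:
  assumes "V \<in> borel_measurable M" "AE x in M. 0 \<le> V x" "u \<in> D" "v \<in> D"
  shows "form_minus M t V u v = t u v - L2_inner (density M (\<lambda>x. ennreal (V x))) u v"
proof -
  have [measurable]: "u \<in> borel_measurable M" "v \<in> borel_measurable M" using assms D_meas by auto
  have "L2_inner (density M (\<lambda>x. ennreal (V x))) u v = (\<integral>x. V x *\<^sub>R (u x * cnj (v x)) \<partial>M)"
    unfolding L2_inner_def using assms by (intro integral_density) auto
  then show ?thesis by (simp add: form_minus_def scaleR_conv_of_real mult.assoc)
qed

lemma herm_form_minus:
  assumes "V \<in> borel_measurable M" "AE x in M. 0 \<le> V x"
    and "\<And>u. u \<in> D \<Longrightarrow> u \<in> L2 (density M (\<lambda>x. ennreal (V x)))"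
  shows "herm_form D (form_minus M t V)"
proof
  note eq = form_minus_eq[OF assms(1,2)]
  show "fun_subspace D" by (rule t.subspace)
  show "form_minus M t V (\<lambda>x. \<alpha> * u x + \<beta> * v x) w = \<alpha> * form_minus M t V u w + \<beta> * form_minus M t V v w"
    if "u \<in> D" "v \<in> D" "w \<in> D" for \<alpha> \<beta> u v w
    using that assms(3) t.comb_in by (simp add: eq t.lin L2.lin algebra_simps)
  show "form_minus M t V v u = cnj (form_minus M t V u v)" if "u \<in> D" "v \<in> D" for u v
    using that assms(3) t.herm[of u v] L2.herm[of u _ v] by (simp add: eq)
qed

end

text \<open>The exponents of the theorem, expressed through \<open>p = \<gamma> + \<kappa>\<close>.\<close>

locale exponents =
  fixes \<gamma> \<kappa> q \<theta> p :: real
  assumes \<gamma>: "0 < \<gamma>" and \<kappa>: "0 < \<kappa>" and p: "1 < p" "p = \<gamma> + \<kappa>"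
    and q: "q = 2 * p / (p - 1)" and \<theta>: "\<theta> = \<kappa> / p"
begin

lemma \<theta>_bounds: "0 < \<theta>" "\<theta> < 1"
  using \<gamma> \<kappa> p by (auto simp: \<theta>)

lemma one_minus_\<theta>: "1 - \<theta> = \<gamma> / p"
  using p by (simp add: \<theta> field_simps)

lemma two_over_q: "2 / q = (p - 1) / p"
  using p(1) by (simp add: q field_simps)

lemma q_gt_2: "2 < q"
  using p by (simp add: q field_simps)

text \<open>The combination of constants in which the bounds are stated.\<close>

definition normalized :: "real \<Rightarrow> real" where
  "normalized S = \<theta> powr (- \<theta>) * (1 - \<theta>) powr (- 1 + \<theta>) * S"

lemma normalized_pos: "0 < S \<Longrightarrow> 0 < normalized S"
  using \<theta>_bounds by (simp add: normalized_def)

lemma weighted_am_gm: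
  assumes "0 \<le> x" "0 \<le> y"
  shows "normalized 1 * (x powr \<theta> * y powr (1 - \<theta>)) \<le> x + y"
proof (cases "x = 0 \<or> y = 0")
  case True
  then show ?thesis using assms by auto
next
  case False
  then have pos: "0 < x" "0 < y" using assms by auto
  have "(x / \<theta>) powr \<theta> * (y / (1 - \<theta>)) powr (1 - \<theta>) \<le> \<theta> * (x / \<theta>) + (1 - \<theta>) * (y / (1 - \<theta>))"
    using \<theta>_bounds pos by (intro Youngs_inequality_0) auto
  also have "\<dots> = x + y" using \<theta>_bounds by simp
  also have "(x / \<theta>) powr \<theta> * (y / (1 - \<theta>)) powr (1 - \<theta>) = normalized 1 * (x powr \<theta> * y powr (1 - \<theta>))"
  proof -
    have "(1 - \<theta>) powr (- 1 + \<theta>) = inverse ((1 - \<theta>) powr (1 - \<theta>))"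
      by (simp flip: powr_minus)
    then show ?thesis using pos \<theta>_bounds by (simp add: normalized_def powr_divide powr_minus field_simps)
  qed
  finally show ?thesis .
qed

end

locale form_with_exponents = closed_nonneg_form M D t + exponents \<gamma> \<kappa> q \<theta> p
  for M :: "'a measure" and D t \<gamma> \<kappa> q \<theta> p
begin

lemma L2_norm_powr:
  assumes "u \<in> D"
  shows "L2_norm M u powr (2 * (1 - \<theta>)) = quad\<^sub>2 u powr (1 - \<theta>)"
proof -
  have "L2_norm M u = quad\<^sub>2 u powr (1 / 2)"
    using L2.nonneg[OF DL[OF assms]] by (simp add: L2_norm_sqrt powr_half_sqrt)
  moreover have "1 / 2 * (2 * (1 - \<theta>)) = 1 - \<theta>" by simp
  ultimately show ?thesis by (simp only: powr_powr)
qed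

end

text \<open>The consequence of the first two Beurling--Deny conditions that yields positive resolvents.\<close>

locale markov_form = form_with_exponents M D t \<gamma> \<kappa> q \<theta> p
  for M :: "'a measure" and D t \<gamma> \<kappa> q \<theta> p +
  assumes abs_in: "u \<in> D \<Longrightarrow> (\<lambda>x. complex_of_real \<bar>Re (u x)\<bar>) \<in> D"
    and abs_le: "u \<in> D \<Longrightarrow> quad t (\<lambda>x. complex_of_real \<bar>Re (u x)\<bar>) \<le> quad t u"
begin

text \<open>The Sobolev inequality for \<open>T + \<tau>\<close>.\<close>

lemma shift_sobolev:
  assumes sob: "sobolev_interp M D t q \<theta> S" and S: "0 < S" and \<tau>: "0 < \<tau>" and u: "u \<in> D"
  shows "normalized S * \<tau> powr (1 - \<theta>) * (\<integral>x. cmod (u x) powr q \<partial>M) powr (2 / q) \<le> quad (shift \<tau>) u"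
proof -
  define x where "x = quad t u"
  define y where "y = quad\<^sub>2 u"
  define I where "I = (\<integral>x. cmod (u x) powr q \<partial>M) powr (2 / q)"
  have nn: "0 \<le> x" "0 \<le> y" unfolding x_def y_def using t.nonneg[OF u] L2.nonneg[OF DL[OF u]] by auto
  have SI: "S * I \<le> x powr \<theta> * y powr (1 - \<theta>)"
    using sob u unfolding sobolev_interp_def x_def y_def I_def L2_norm_powr[OF u, symmetric] by blast
  have "normalized S * \<tau> powr (1 - \<theta>) * I = normalized 1 * \<tau> powr (1 - \<theta>) * (S * I)"
    by (simp add: normalized_def)
  also have "\<dots> \<le> normalized 1 * \<tau> powr (1 - \<theta>) * (x powr \<theta> * y powr (1 - \<theta>))"
    using SI normalized_pos[of 1] by (intro mult_left_mono) auto
  also have "\<dots> = normalized 1 * (x powr \<theta> * (\<tau> * y) powr (1 - \<theta>))"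
    using nn \<tau> by (simp add: powr_mult)
  also have "\<dots> \<le> x + \<tau> * y" using nn \<tau> by (intro weighted_am_gm) auto
  finally show ?thesis by (simp add: quad_shift x_def y_def I_def)
qed

lemma weighted_form_shift:
  assumes sob: "sobolev_interp M D t q \<theta> S" and S: "0 < S" and \<tau>: "0 < \<tau>"
    and V: "V \<in> borel_measurable M" "AE x in M. 0 \<le> V x" "integrable M (\<lambda>x. V x powr p)"
  shows "weighted_form D (shift \<tau>) M V p (normalized S * \<tau> powr (1 - \<theta>))"
proof -
  interpret s: psd_form D "shift \<tau>" using \<tau> by (intro psd_shift) simp
  show ?thesis
  proof
    show "s.form_complete" by (rule complete_shift[OF \<tau>])
    show "D \<subseteq> L2 M" by (rule D_L2)
    show "(\<lambda>x. complex_of_real \<bar>Re (u x)\<bar>) \<in> D" if "u \<in> D" for u using that by (rule abs_in)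
    show "quad (shift \<tau>) (\<lambda>x. complex_of_real \<bar>Re (u x)\<bar>) \<le> quad (shift \<tau>) u" if u: "u \<in> D" for u
    proof -
      have "quad\<^sub>2 (\<lambda>x. complex_of_real \<bar>Re (u x)\<bar>) \<le> quad\<^sub>2 u"
        unfolding quad_L2
      proof (rule integral_mono)
        show "integrable M (\<lambda>x. (cmod (complex_of_real \<bar>Re (u x)\<bar>))\<^sup>2)"
          using L2_integrable[OF DL[OF abs_in[OF u]]] .
        show "integrable M (\<lambda>x. (cmod (u x))\<^sup>2)" using L2_integrable[OF DL[OF u]] .
      qed (simp add: cmod_power2)
      then show ?thesis unfolding quad_shift using abs_le[OF u] \<tau> by (intro add_mono mult_left_mono) auto
    qed
    show "0 < normalized S * \<tau> powr (1 - \<theta>)" using normalized_pos[OF S] \<tau> by simp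
    show "integrable M (\<lambda>x. cmod (u x) powr (2 * p / (p - 1)))" if "u \<in> D" for u
      using sob that unfolding sobolev_interp_def q by blast
    show "normalized S * \<tau> powr (1 - \<theta>) * (\<integral>x. cmod (u x) powr (2 * p / (p - 1)) \<partial>M) powr ((p - 1) / p) \<le> quad (shift \<tau>) u"
      if "u \<in> D" for u using shift_sobolev[OF sob S \<tau> that] unfolding two_over_q unfolding q .
  qed (use p V in auto)
qed

theorem sobolev_imp_weak_LT:
  assumes sob: "sobolev_interp M D t q \<theta> S" and S: "0 < S"
  shows "weak_LT M D t \<gamma> \<kappa> (exp (p - 1) * normalized S powr (- p))"
  unfolding weak_LT_def
proof (intro ballI impI, elim conjE, unfold p(2)[symmetric])
  fix V :: "'a \<Rightarrow> real"
  assume V: "V \<in> borel_measurable M" "AE x in M. 0 \<le> V x" "integrable M (\<lambda>x. V x powr p)"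
  define N where "N = density M (\<lambda>x. ennreal (V x))"
  define Vp where "Vp = (\<integral>x. V x powr p \<partial>M)"
  define a where "a = form_minus M t V"
  have Vp0: "0 \<le> Vp" by (simp add: Vp_def)
  have WF: "weighted_form D (shift \<tau>) M V p (normalized S * \<tau> powr (1 - \<theta>))" if "0 < \<tau>" for \<tau>
    using that by (rule weighted_form_shift[OF sob S _ V])
  have NL: "u \<in> L2 N" if "u \<in> D" for u
    using weighted_form.weight_bound(1)[OF WF[of 1] that] weighted_form.N_def[OF WF[of 1]] by (simp add: N_def)
  have Nq: "quad (L2_inner N) u \<le> Vp powr (1 / p) / (normalized S * \<tau> powr (1 - \<theta>)) * (quad t u + \<tau> * quad\<^sub>2 u)"
    if "u \<in> D" "0 < \<tau>" for u \<tau>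
    using weighted_form.weight_bound(2)[OF WF[OF that(2)] that(1)]
    unfolding weighted_form.N_def[OF WF[OF that(2)]] weighted_form.Vp_def[OF WF[OF that(2)]]
    by (simp add: quad_shift N_def Vp_def)
  have a_eq: "a u v = t u v - L2_inner N u v" if "u \<in> D" "v \<in> D" for u v
    unfolding a_def N_def by (rule form_minus_eq[OF V(1,2) that])
  have a_quad: "quad a u = quad t u - quad (L2_inner N) u" if "u \<in> D" for u
    using a_eq[OF that that] by (simp add: quad_def)
  \<comment> \<open>\<open>\<tau>\<^sub>0\<close> is so large that \<open>V\<close> has form bound at most \<open>1/2\<close> relative to \<open>T + \<tau>\<^sub>0\<close>\<close>
  define \<tau>\<^sub>0 where "\<tau>\<^sub>0 = (2 * Vp powr (1 / p) / normalized S + 1) powr (1 / (1 - \<theta>))"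
  have \<tau>0_base: "0 < 2 * Vp powr (1 / p) / normalized S + 1"
    using normalized_pos[OF S] by (simp add: add_nonneg_pos)
  have \<tau>0: "0 < \<tau>\<^sub>0" using \<tau>0_base by (simp add: \<tau>\<^sub>0_def)
  have half: "quad (L2_inner N) u \<le> 1 / 2 * (quad t u + \<tau>\<^sub>0 * quad\<^sub>2 u)" if u: "u \<in> D" for u
  proof -
    have "\<tau>\<^sub>0 powr (1 - \<theta>) = 2 * Vp powr (1 / p) / normalized S + 1"
      using \<theta>_bounds \<tau>0_base by (simp add: \<tau>\<^sub>0_def powr_powr)
    then have "normalized S * \<tau>\<^sub>0 powr (1 - \<theta>) = 2 * Vp powr (1 / p) + normalized S"
      using normalized_pos[OF S] by (simp add: field_simps)
    then have "Vp powr (1 / p) / (normalized S * \<tau>\<^sub>0 powr (1 - \<theta>)) \<le> 1 / 2"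
      using normalized_pos[OF S] by (simp add: divide_le_eq add_nonneg_pos)
    then have "Vp powr (1 / p) / (normalized S * \<tau>\<^sub>0 powr (1 - \<theta>)) * (quad t u + \<tau>\<^sub>0 * quad\<^sub>2 u)
        \<le> 1 / 2 * (quad t u + \<tau>\<^sub>0 * quad\<^sub>2 u)"
      using t.nonneg[OF u] L2.nonneg[OF DL[OF u]] \<tau>0 by (intro mult_right_mono) auto
    then show ?thesis using Nq[OF u \<tau>0] by linarith
  qed
  interpret a: herm_form D a
    unfolding a_def using NL by (intro herm_form_minus V) (simp add: N_def)
  have t_le: "quad t u \<le> 2 * quad a u + \<tau>\<^sub>0 * quad\<^sub>2 u" if "u \<in> D" for u
    using half[OF that] a_quad[OF that] by (simp add: algebra_simps)
  have "form_sum_exists M D t V"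
    unfolding form_sum_exists_def a_def[symmetric]
  proof (intro conjI ballI)
    show "integrable M (\<lambda>x. V x * (cmod (u x))\<^sup>2)" if u: "u \<in> D" for u
    proof -
      have [measurable]: "u \<in> borel_measurable M" using u by (rule D_meas)
      show ?thesis using L2_integrable[OF NL[OF u]] V(1,2) unfolding N_def by (simp add: integrable_density)
    qed
    have "- (\<tau>\<^sub>0 / 2) * quad\<^sub>2 u \<le> quad a u" if "u \<in> D" for u
      using t_le[OF that] t.nonneg[OF that] by (simp add: algebra_simps)
    then show "semibounded_form M D a"
      unfolding semibounded_form_def L2_norm_squared by blast
    show "closed_form M D a"
      unfolding closed_form_def
    proof (intro allI impI, elim conjE)
      fix U :: "nat \<Rightarrow> 'a \<Rightarrow> complex" and u
      assume U: "\<forall>n. U n \<in> D" and u: "u \<in> L2 M" and lim: "(\<lambda>n. L2_norm M (\<lambda>x. U n x - u x)) \<longlonglongrightarrow> 0"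
        and cauchy: "\<forall>e>0. \<exists>n0. \<forall>m\<ge>n0. \<forall>n\<ge>n0. \<bar>quad a (\<lambda>x. U m x - U n x)\<bar> < e"
      have d: "(\<lambda>x. U m x - U n x) \<in> D" for m n using U t.diff_in by blast
      have lim2: "(\<lambda>n. quad\<^sub>2 (\<lambda>x. U n x - u x)) \<longlonglongrightarrow> 0"
        using tendsto_power[OF lim, of 2] by (simp add: L2_norm_squared)
      have "\<exists>n0. \<forall>m\<ge>n0. \<forall>n\<ge>n0. \<bar>quad t (\<lambda>x. U m x - U n x)\<bar> < e" if e: "0 < e" for e
      proof -
        have "0 < e / 4" "0 < e / (8 * \<tau>\<^sub>0)" using e \<tau>0 by auto
        then obtain n1 where n1: "\<And>m n. m \<ge> n1 \<Longrightarrow> n \<ge> n1 \<Longrightarrow> \<bar>quad a (\<lambda>x. U m x - U n x)\<bar> < e / 4"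
          using cauchy by blast
        have "\<forall>\<^sub>F n in sequentially. quad\<^sub>2 (\<lambda>x. U n x - u x) < e / (8 * \<tau>\<^sub>0)"
          using lim2 \<open>0 < e / (8 * \<tau>\<^sub>0)\<close> by (rule order_tendstoD)
        then obtain n2 where n2: "\<And>n. n \<ge> n2 \<Longrightarrow> quad\<^sub>2 (\<lambda>x. U n x - u x) < e / (8 * \<tau>\<^sub>0)"
          by (auto simp: eventually_sequentially)
        have "\<bar>quad t (\<lambda>x. U m x - U n x)\<bar> < e" if mn: "m \<ge> max n1 n2" "n \<ge> max n1 n2" for m n
        proof -
          have L: "(\<lambda>x. U k x - u x) \<in> L2 M" for k using U DL u by (intro L2.diff_in) auto
          have "quad\<^sub>2 (\<lambda>x. U m x - U n x) \<le> 2 * quad\<^sub>2 (\<lambda>x. U m x - u x) + 2 * quad\<^sub>2 (\<lambda>x. U n x - u x)"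
            using L2.quad_diff_le_2[OF L[of m] L[of n]] by simp
          also have "\<dots> < 4 * (e / (8 * \<tau>\<^sub>0))" using n2[of m] n2[of n] mn by simp
          finally have "\<tau>\<^sub>0 * quad\<^sub>2 (\<lambda>x. U m x - U n x) < e / 2" using \<tau>0 by (simp add: field_simps)
          moreover have "quad a (\<lambda>x. U m x - U n x) < e / 4" using n1[of m n] mn by simp
          ultimately have "quad t (\<lambda>x. U m x - U n x) < e" using t_le[OF d, of m n] by linarith
          then show ?thesis using t.nonneg[OF d] by simp
        qed
        then show ?thesis by blast
      qed
      then have *: "u \<in> D" "(\<lambda>n. quad t (\<lambda>x. U n x - u x)) \<longlonglongrightarrow> 0"
        using closed U u lim unfolding closed_form_def by blast+
      have du: "(\<lambda>x. U n x - u x) \<in> D" for n using U *(1) t.diff_in by blast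
      have "(\<lambda>n. quad t (\<lambda>x. U n x - u x) + 1 / 2 * (quad t (\<lambda>x. U n x - u x) + \<tau>\<^sub>0 * quad\<^sub>2 (\<lambda>x. U n x - u x))) \<longlonglongrightarrow> 0 + 1 / 2 * (0 + \<tau>\<^sub>0 * 0)"
        by (intro tendsto_add tendsto_mult tendsto_const *(2) lim2)
      then have bound0: "(\<lambda>n. quad t (\<lambda>x. U n x - u x) + 1 / 2 * (quad t (\<lambda>x. U n x - u x) + \<tau>\<^sub>0 * quad\<^sub>2 (\<lambda>x. U n x - u x))) \<longlonglongrightarrow> 0"
        by simp
      have "\<bar>quad a (\<lambda>x. U n x - u x)\<bar> \<le> quad t (\<lambda>x. U n x - u x) + 1 / 2 * (quad t (\<lambda>x. U n x - u x) + \<tau>\<^sub>0 * quad\<^sub>2 (\<lambda>x. U n x - u x))" for n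
        using half[OF du, of n] a_quad[OF du, of n] t.nonneg[OF du, of n] L2.nonneg[OF NL[OF du], of n] by linarith
      then have "(\<lambda>n. \<bar>quad a (\<lambda>x. U n x - u x)\<bar>) \<longlonglongrightarrow> 0"
        by (rule tendsto_zero_le[of "\<lambda>n. \<bar>quad a (\<lambda>x. U n x - u x)\<bar>", OF abs_ge_zero _ bound0])
      then show "u \<in> D \<and> (\<lambda>n. quad a (\<lambda>x. U n x - u x)) \<longlonglongrightarrow> 0"
        using *(1) by (simp add: tendsto_rabs_zero_iff)
    qed
  qed
  moreover have "eigenvalue_count M (form_operator M D a) (- \<tau>)
      \<le> ennreal (exp (p - 1) * normalized S powr (- p) * \<tau> powr (- \<gamma>) * Vp)" if \<tau>: "0 < \<tau>" for \<tau>
  proof -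
    define S' where "S' = normalized S * \<tau> powr (1 - \<theta>)"
    interpret w: weighted_form D "shift \<tau>" M V p S' unfolding S'_def by (rule WF[OF \<tau>])
    have wN: "w.N = N" by (simp add: w.N_def N_def)
    have wVp: "w.Vp = Vp" by (simp add: w.Vp_def Vp_def)
    interpret s1: psd_form D "shift 1" by (rule psd_shift) simp
    define k where "k = Vp powr (1 / p) / normalized S"
    have k: "quad (L2_inner N) u \<le> k * quad (shift 1) u" if "u \<in> D" for u
      using Nq[OF that, of 1] by (simp add: k_def quad_shift)
    have k0: "0 \<le> k" using normalized_pos[OF S] by (simp add: k_def)
    interpret fb: form_below D a M "shift 1" 1 "2 + 2 * k\<^sup>2" "1/2" "\<tau>\<^sub>0 / 2 + 1/2" \<tau> "exp (p - 1) * (S' powr (- p) * Vp)"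
    proof (intro form_below.intro form_below_axioms.intro)
      show "herm_form D a" by (rule a.herm_form_axioms)
      show "D \<subseteq> L2 M" by (rule D_L2)
      show "psd_form D (shift 1)" by (rule s1.psd_form_axioms)
      show "s1.form_complete" by (rule complete_shift) simp
      show "quad\<^sub>2 u \<le> 1 * quad (shift 1) u" if "u \<in> D" for u
        using t.nonneg[OF that] by (simp add: quad_shift)
      show "(cmod (a u v))\<^sup>2 \<le> (2 + 2 * k\<^sup>2) * (quad (shift 1) u * quad (shift 1) v)" if uv: "u \<in> D" "v \<in> D" for u v
      proof -
        have nn: "0 \<le> quad (shift 1) u" "0 \<le> quad (shift 1) v" using s1.nonneg uv by auto
        have tl: "quad t u \<le> quad (shift 1) u" "quad t v \<le> quad (shift 1) v"
          using L2.nonneg DL uv by (auto simp: quad_shift)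
        have "(cmod (a u v))\<^sup>2 \<le> 2 * (cmod (t u v))\<^sup>2 + 2 * (cmod (L2_inner N u v))\<^sup>2"
          using cmod_comb_squared[of 1 "t u v" "-1" "L2_inner N u v"] by (simp add: a_eq[OF uv])
        also have "\<dots> \<le> 2 * (quad t u * quad t v) + 2 * (quad (L2_inner N) u * quad (L2_inner N) v)"
          using t.cauchy_schwarz[OF uv] L2.cauchy_schwarz[OF NL[OF uv(1)] NL[OF uv(2)]] by simp
        also have "\<dots> \<le> 2 * (quad (shift 1) u * quad (shift 1) v) + 2 * ((k * quad (shift 1) u) * (k * quad (shift 1) v))"
          using tl k uv nn k0 t.nonneg L2.nonneg[OF NL[OF uv(1)]] L2.nonneg[OF NL[OF uv(2)]]
          by (intro add_mono mult_left_mono mult_mono) auto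
        also have "\<dots> = (2 + 2 * k\<^sup>2) * (quad (shift 1) u * quad (shift 1) v)"
          by (simp add: power2_eq_square algebra_simps)
        finally show ?thesis .
      qed
      show "1/2 * quad (shift 1) u \<le> quad a u + (\<tau>\<^sub>0 / 2 + 1/2) * quad\<^sub>2 u" if "u \<in> D" for u
        using t_le[OF that] by (simp add: quad_shift algebra_simps)
      show "a u v = 0" if "u \<in> D" "v \<in> D" "AE x in M. u x = 0" for u v
      proof -
        have "form_minus M t V u v = t u v - (\<integral>x. 0 \<partial>M)"
          unfolding form_minus_def using that D_meas V(1)
          by (intro arg_cong2[where f = "(-)"] refl integral_cong_AE) (auto elim!: eventually_mono)
        then show ?thesis using t_null[OF that] by (simp add: a_def)
      qed
      fix n :: nat and g
      assume g: "\<And>i. i < n \<Longrightarrow> g i \<in> D"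
        and neg: "\<And>c. \<exists>i<n. c i \<noteq> 0 \<Longrightarrow> quad a (\<lambda>x. \<Sum>i<n. c i * g i x) + \<tau> * quad\<^sub>2 (\<lambda>x. \<Sum>i<n. c i * g i x) < 0"
      have comb: "(\<lambda>x. \<Sum>i<n. c i * g i x) \<in> D" for c using g by (intro t.sum_in) auto
      have less: "quad (shift \<tau>) (\<lambda>x. \<Sum>i<n. c i * g i x) < quad (L2_inner N) (\<lambda>x. \<Sum>i<n. c i * g i x)"
        if "\<exists>i<n. c i \<noteq> 0" for c
        using neg[OF that] a_quad[OF comb] by (simp add: quad_shift)
      \<comment> \<open>\<open>V[u] > t[u] + \<tau> \<parallel>u\<parallel>\<^sup>2\<close> on the span, so it has an orthonormal basis in \<open>L\<^sup>2(V)\<close> with form values at most one\<close>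
      have "\<exists>b. psd_form.orthonormal (L2 N) (L2_inner N) (\<lambda>i x. \<Sum>k\<in>{..<n}. b i k * g k x) {..<n}"
      proof (rule L2.gram_schmidt)
        fix c assume "\<exists>i\<in>{..<n}. c i \<noteq> (0::complex)"
        then have "\<exists>i<n. c i \<noteq> 0" by auto
        then show "0 < quad (L2_inner N) (\<lambda>x. \<Sum>i\<in>{..<n}. c i * g i x)"
          using le_less_trans[OF w.nonneg[OF comb[of c]] less] by blast
      qed (use g NL in auto)
      then obtain b where b: "psd_form.orthonormal (L2 N) (L2_inner N) (\<lambda>i x. \<Sum>k<n. b i k * g k x) {..<n}" by blast
      have "real (card {..<n}) \<le> exp (p - 1) * (S' powr (- p) * w.Vp)"
      proof (rule w.orthonormal_card_bound[unfolded wN, OF b])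
        show "(\<lambda>x. \<Sum>k<n. b i k * g k x) \<in> D" for i by (rule comb)
        fix i assume i: "i \<in> {..<n}"
        have one: "quad (L2_inner N) (\<lambda>x. \<Sum>k<n. b i k * g k x) = 1"
          using b i by (simp add: L2.orthonormal_def quad_def)
        have "\<exists>k<n. b i k \<noteq> 0"
        proof (rule ccontr)
          assume "\<not> ?thesis"
          then have "(\<lambda>x. \<Sum>k<n. b i k * g k x) = (\<lambda>x. 0)" by auto
          then show False using one L2.quad_zero[of N] by simp
        qed
        then show "quad (shift \<tau>) (\<lambda>x. \<Sum>k<n. b i k * g k x) \<le> 1" using less[of "b i"] one by simp
      qed
      then show "real n \<le> exp (p - 1) * (S' powr (- p) * Vp)" by (simp add: wVp)
    qed simp
    have "S' powr (- p) = normalized S powr (- p) * \<tau> powr (- \<gamma>)"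
    proof -
      have "\<gamma> / p * - p = - \<gamma>" using p(1) by simp
      then show ?thesis by (simp only: S'_def powr_mult powr_powr one_minus_\<theta>)
    qed
    then show ?thesis using fb.eigenvalue_count_bound by (simp add: mult.assoc)
  qed
  ultimately show "form_sum_exists M D t V \<and> (\<forall>\<tau>>0. eigenvalue_count M (form_operator M D (form_minus M t V)) (- \<tau>)
      \<le> ennreal (exp (p - 1) * normalized S powr (- p) * \<tau> powr (- \<gamma>) * (\<integral>x. V x powr p \<partial>M)))"
    by (simp add: a_def Vp_def)
qed

end

section \<open>From the bound on eigenvalues to the Sobolev inequality\<close>

lemma ae_dim_ge_1:
  assumes "u \<in> E" "\<not> (AE x in M. u x = 0)"
  shows "1 \<le> ae_dim M E"
proof -
  have "ae_independent M {u}" using assms(2) by (auto simp: ae_independent_def elim: eventually_mono)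
  then have "of_nat (card {u}) \<in> {of_nat (card F) | F. finite F \<and> F \<subseteq> E \<and> ae_independent M F}"
    using assms(1) by (intro CollectI exI[of _ "{u}"]) auto
  then have "of_nat (card {u}) \<le> ae_dim M E" unfolding ae_dim_def by (rule Sup_upper)
  then show ?thesis by simp
qed

lemma eigenvalue_count_ge_1:
  assumes "l < b" "complex_of_real l \<notin> resolvent_set M A"
  shows "1 \<le> eigenvalue_count M A b"
proof (cases "\<exists>l<b. complex_of_real l \<notin> resolvent_set M A \<and> \<not> is_eigenvalue M A (complex_of_real l)")
  case True
  then show ?thesis by (simp add: eigenvalue_count_def)
next
  case False
  then have "is_eigenvalue M A (complex_of_real l)" using assms by blast
  then have "1 \<le> ae_dim M (eigenspace A (complex_of_real l))"
    unfolding is_eigenvalue_def using ae_dim_ge_1 by blast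
  also have "\<dots> = (\<Sum>l\<in>{l}. ae_dim M (eigenspace A (complex_of_real l)))" by simp
  also have "\<dots> \<le> (SUP F\<in>{F. finite F \<and> F \<subseteq> {..<b}}. \<Sum>l\<in>F. ae_dim M (eigenspace A (complex_of_real l)))"
    using assms(1) by (intro SUP_upper) auto
  also have "\<dots> = (\<Sum>\<^sub>\<infinity>l\<in>{..<b}. ae_dim M (eigenspace A (complex_of_real l)))"
    by (rule nonneg_infsum_complete[symmetric]) simp
  finally show ?thesis using False by (simp add: eigenvalue_count_def)
qed

text \<open>
  The infimum of the Rayleigh quotient belongs to the spectrum: for \<open>m\<close> in the resolvent set with
  \<open>\<parallel>(A - m)\<^sup>-\<^sup>1\<parallel> \<le> C\<close>, the form would be bounded below by \<open>m + 1/C\<close>.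
\<close>

lemma rayleigh_infimum_not_resolvent:
  fixes D :: "('a \<Rightarrow> complex) set"
  assumes "herm_form D a" and D_L2: "D \<subseteq> L2 M"
    and below: "\<And>u. u \<in> D \<Longrightarrow> m * quad (L2_inner M) u \<le> quad a u"
    and sharp: "\<And>e. 0 < e \<Longrightarrow> \<exists>u\<in>D. quad a u < (m + e) * quad (L2_inner M) u"
  shows "complex_of_real m \<notin> resolvent_set M (form_operator M D a)"
proof
  interpret herm_form D a by fact
  let ?q = "quad (L2_inner M)"
  assume "complex_of_real m \<in> resolvent_set M (form_operator M D a)"
  then obtain C where surj: "\<And>g. g \<in> L2 M \<Longrightarrow> \<exists>(u, f)\<in>form_operator M D a. AE x in M. f x - of_real m * u x = g x"
    and C: "\<forall>(u, f)\<in>form_operator M D a. L2_norm M u \<le> C * L2_norm M (\<lambda>x. f x - of_real m * u x)"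
    unfolding resolvent_set_def by auto
  have DL: "u \<in> L2 M" if "u \<in> D" for u using that D_L2 by blast
  define b where "b u v = a u v - of_real m * L2_inner M u v" for u v
  have quad_b: "quad b u = quad a u - m * ?q u" for u by (simp add: quad_def b_def)
  interpret b: herm_form D b
    using herm_form_add_scaled[OF herm_form_axioms L2.herm_form_axioms D_L2, of "- m"]
    unfolding b_def[abs_def] by simp
  interpret b: psd_form D b
    using below by unfold_locales (simp add: quad_b)
  define C' where "C' = \<bar>C\<bar> + 1"
  have C': "0 < C'" by (simp add: C'_def)
  have low: "?q u \<le> C' * quad b u" if u: "u \<in> D" for u
  proof (cases "?q u = 0")
    case True
    then show ?thesis using b.nonneg[OF u] C' by simp
  next
    case False
    then have pos: "0 < ?q u" using L2.nonneg[OF DL[OF u]] by simp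
    obtain w f where wf: "(w, f) \<in> form_operator M D a" and ae: "AE x in M. f x - of_real m * w x = u x"
      using surj[OF DL[OF u]] by blast
    have w: "w \<in> D" "f \<in> L2 M" "\<And>v. v \<in> D \<Longrightarrow> a w v = L2_inner M f v"
      using wf by (auto simp: form_operator_def)
    define g where "g = (\<lambda>x. f x - of_real m * w x)"
    have gL: "g \<in> L2 M" unfolding g_def using w DL by (intro L2.diff_in L2.scale_in) auto
    have g_inner: "L2_inner M g v = L2_inner M u v" if "v \<in> D" for v
      unfolding L2_inner_def using ae gL DL[OF u] DL[OF that]
      by (intro integral_cong_AE) (auto simp: g_def dest!: L2_measurable elim!: eventually_mono)
    have qg: "?q g = ?q u"
      unfolding quad_L2 using ae gL DL[OF u]
      by (intro integral_cong_AE) (auto simp: g_def dest!: L2_measurable elim!: eventually_mono)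
    have b_w: "b w v = L2_inner M u v" if v: "v \<in> D" for v
    proof -
      have "L2_inner M g v = L2_inner M f v - of_real m * L2_inner M w v"
        unfolding g_def using w DL v by (simp add: L2.diff_left L2.scale_in L2.scale_left)
      then show ?thesis using g_inner[OF v] w(3)[OF v] by (simp add: b_def)
    qed
    have "L2_norm M w \<le> C * L2_norm M g" using C wf by (auto simp: g_def)
    also have "\<dots> \<le> C' * L2_norm M g"
      unfolding L2_norm_sqrt C'_def using L2.nonneg[OF gL] by (intro mult_right_mono) auto
    finally have norm_w: "sqrt (?q w) \<le> C' * sqrt (?q u)" by (simp add: L2_norm_sqrt qg)
    have "quad b w = Re (L2_inner M u w)" using b_w[OF w(1)] by (simp add: quad_def)
    also have "\<dots> \<le> cmod (L2_inner M u w)" by (rule complex_Re_le_cmod)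
    also have "\<dots> \<le> sqrt (?q u) * sqrt (?q w)" using DL u w by (intro L2.cauchy_schwarz_sqrt) auto
    also have "\<dots> \<le> sqrt (?q u) * (C' * sqrt (?q u))" using norm_w pos by (intro mult_left_mono) auto
    also have "\<dots> = C' * ?q u" using pos by simp
    finally have bw: "quad b w \<le> C' * ?q u" .
    have "?q u * ?q u = (cmod (b w u))\<^sup>2"
      using b_w[OF u] L2.self[OF DL[OF u]] by (simp add: power2_eq_square norm_mult)
    also have "\<dots> \<le> quad b w * quad b u" using w u by (intro b.cauchy_schwarz)
    also have "\<dots> \<le> (C' * ?q u) * quad b u" using bw b.nonneg[OF u] by (intro mult_right_mono)
    finally have "?q u * ?q u \<le> ?q u * (C' * quad b u)" by (simp add: mult_ac)
    then show ?thesis using pos by (simp only: mult_le_cancel_left_pos)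
  qed
  obtain u where u: "u \<in> D" "quad a u < (m + 1 / C') * ?q u" using sharp[of "1 / C'"] C' by auto
  then have "C' * quad b u < ?q u" using C' by (simp add: quad_b field_simps)
  then show False using low[OF u(1)] by simp
qed

lemma eigenvalue_below:
  fixes D :: "('a \<Rightarrow> complex) set"
  assumes a: "herm_form D a" and D_L2: "D \<subseteq> L2 M" and semi: "semibounded_form M D a"
    and null: "\<And>u. u \<in> D \<Longrightarrow> AE x in M. u x = 0 \<Longrightarrow> quad a u = 0"
    and u: "u \<in> D" "quad a u < - \<tau> * quad (L2_inner M) u"
  shows "1 \<le> eigenvalue_count M (form_operator M D a) (- \<tau>)"
proof -
  let ?q = "quad (L2_inner M)"
  have DL: "u \<in> L2 M" if "u \<in> D" for u using that D_L2 by blast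
  obtain c where c: "\<And>u. u \<in> D \<Longrightarrow> - c * ?q u \<le> quad a u"
    using semi unfolding semibounded_form_def L2_norm_squared by blast
  have q0: "quad a u = 0" if "u \<in> D" "?q u = 0" for u
    using null[OF that(1)] L2_null_AE[OF DL[OF that(1)] that(2)] by blast
  define Q where "Q = {quad a u / ?q u | u. u \<in> D \<and> 0 < ?q u}"
  define m where "m = Inf Q"
  have upos: "0 < ?q u" using q0[OF u(1)] u(2) L2.nonneg[OF DL[OF u(1)]] by (cases "?q u = 0") auto
  have uQ: "quad a u / ?q u \<in> Q" using u(1) upos by (auto simp: Q_def)
  have bddQ: "bdd_below Q"
  proof (rule bdd_belowI)
    fix r assume "r \<in> Q"
    then show "- c \<le> r" using c by (auto simp: Q_def field_simps)
  qed
  have "m \<le> quad a u / ?q u" unfolding m_def using uQ bddQ by (rule cInf_lower)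
  also have "\<dots> < - \<tau>" using u(2) upos by (simp add: field_simps)
  finally have m: "m < - \<tau>" .
  have "complex_of_real m \<notin> resolvent_set M (form_operator M D a)"
  proof (rule rayleigh_infimum_not_resolvent[OF a D_L2])
    fix v assume v: "v \<in> D"
    show "m * ?q v \<le> quad a v"
    proof (cases "?q v = 0")
      case True
      then show ?thesis using q0[OF v] by simp
    next
      case False
      then have pos: "0 < ?q v" using L2.nonneg[OF DL[OF v]] by simp
      then have "m \<le> quad a v / ?q v" unfolding m_def using v by (intro cInf_lower[OF _ bddQ]) (auto simp: Q_def)
      then show ?thesis using pos by (simp add: field_simps)
    qed
  next
    fix e :: real assume "0 < e"
    then have "Inf Q < m + e" by (simp add: m_def)
    then obtain r where "r \<in> Q" "r < m + e" using cInf_less_iff[OF _ bddQ] uQ by blast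
    then obtain v where "v \<in> D" "0 < ?q v" "quad a v / ?q v < m + e" by (auto simp: Q_def)
    then show "\<exists>v\<in>D. quad a v < (m + e) * ?q v" by (auto simp: field_simps intro!: bexI[of _ v])
  qed
  then show ?thesis using m by (intro eigenvalue_count_ge_1)
qed

context exponents
begin

lemma p_q: "p * (q - 2) = q"
  using p(1) by (simp add: q field_simps)

lemma normalized_eq: "normalized S = normalized 1 * S"
  by (simp add: normalized_def)

text \<open>
  The converse of \<open>weighted_am_gm\<close>. If \<open>x\<close> or \<open>y\<close> vanishes, the infimum over \<open>\<tau>\<close> is zero, but is not
  attained.
\<close>

lemma optimize_shift:
  assumes nn: "0 \<le> x" "0 \<le> y" and le: "\<And>\<tau>. 0 < \<tau> \<Longrightarrow> X * \<tau> powr (1 - \<theta>) \<le> x + \<tau> * y"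
  shows "X \<le> normalized 1 * (x powr \<theta> * y powr (1 - \<theta>))"
proof -
  consider "X \<le> 0" | "0 < X" "y = 0" | "0 < X" "x = 0" "0 < y" | "0 < x" "0 < y"
    using nn by linarith
  then show ?thesis
  proof cases
    case 1
    have "0 \<le> normalized 1 * (x powr \<theta> * y powr (1 - \<theta>))" using normalized_pos[of 1] by simp
    then show ?thesis using 1 by linarith
  next
    case 2
    define \<tau> where "\<tau> = ((2 * x + 1) / X) powr (1 / (1 - \<theta>))"
    have "0 < \<tau>" using 2 nn by (simp add: \<tau>_def)
    moreover have "X * \<tau> powr (1 - \<theta>) = 2 * x + 1"
      using 2 nn \<theta>_bounds by (simp add: \<tau>_def powr_powr)
    ultimately show ?thesis using le[of \<tau>] 2 nn by simp
  next
    case 3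
    define \<tau> where "\<tau> = (X / (2 * y)) powr (1 / \<theta>)"
    have \<tau>: "0 < \<tau>" using 3 by (simp add: \<tau>_def)
    have \<tau>\<theta>: "\<tau> powr \<theta> = X / (2 * y)" using 3 \<theta>_bounds by (simp add: \<tau>_def powr_powr)
    have "X * \<tau> powr (1 - \<theta>) \<le> (\<tau> powr (1 - \<theta>) * \<tau> powr \<theta>) * y"
      using le[OF \<tau>] \<tau> 3 by (simp flip: powr_add)
    also have "\<dots> = (X / 2) * \<tau> powr (1 - \<theta>)" using 3 by (simp add: \<tau>\<theta>)
    finally show ?thesis using 3 \<tau> by simp
  next
    case 4
    define \<tau> where "\<tau> = (1 - \<theta>) * x / (\<theta> * y)"
    have \<tau>: "0 < \<tau>" using 4 \<theta>_bounds by (simp add: \<tau>_def)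
    have eq: "x + \<tau> * y = x / \<theta>" using 4 \<theta>_bounds by (simp add: \<tau>_def field_simps)
    have \<tau>_pos: "0 < \<tau> powr (1 - \<theta>)" using \<tau> by simp
    have "X \<le> (x / \<theta>) / \<tau> powr (1 - \<theta>)" using le[OF \<tau>] by (simp only: eq pos_le_divide_eq[OF \<tau>_pos])
    also have "\<dots> = normalized 1 * (x powr \<theta> * y powr (1 - \<theta>))"
    proof -
      have num: "x / \<theta> = (x powr \<theta> * x powr (1 - \<theta>)) / (\<theta> powr \<theta> * \<theta> powr (1 - \<theta>))"
        using \<theta>_bounds 4 by (simp flip: powr_add)
      have den: "\<tau> powr (1 - \<theta>) = (1 - \<theta>) powr (1 - \<theta>) * x powr (1 - \<theta>) / (\<theta> powr (1 - \<theta>) * y powr (1 - \<theta>))"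
        using 4 \<theta>_bounds by (simp add: \<tau>_def powr_divide powr_mult)
      have "(x powr \<theta> * x powr (1 - \<theta>)) / (\<theta> powr \<theta> * \<theta> powr (1 - \<theta>)) /
          ((1 - \<theta>) powr (1 - \<theta>) * x powr (1 - \<theta>) / (\<theta> powr (1 - \<theta>) * y powr (1 - \<theta>)))
          = x powr \<theta> * y powr (1 - \<theta>) / (\<theta> powr \<theta> * (1 - \<theta>) powr (1 - \<theta>))"
        using 4 \<theta>_bounds by (simp add: field_simps)
      also have "\<dots> = normalized 1 * (x powr \<theta> * y powr (1 - \<theta>))"
      proof -
        have "(1 - \<theta>) powr (- 1 + \<theta>) = inverse ((1 - \<theta>) powr (1 - \<theta>))" by (simp flip: powr_minus)
        then show ?thesis by (simp add: normalized_def powr_minus field_simps)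
      qed
      finally show ?thesis unfolding num den .
    qed
    finally show ?thesis .
  qed
qed

end

context form_with_exponents
begin

text \<open>If the bound on the number of eigenvalues is less than one, there are none.\<close>

lemma weak_LT_lower_bound:
  assumes LT: "weak_LT M D t \<gamma> \<kappa> L" and \<tau>: "0 < \<tau>"
    and V: "V \<in> borel_measurable M" "AE x in M. 0 \<le> V x" "integrable M (\<lambda>x. V x powr p)"
    and small: "L * \<tau> powr (- \<gamma>) * (\<integral>x. V x powr p \<partial>M) < 1"
    and u: "u \<in> D"
  shows "integrable M (\<lambda>x. V x * (cmod (u x))\<^sup>2)"
    "(\<integral>x. V x * (cmod (u x))\<^sup>2 \<partial>M) \<le> quad t u + \<tau> * quad\<^sub>2 u"
proof -
  define a where "a = form_minus M t V"
  have fs: "form_sum_exists M D t V"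
    and count: "eigenvalue_count M (form_operator M D a) (- \<tau>) \<le> ennreal (L * \<tau> powr (- \<gamma>) * (\<integral>x. V x powr p \<partial>M))"
    using LT V \<tau> unfolding weak_LT_def p(2)[symmetric] a_def by auto
  have int: "integrable M (\<lambda>x. V x * (cmod (u x))\<^sup>2)" if "u \<in> D" for u
    using fs that by (simp add: form_sum_exists_def)
  then show "integrable M (\<lambda>x. V x * (cmod (u x))\<^sup>2)" using u by blast
  have a_quad: "quad a u = quad t u - (\<integral>x. V x * (cmod (u x))\<^sup>2 \<partial>M)" for u
  proof -
    have "(\<integral>x. of_real (V x) * u x * cnj (u x) \<partial>M) = (\<integral>x. complex_of_real (V x * (cmod (u x))\<^sup>2) \<partial>M)"
      by (simp add: mult.assoc complex_norm_square del: of_real_power)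
    then show ?thesis by (simp add: a_def form_minus_def quad_def del: of_real_mult)
  qed
  define N where "N = density M (\<lambda>x. ennreal (V x))"
  have NL: "u \<in> L2 N" if "u \<in> D" for u
  proof -
    have [measurable]: "u \<in> borel_measurable M" using that by (rule D_meas)
    show ?thesis using int[OF that] V(1,2) unfolding L2_def N_def by (simp add: integrable_density)
  qed
  have herm: "herm_form D a"
    unfolding a_def using NL by (intro herm_form_minus V) (simp add: N_def)
  show "(\<integral>x. V x * (cmod (u x))\<^sup>2 \<partial>M) \<le> quad t u + \<tau> * quad\<^sub>2 u"
  proof (rule ccontr)
    assume "\<not> ?thesis"
    then have neg: "quad a u < - \<tau> * quad\<^sub>2 u" by (simp add: a_quad)
    have "1 \<le> eigenvalue_count M (form_operator M D a) (- \<tau>)"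
    proof (rule eigenvalue_below[OF herm D_L2 _ _ u neg])
      show "semibounded_form M D a" using fs by (simp add: form_sum_exists_def a_def)
      show "quad a v = 0" if v: "v \<in> D" "AE x in M. v x = 0" for v
      proof -
        have "(\<integral>x. V x * (cmod (v x))\<^sup>2 \<partial>M) = 0"
          using v(2) by (intro integral_eq_zero_AE) (auto elim: eventually_mono)
        then show ?thesis using t_null[OF v(1) v(1) v(2)] by (simp add: a_quad) (simp add: quad_def)
      qed
    qed
    also have "\<dots> \<le> ennreal (L * \<tau> powr (- \<gamma>) * (\<integral>x. V x powr p \<partial>M))" by (rule count)
    also have "\<dots> < 1" using small by (simp add: ennreal_less_one_iff)
    finally show False by simp
  qed
qed

text \<open>The test potential is a multiple of \<open>\<bar>u\<bar>\<^bsup>q-2\<^esup>\<close>, truncated to be integrable.\<close>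

lemma truncated_bound:
  assumes LT: "weak_LT M D t \<gamma> \<kappa> L" and L: "0 < L" and u: "u \<in> D" and k: "0 < k"
  shows "integrable M (\<lambda>x. min (cmod (u x)) k powr q)"
    "L powr (- 1 / p) * (\<integral>x. min (cmod (u x)) k powr q \<partial>M) powr (2 / q)
       \<le> normalized 1 * (quad t u powr \<theta> * quad\<^sub>2 u powr (1 - \<theta>))"
proof -
  have [measurable]: "u \<in> borel_measurable M" using u by (rule D_meas)
  define w where "w x = min (cmod (u x)) k" for x
  have [measurable]: "w \<in> borel_measurable M" unfolding w_def by measurable
  have w: "0 \<le> w x" "w x \<le> cmod (u x)" "w x \<le> k" for x using k by (auto simp: w_def)
  have w_split: "w x powr q = w x powr (q - 2) * (w x)\<^sup>2" for x
  proof (cases "w x = 0")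
    case False
    then have "0 < w x" using w(1)[of x] by simp
    have "w x powr (q - 2) * w x powr 2 = w x powr (q - 2 + 2)" by (rule powr_add[symmetric])
    then show ?thesis using \<open>0 < w x\<close> by simp
  qed simp
  have int_w: "integrable M (\<lambda>x. w x powr q)"
  proof (rule Bochner_Integration.integrable_bound)
    show "integrable M (\<lambda>x. k powr (q - 2) * (cmod (u x))\<^sup>2)" using L2_integrable[OF DL[OF u]] by simp
    show "AE x in M. norm (w x powr q) \<le> norm (k powr (q - 2) * (cmod (u x))\<^sup>2)"
    proof (intro always_eventually allI)
      fix x
      have "w x powr (q - 2) * (w x)\<^sup>2 \<le> k powr (q - 2) * (cmod (u x))\<^sup>2"
        using w[of x] q_gt_2 by (intro mult_mono powr_mono2 power_mono) auto
      then show "norm (w x powr q) \<le> norm (k powr (q - 2) * (cmod (u x))\<^sup>2)" by (simp add: w_split)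
    qed
  qed measurable
  then show "integrable M (\<lambda>x. min (cmod (u x)) k powr q)" by (simp add: w_def)
  define I where "I = (\<integral>x. w x powr q \<partial>M)"
  have I0: "0 \<le> I" by (simp add: I_def)
  have "L powr (- 1 / p) * I powr (2 / q) \<le> normalized 1 * (quad t u powr \<theta> * quad\<^sub>2 u powr (1 - \<theta>))"
  proof (rule optimize_shift)
    show "0 \<le> quad t u" "0 \<le> quad\<^sub>2 u" using t.nonneg[OF u] L2.nonneg[OF DL[OF u]] by auto
    fix \<tau> :: real assume \<tau>: "0 < \<tau>"
    show "L powr (- 1 / p) * I powr (2 / q) * \<tau> powr (1 - \<theta>) \<le> quad t u + \<tau> * quad\<^sub>2 u"
    proof (cases "I = 0")
      case True
      then show ?thesis using t.nonneg[OF u] L2.nonneg[OF DL[OF u]] \<tau> by simp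
    next
      case False
      then have Ipos: "0 < I" using I0 by simp
      define c where "c = (\<tau> powr \<gamma> / (L * I)) powr (1 / p)"
      have c: "0 < c" using \<tau> L Ipos by (simp add: c_def)
      have cp: "c powr p = \<tau> powr \<gamma> / (L * I)" using \<tau> L Ipos p(1) by (simp add: c_def powr_powr)
      \<comment> \<open>for \<open>z = 1\<close> the bound on the number of eigenvalues would be exactly one\<close>
      have "z * (c * I) \<le> quad t u + \<tau> * quad\<^sub>2 u" if z: "0 < z" "z < 1" for z
      proof -
        define V where "V x = z * c * w x powr (q - 2)" for x
        have Vm: "V \<in> borel_measurable M" unfolding V_def by measurable
        have V0: "AE x in M. 0 \<le> V x" using z c by (simp add: V_def)
        have Vp: "V x powr p = (z powr p * c powr p) * w x powr q" for x
          using z c p_q by (simp add: V_def powr_mult powr_powr mult.commute)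
        have Vint: "integrable M (\<lambda>x. V x powr p)" unfolding Vp using int_w by simp
        have "(\<integral>x. V x powr p \<partial>M) = (z powr p * c powr p) * I" unfolding Vp I_def by simp
        then have "L * \<tau> powr (- \<gamma>) * (\<integral>x. V x powr p \<partial>M) = z powr p"
          using \<tau> L Ipos by (simp add: cp powr_minus field_simps)
        moreover have "z powr p < 1" using powr_less_mono2[of p z 1] z p(1) by simp
        ultimately have small: "L * \<tau> powr (- \<gamma>) * (\<integral>x. V x powr p \<partial>M) < 1" by simp
        note VL = weak_LT_lower_bound[OF LT \<tau> Vm V0 Vint small u]
        have "z * (c * I) = (\<integral>x. (z * c) * w x powr q \<partial>M)" by (simp add: I_def)
        also have "\<dots> \<le> (\<integral>x. V x * (cmod (u x))\<^sup>2 \<partial>M)"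
        proof (rule integral_mono)
          show "integrable M (\<lambda>x. (z * c) * w x powr q)" using int_w by simp
          show "integrable M (\<lambda>x. V x * (cmod (u x))\<^sup>2)" by (rule VL(1))
          show "(z * c) * w x powr q \<le> V x * (cmod (u x))\<^sup>2" for x
          proof -
            have "(z * c * w x powr (q - 2)) * (w x)\<^sup>2 \<le> (z * c * w x powr (q - 2)) * (cmod (u x))\<^sup>2"
              using w[of x] z c by (intro mult_left_mono power_mono) auto
            then show ?thesis by (simp add: V_def w_split mult.assoc)
          qed
        qed
        also have "\<dots> \<le> quad t u + \<tau> * quad\<^sub>2 u" by (rule VL(2))
        finally show ?thesis .
      qed
      then have "c * I \<le> quad t u + \<tau> * quad\<^sub>2 u" by (rule field_le_mult_one_interval)
      moreover have "c * I = L powr (- 1 / p) * I powr (2 / q) * \<tau> powr (1 - \<theta>)"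
      proof -
        have "1 / p + 2 / q = 1" using p(1) by (simp add: two_over_q field_simps)
        then have I_eq: "I powr (1 / p) * I powr (2 / q) = I" using Ipos by (simp flip: powr_add)
        have c_eq: "c = \<tau> powr (1 - \<theta>) / (L powr (1 / p) * I powr (1 / p))"
          using \<tau> L Ipos by (simp add: c_def powr_divide powr_mult powr_powr one_minus_\<theta>)
        have "c * (I powr (1 / p) * I powr (2 / q)) = L powr (- 1 / p) * I powr (2 / q) * \<tau> powr (1 - \<theta>)"
          unfolding c_eq using L Ipos by (simp add: powr_minus field_simps)
        then show ?thesis by (simp only: I_eq)
      qed
      ultimately show ?thesis by simp
    qed
  qed
  then show "L powr (- 1 / p) * (\<integral>x. min (cmod (u x)) k powr q \<partial>M) powr (2 / q)
       \<le> normalized 1 * (quad t u powr \<theta> * quad\<^sub>2 u powr (1 - \<theta>))"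
    by (simp add: I_def w_def)
qed

theorem weak_LT_imp_sobolev:
  assumes LT: "weak_LT M D t \<gamma> \<kappa> L" and L: "0 < L" and S: "normalized S = L powr (- 1 / p)"
  shows "sobolev_interp M D t q \<theta> S"
  unfolding sobolev_interp_def
proof (intro ballI)
  fix u assume u: "u \<in> D"
  have [measurable]: "u \<in> borel_measurable M" using u by (rule D_meas)
  define Y where "Y = normalized 1 * (quad t u powr \<theta> * quad\<^sub>2 u powr (1 - \<theta>))"
  have n1: "0 < normalized 1" by (rule normalized_pos) simp
  define f where "f k x = min (cmod (u x)) (real (Suc k)) powr q" for k x
  have int: "integrable M (f k)" and le: "L powr (- 1 / p) * (\<integral>x. f k x \<partial>M) powr (2 / q) \<le> Y" for k
    using truncated_bound[OF LT L u, of "real (Suc k)"] unfolding f_def Y_def by auto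
  have mono: "f j x \<le> f k x" if "j \<le> k" for j k x
    unfolding f_def using that q_gt_2 by (intro powr_mono2) auto
  have "(\<integral>x. f k x \<partial>M) \<le> (Y / L powr (- 1 / p)) powr (q / 2)" for k
  proof -
    have "(\<integral>x. f k x \<partial>M) powr (2 / q) \<le> Y / L powr (- 1 / p)" using le[of k] L by (simp add: field_simps)
    then have "((\<integral>x. f k x \<partial>M) powr (2 / q)) powr (q / 2) \<le> (Y / L powr (- 1 / p)) powr (q / 2)"
      using q_gt_2 by (intro powr_mono2) auto
    moreover have "0 \<le> (\<integral>x. f k x \<partial>M)" by (simp add: f_def)
    ultimately show ?thesis using q_gt_2 by (simp add: powr_powr)
  qed
  moreover have "incseq (\<lambda>k. \<integral>x. f k x \<partial>M)"
    using mono int by (intro incseq_SucI integral_mono) auto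
  ultimately obtain I where I: "(\<lambda>k. \<integral>x. f k x \<partial>M) \<longlonglongrightarrow> I"
    by (metis incseq_convergent)
  have lim: "AE x in M. (\<lambda>k. f k x) \<longlonglongrightarrow> cmod (u x) powr q"
  proof (intro always_eventually allI)
    fix x
    obtain k0 where k0: "cmod (u x) \<le> real k0" using real_arch_simple by blast
    have "\<forall>\<^sub>F k in sequentially. f k x = cmod (u x) powr q"
      using eventually_ge_at_top[of k0]
    proof eventually_elim
      case (elim k)
      then have "cmod (u x) \<le> real (Suc k)" using k0 by (simp add: order_trans)
      then show ?case by (simp add: f_def)
    qed
    then show "(\<lambda>k. f k x) \<longlonglongrightarrow> cmod (u x) powr q" by (rule tendsto_eventually)
  qed
  have mc: "AE x in M. mono (\<lambda>k. f k x)" using mono by (auto simp: mono_def)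
  have ms: "(\<lambda>x. cmod (u x) powr q) \<in> borel_measurable M" by measurable
  have int_u: "integrable M (\<lambda>x. cmod (u x) powr q)"
    by (rule integrable_monotone_convergence[OF int mc lim I ms])
  have I_eq: "(\<integral>x. cmod (u x) powr q \<partial>M) = I"
    by (rule integral_monotone_convergence[OF int mc lim I ms])
  have I0: "0 \<le> I" unfolding I_eq[symmetric] by simp
  have "(\<lambda>k. L powr (- 1 / p) * (\<integral>x. f k x \<partial>M) powr (2 / q)) \<longlonglongrightarrow> L powr (- 1 / p) * I powr (2 / q)"
    using I q_gt_2 by (intro tendsto_mult tendsto_const tendsto_powr') (auto simp: f_def)
  then have "L powr (- 1 / p) * I powr (2 / q) \<le> Y"
    by (rule LIMSEQ_le_const2) (use le in auto)
  then have "normalized 1 * (S * I powr (2 / q)) \<le> normalized 1 * (quad t u powr \<theta> * quad\<^sub>2 u powr (1 - \<theta>))"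
    unfolding Y_def S[symmetric] normalized_eq[of S] by (simp add: mult.assoc)
  then have "S * I powr (2 / q) \<le> quad t u powr \<theta> * quad\<^sub>2 u powr (1 - \<theta>)"
    using n1 by (simp only: mult_le_cancel_left_pos)
  then show "integrable M (\<lambda>x. cmod (u x) powr q) \<and>
     S * (\<integral>x. cmod (u x) powr q \<partial>M) powr (2 / q) \<le> quad t u powr \<theta> * L2_norm M u powr (2 * (1 - \<theta>))"
    using int_u by (simp only: I_eq L2_norm_powr[OF u])
qed

end

section \<open>Sharp constants\<close>

context markov_form
begin

text \<open>
  This excludes that every \<open>S\<close> is admissible in the interpolation inequality.
\<close>

lemma exists_nonnull:
  assumes "sigma_finite_measure M" "dense_in_L2 M D" "emeasure M (space M) \<noteq> 0"
  shows "\<exists>u\<in>D. \<not> (AE x in M. u x = 0)"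
proof -
  interpret sigma_finite_measure M by fact
  obtain A :: "nat \<Rightarrow> 'a set" where A: "range A \<subseteq> sets M" "(\<Union>i. A i) = space M" "\<And>i. emeasure M (A i) \<noteq> \<infinity>"
    using sigma_finite by blast
  have "\<exists>i. emeasure M (A i) \<noteq> 0"
  proof (rule ccontr)
    assume "\<not> ?thesis"
    then have "emeasure M (\<Union>i. A i) = 0" using A(1) by (intro emeasure_UN_eq_0) auto
    then show False using assms(3) A(2) by simp
  qed
  then obtain i where i: "emeasure M (A i) \<noteq> 0" by blast
  have Ai: "A i \<in> sets M" using A(1) by auto
  define f where "f x = complex_of_real (indicator (A i) x)" for x
  have f2: "(cmod (f x))\<^sup>2 = indicator (A i) x" for x by (simp add: f_def indicator_def)
  have int_A: "integrable M (indicator (A i) :: 'a \<Rightarrow> real)" using Ai A(3)[of i] by (simp add: less_top)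
  have "f \<in> borel_measurable M" unfolding f_def using Ai by measurable
  then have f: "f \<in> L2 M" using int_A by (simp add: L2_def f2)
  have qf: "0 < quad\<^sub>2 f"
  proof -
    have "quad\<^sub>2 f = measure M (A i)"
      unfolding quad_L2 f2 using sets.sets_into_space[OF Ai] by (simp add: Int_absorb2)
    then show ?thesis using i A(3)[of i] by (simp add: measure_def enn2real_positive_iff less_top zero_less_iff_neq_zero)
  qed
  then have "0 < L2_norm M f" by (simp add: L2_norm_sqrt)
  then obtain u where u: "u \<in> D" "L2_norm M (\<lambda>x. f x - u x) < L2_norm M f"
    using assms(2) f unfolding dense_in_L2_def by blast
  have "\<not> (AE x in M. u x = 0)"
  proof
    assume u0: "AE x in M. u x = 0"
    have [measurable]: "u \<in> borel_measurable M" "f \<in> borel_measurable M"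
      using u(1) D_meas f by (auto dest: L2_measurable)
    have "quad\<^sub>2 (\<lambda>x. f x - u x) = quad\<^sub>2 f"
      unfolding quad_L2 using u0 by (intro integral_cong_AE) (auto elim!: eventually_mono)
    then show False using u(2) by (simp add: L2_norm_sqrt)
  qed
  then show ?thesis using u(1) by blast
qed

lemma sobolev_closed:
  assumes ne: "A \<noteq> {}" and A: "\<And>S. S \<in> A \<Longrightarrow> sobolev_interp M D t q \<theta> S"
  shows "sobolev_interp M D t q \<theta> (Sup A)"
  unfolding sobolev_interp_def
proof (intro ballI conjI)
    fix u assume u: "u \<in> D"
    define I where "I = (\<integral>x. cmod (u x) powr q \<partial>M) powr (2 / q)"
    define Y where "Y = quad t u powr \<theta> * L2_norm M u powr (2 * (1 - \<theta>))"
    have le: "S * I \<le> Y" if "S \<in> A" for S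
      using A[OF that] u unfolding sobolev_interp_def I_def Y_def by blast
    show "integrable M (\<lambda>x. cmod (u x) powr q)" using ne A u unfolding sobolev_interp_def by blast
    have "Sup A * I \<le> Y"
    proof (cases "I = 0")
      case True
      then show ?thesis using le ne by auto
    next
      case False
      then have pos: "0 < I" by (simp add: I_def)
      have "Sup A \<le> Y / I"
      proof (rule cSup_least[OF ne])
        fix S assume "S \<in> A"
        then show "S \<le> Y / I" using le pos by (simp add: pos_le_divide_eq)
      qed
      then show ?thesis using pos by (simp add: pos_le_divide_eq)
    qed
    then show "quad t u powr \<theta> * L2_norm M u powr (2 * (1 - \<theta>)) \<ge> Sup A * (\<integral>x. cmod (u x) powr q \<partial>M) powr (2 / q)"
      by (simp only: I_def Y_def)
qed

lemma weak_LT_closed: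
  assumes ne: "A \<noteq> {}" and A: "\<And>L. L \<in> A \<Longrightarrow> weak_LT M D t \<gamma> \<kappa> L" and A0: "\<And>L. L \<in> A \<Longrightarrow> 0 \<le> L"
  shows "weak_LT M D t \<gamma> \<kappa> (Inf A)"
  unfolding weak_LT_def
proof (intro ballI impI conjI allI)
  fix V :: "'a \<Rightarrow> real" assume V: "V \<in> borel_measurable M" "(AE x in M. 0 \<le> V x) \<and> integrable M (\<lambda>x. V x powr (\<gamma> + \<kappa>))"
  show "form_sum_exists M D t V" using ne A V unfolding weak_LT_def by blast
  fix \<tau> :: real assume \<tau>: "0 < \<tau>"
  define n where "n = eigenvalue_count M (form_operator M D (form_minus M t V)) (- \<tau>)"
  define c where "c = \<tau> powr (- \<gamma>) * (\<integral>x. V x powr (\<gamma> + \<kappa>) \<partial>M)"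
  have c0: "0 \<le> c" by (simp add: c_def)
  have le: "n \<le> ennreal (L * c)" if "L \<in> A" for L
    using A[OF that] V \<tau> unfolding weak_LT_def n_def c_def by (simp add: mult.assoc)
  obtain L0 where L0: "L0 \<in> A" using ne by blast
  have "n < \<infinity>" using le_less_trans[OF le[OF L0] ennreal_less_top] by simp
  then obtain \<nu> where \<nu>: "n = ennreal \<nu>" "0 \<le> \<nu>" by (cases n) auto
  have \<nu>_le: "\<nu> \<le> L * c" if "L \<in> A" for L
    using le[OF that] \<nu> A0[OF that] c0 by (simp add: ennreal_le_iff)
  have "\<nu> \<le> Inf A * c"
  proof (cases "c = 0")
    case True
    then show ?thesis using \<nu>_le[OF L0] by simp
  next
    case False
    then have cpos: "0 < c" using c0 by simp
    have "\<nu> / c \<le> Inf A"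
    proof (rule cInf_greatest[OF ne])
      fix L assume "L \<in> A"
      then show "\<nu> / c \<le> L" using \<nu>_le cpos by (simp add: pos_divide_le_eq)
    qed
    then show ?thesis using cpos by (simp add: pos_divide_le_eq)
  qed
  then show "eigenvalue_count M (form_operator M D (form_minus M t V)) (- \<tau>)
      \<le> ennreal (Inf A * \<tau> powr (- \<gamma>) * (\<integral>x. V x powr (\<gamma> + \<kappa>) \<partial>M))"
    unfolding n_def[symmetric] \<nu>(1) c_def mult.assoc[symmetric] by (intro ennreal_leI) (simp only: mult.assoc)
qed

text \<open>The constant in the Sobolev inequality that a constant \<open>L\<close> in the weak LT inequality yields.\<close>

definition sobolev_of_LT :: "real \<Rightarrow> real" where
  "sobolev_of_LT L = L powr (- 1 / p) / normalized 1"

lemma sobolev_of_LT: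
  assumes "0 < L" "weak_LT M D t \<gamma> \<kappa> L"
  shows "0 < sobolev_of_LT L" "normalized (sobolev_of_LT L) = L powr (- 1 / p)"
    "sobolev_interp M D t q \<theta> (sobolev_of_LT L)"
proof -
  have n1: "0 < normalized 1" by (rule normalized_pos) simp
  show "0 < sobolev_of_LT L" using n1 assms by (simp add: sobolev_of_LT_def)
  show n: "normalized (sobolev_of_LT L) = L powr (- 1 / p)"
    unfolding normalized_eq[of "sobolev_of_LT L"] unfolding sobolev_of_LT_def using n1 by simp
  show "sobolev_interp M D t q \<theta> (sobolev_of_LT L)"
    by (rule weak_LT_imp_sobolev[OF assms(2,1) n])
qed

lemma lower_constant:
  assumes "0 < L" "weak_LT M D t \<gamma> \<kappa> L" "sobolev_of_LT L \<le> S"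
  shows "normalized S powr (- p) \<le> L"
proof -
  have "normalized (sobolev_of_LT L) \<le> normalized S"
    using assms(3) normalized_pos[of 1] unfolding normalized_eq[of S] normalized_eq[of "sobolev_of_LT L"]
    by (intro mult_left_mono) auto
  then have "normalized S powr (- p) \<le> (L powr (- 1 / p)) powr (- p)"
    using sobolev_of_LT[OF assms(1,2)] assms(1) p(1) by (intro powr_mono2') auto
  also have "\<dots> = L" using assms(1) p(1) by (simp add: powr_powr)
  finally show ?thesis .
qed

lemma sobolev_iff_weak_LT:
  "(\<exists>S>0. sobolev_interp M D t q \<theta> S) \<longleftrightarrow> (\<exists>L>0. weak_LT M D t \<gamma> \<kappa> L)"
proof
  assume "\<exists>S>0. sobolev_interp M D t q \<theta> S"
  then obtain S where S: "0 < S" "sobolev_interp M D t q \<theta> S" by blast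
  have "0 < exp (p - 1) * normalized S powr (- p)" using normalized_pos[OF S(1)] by simp
  then show "\<exists>L>0. weak_LT M D t \<gamma> \<kappa> L" using sobolev_imp_weak_LT[OF S(2,1)] by blast
next
  assume "\<exists>L>0. weak_LT M D t \<gamma> \<kappa> L"
  then show "\<exists>S>0. sobolev_interp M D t q \<theta> S" using sobolev_of_LT by blast
qed

lemma sharp_constants_exist:
  assumes "sigma_finite_measure M" "dense_in_L2 M D" "emeasure M (space M) \<noteq> 0"
    and ex: "\<exists>S>0. sobolev_interp M D t q \<theta> S"
  shows "\<exists>S. sharp_sobolev M D t q \<theta> S" "\<exists>L. sharp_LT M D t \<gamma> \<kappa> L"
proof -
  define A where "A = {S. 0 < S \<and> sobolev_interp M D t q \<theta> S}"
  have Ane: "A \<noteq> {}" using ex by (auto simp: A_def)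
  obtain S0 where S0: "S0 \<in> A" using Ane by blast
  obtain u where u: "u \<in> D" "\<not> (AE x in M. u x = 0)" using exists_nonnull[OF assms(1-3)] by blast
  define I where "I = (\<integral>x. cmod (u x) powr q \<partial>M)"
  have int: "integrable M (\<lambda>x. cmod (u x) powr q)" using S0 u(1) unfolding A_def sobolev_interp_def by blast
  have "I \<noteq> 0"
  proof
    assume "I = 0"
    then have "AE x in M. cmod (u x) powr q = 0" using int by (simp add: I_def integral_nonneg_eq_0_iff_AE)
    then show False using u(2) by (auto elim: eventually_mono)
  qed
  then have I: "0 < I powr (2 / q)" by (simp add: I_def)
  have bdd: "bdd_above A"
  proof (rule bdd_aboveI)
    fix S assume "S \<in> A"
    then have "S * I powr (2 / q) \<le> quad t u powr \<theta> * L2_norm M u powr (2 * (1 - \<theta>))"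
      using u(1) unfolding A_def sobolev_interp_def I_def by blast
    then show "S \<le> quad t u powr \<theta> * L2_norm M u powr (2 * (1 - \<theta>)) / I powr (2 / q)"
      using I by (simp add: pos_le_divide_eq)
  qed
  have upper: "S \<le> Sup A" if "0 < S" "sobolev_interp M D t q \<theta> S" for S
    using that bdd by (intro cSup_upper) (auto simp: A_def)
  have "sobolev_interp M D t q \<theta> (Sup A)" using sobolev_closed[OF Ane] by (auto simp: A_def)
  moreover have pos: "0 < Sup A" using S0 upper[of S0] by (auto simp: A_def)
  ultimately show "\<exists>S. sharp_sobolev M D t q \<theta> S" using upper unfolding sharp_sobolev_def by blast
  define B where "B = {L. 0 < L \<and> weak_LT M D t \<gamma> \<kappa> L}"
  have Bne: "B \<noteq> {}" using ex sobolev_iff_weak_LT by (auto simp: B_def)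
  have low: "normalized (Sup A) powr (- p) \<le> L" if "L \<in> B" for L
    using that sobolev_of_LT[of L] upper by (intro lower_constant) (auto simp: B_def)
  have "0 < normalized (Sup A) powr (- p)" using normalized_pos[OF pos] by simp
  also have "\<dots> \<le> Inf B" using Bne low by (rule cInf_greatest)
  finally have "0 < Inf B" .
  moreover have "weak_LT M D t \<gamma> \<kappa> (Inf B)" by (rule weak_LT_closed[OF Bne]) (auto simp: B_def)
  moreover have "bdd_below B" using low by (rule bdd_belowI)
  then have "Inf B \<le> L" if "0 < L" "weak_LT M D t \<gamma> \<kappa> L" for L
    using that by (intro cInf_lower) (auto simp: B_def)
  ultimately show "\<exists>L. sharp_LT M D t \<gamma> \<kappa> L" unfolding sharp_LT_def by blast
qed

lemma sharp_constants_bounds: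
  assumes "sharp_sobolev M D t q \<theta> S" "sharp_LT M D t \<gamma> \<kappa> L"
  shows "normalized S powr (- p) \<le> L" "L \<le> exp (p - 1) * normalized S powr (- p)"
proof -
  have S: "0 < S" "sobolev_interp M D t q \<theta> S" "\<And>S'. 0 < S' \<Longrightarrow> sobolev_interp M D t q \<theta> S' \<Longrightarrow> S' \<le> S"
    using assms(1) by (auto simp: sharp_sobolev_def)
  have L: "0 < L" "weak_LT M D t \<gamma> \<kappa> L" "\<And>L'. 0 < L' \<Longrightarrow> weak_LT M D t \<gamma> \<kappa> L' \<Longrightarrow> L \<le> L'"
    using assms(2) by (auto simp: sharp_LT_def)
  show "normalized S powr (- p) \<le> L"
    using L(1,2) S(3) sobolev_of_LT[OF L(1,2)] by (intro lower_constant) auto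
  have "0 < exp (p - 1) * normalized S powr (- p)" using normalized_pos[OF S(1)] by simp
  then show "L \<le> exp (p - 1) * normalized S powr (- p)"
    by (rule L(3)[OF _ sobolev_imp_weak_LT[OF S(2,1)]])
qed

end

text \<open>
  Passing from \<open>u\<close> to \<open>Re u\<close> uses the first of the generalized Beurling--Deny conditions, passing from
  there to \<open>\<bar>Re u\<bar>\<close> the second.
\<close>

lemma beurling_deny_abs_Re:
  assumes bd: "gen_beurling_deny M D t p" and D_L2: "D \<subseteq> L2 M" and nn: "nonneg_form D t" and u: "u \<in> D"
  shows "(\<lambda>x. complex_of_real \<bar>Re (u x)\<bar>) \<in> D" "quad t (\<lambda>x. complex_of_real \<bar>Re (u x)\<bar>) \<le> quad t u"
proof -
  define v where "v = (\<lambda>x. complex_of_real (Re (u x)))"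
  define w where "w = (\<lambda>x. complex_of_real (Im (u x)))"
  have uL: "u \<in> L2 M" using u D_L2 by blast
  then have [measurable]: "u \<in> borel_measurable M" by (rule L2_measurable)
  have vw: "v \<in> L2 M" "w \<in> L2 M"
    unfolding v_def w_def
    by (auto intro!: L2_bound[OF uL, of _ 1] always_eventually simp: abs_Re_le_cmod abs_Im_le_cmod)
  have real: "ae_real M v" "ae_real M w" by (simp_all add: ae_real_def v_def w_def)
  have u_eq: "u = (\<lambda>x. v x + \<i> * w x)" by (auto simp: v_def w_def complex_eq_iff)
  have i: "((\<lambda>x. v x + \<i> * w x) \<in> D \<longleftrightarrow> v \<in> D \<and> w \<in> D) \<and>
      (v \<in> D \<and> w \<in> D \<longrightarrow> quad t (\<lambda>x. v x + \<i> * w x) = quad t v + quad t w)"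
    using bd vw real unfolding gen_beurling_deny_def by blast
  have D: "v \<in> D" "w \<in> D" using i u unfolding u_eq[symmetric] by auto
  have "quad t u = quad t v + quad t w" using i D unfolding u_eq[symmetric] by auto
  moreover have "0 \<le> quad t w" using nn D by (simp add: nonneg_form_def)
  ultimately have vu: "quad t v \<le> quad t u" by simp
  have "(\<lambda>x. complex_of_real (cmod (v x))) \<in> D \<and> quad t (\<lambda>x. complex_of_real (cmod (v x))) \<le> quad t v"
    using bd D(1) real(1) unfolding gen_beurling_deny_def by blast
  then show "(\<lambda>x. complex_of_real \<bar>Re (u x)\<bar>) \<in> D" "quad t (\<lambda>x. complex_of_real \<bar>Re (u x)\<bar>) \<le> quad t u"
    using vu by (auto simp: v_def)
qed

theorem theorem2p2:
  fixes M :: "'a measure"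
    and D :: "('a \<Rightarrow> complex) set"
    and t :: "('a \<Rightarrow> complex) \<Rightarrow> ('a \<Rightarrow> complex) \<Rightarrow> complex"
    and \<gamma> \<kappa> q \<theta> :: real
  assumes "sigma_finite_measure M"
    and "hermitian_form M D t" and "dense_in_L2 M D"
    and "nonneg_form D t" and "closed_form M D t"
    and "0 < \<kappa>" and "0 < \<gamma>" and "2 < q" and "0 < \<theta>" and "\<theta> < 1"
    and "\<gamma> = q * (1 - \<theta>) / (q - 2)" and "\<kappa> = q * \<theta> / (q - 2)"
    and "1 < \<gamma> + \<kappa>"
    and "gen_beurling_deny M D t (\<gamma> + \<kappa>)"
  shows "((\<exists>S>0. sobolev_interp M D t q \<theta> S) \<longleftrightarrow> (\<exists>L>0. weak_LT M D t \<gamma> \<kappa> L)) \<and>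
    ((\<exists>S>0. sobolev_interp M D t q \<theta> S) \<and> emeasure M (space M) \<noteq> 0 \<longrightarrow>
      (\<exists>S. sharp_sobolev M D t q \<theta> S) \<and> (\<exists>L. sharp_LT M D t \<gamma> \<kappa> L)) \<and>
    (\<forall>S L. sharp_sobolev M D t q \<theta> S \<and> sharp_LT M D t \<gamma> \<kappa> L \<longrightarrow>
      (\<theta> powr (- \<theta>) * (1 - \<theta>) powr (- 1 + \<theta>) * S) powr (- \<gamma> - \<kappa>) \<le> L \<and>
      L \<le> exp (\<gamma> + \<kappa> - 1) *
          (\<theta> powr (- \<theta>) * (1 - \<theta>) powr (- 1 + \<theta>) * S) powr (- \<gamma> - \<kappa>))"
proof -
  define p where "p = \<gamma> + \<kappa>"
  have p_eq: "p = q / (q - 2)"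
    unfolding p_def assms(11,12) by (simp add: field_simps flip: add_divide_distrib)
  have D_L2: "D \<subseteq> L2 M" using assms(2) by (simp add: hermitian_form_def)
  interpret markov_form M D t \<gamma> \<kappa> q \<theta> p
  proof
    show "q = 2 * p / (p - 1)" using \<open>2 < q\<close> by (simp add: p_eq field_simps)
    show "\<theta> = \<kappa> / p" using \<open>2 < q\<close> by (simp add: p_eq assms(12))
    show "1 < p" "p = \<gamma> + \<kappa>" using assms by (simp_all add: p_def)
    show "(\<lambda>x. complex_of_real \<bar>Re (u x)\<bar>) \<in> D" "quad t (\<lambda>x. complex_of_real \<bar>Re (u x)\<bar>) \<le> quad t u"
      if "u \<in> D" for u
      using beurling_deny_abs_Re[OF assms(14) D_L2 assms(4) that] by auto
  qed (fact assms)+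
  have exps: "- \<gamma> - \<kappa> = - p" "\<gamma> + \<kappa> - 1 = p - 1" by (simp_all add: p_def)
  show ?thesis
    unfolding exps normalized_def[symmetric]
    using sobolev_iff_weak_LT sharp_constants_exist[OF assms(1,3)] sharp_constants_bounds by blast
qed

end
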